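(* (Over $\mathrm{ZFC}$.) If $\mathrm{Ord}$ is essentially faint, then unboundedly many ordinals are strongly inaccessible cardinals in $\mathrm{HOD}$.
   Context: "$\mathrm{Ord}$ is essentially faint" is the scheme: for every (parameter-definable) class sequence $\langle E_\alpha\mid\alpha\in\mathrm{Ord}\rangle$ with $\emptyset\neq E_\alpha\subseteq\mathcal P(\alpha)$ and every ordinal $\xi$ there are ordinals $\xi<\alpha<\beta$ and $A\in E_\beta$ with $A\cap\alpha\in E_\alpha$. $\mathrm{HOD}$ is the class of hereditarily ordinal definable sets. *)

theory Defs
  imports Main
begin

text \<open>
  Set theory is treated semantically: a structure is a carrier \<open>M\<close> with a binary relation
  \<open>E\<close> (\<open>E x y\<close> is read ``\<open>x\<close> is an element of \<open>y\<close>''), and a theorem of ZFC is a statement true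
  in every model of ZFC, which need be neither well-founded nor an \<open>\<omega>\<close>-model. All
  set-theoretic notions take the carrier as an argument, with quantifiers bounded by it; so for a
  subclass \<open>N \<subseteq> M\<close>, instantiating the carrier with \<open>N\<close> gives the usual relativization to \<open>N\<close>.
\<close>

subsection \<open>First-order formulas\<close>

datatype fm =
    Mem nat nat
  | Eql nat nat
  | Neg fm
  | Conj fm fm
  | All nat fm

text \<open>
  Assignments are total, but only the finitely many variables occurring in a formula matter, so
  quantifying over assignments amounts to quantifying over finite tuples of parameters.
\<close>

primrec sat :: "'a set \<Rightarrow> ('a \<Rightarrow> 'a \<Rightarrow> bool) \<Rightarrow> (nat \<Rightarrow> 'a) \<Rightarrow> fm \<Rightarrow> bool" where
  "sat M E s (Mem i j) \<longleftrightarrow> E (s i) (s j)"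
| "sat M E s (Eql i j) \<longleftrightarrow> s i = s j"
| "sat M E s (Neg p) \<longleftrightarrow> \<not> sat M E s p"
| "sat M E s (Conj p q) \<longleftrightarrow> sat M E s p \<and> sat M E s q"
| "sat M E s (All n p) \<longleftrightarrow> (\<forall>a\<in>M. sat M E (s(n := a)) p)"


subsection \<open>Basic set-theoretic notions\<close>

definition subset_in :: "'a set \<Rightarrow> ('a \<Rightarrow> 'a \<Rightarrow> bool) \<Rightarrow> 'a \<Rightarrow> 'a \<Rightarrow> bool" where
  "subset_in M E x y \<longleftrightarrow> (\<forall>z\<in>M. E z x \<longrightarrow> E z y)"

definition is_empty :: "'a set \<Rightarrow> ('a \<Rightarrow> 'a \<Rightarrow> bool) \<Rightarrow> 'a \<Rightarrow> bool" where
  "is_empty M E x \<longleftrightarrow> (\<forall>z\<in>M. \<not> E z x)"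

definition is_inter :: "'a set \<Rightarrow> ('a \<Rightarrow> 'a \<Rightarrow> bool) \<Rightarrow> 'a \<Rightarrow> 'a \<Rightarrow> 'a \<Rightarrow> bool" where
  "is_inter M E x y w \<longleftrightarrow> (\<forall>z\<in>M. E z w \<longleftrightarrow> E z x \<and> E z y)"

definition is_power :: "'a set \<Rightarrow> ('a \<Rightarrow> 'a \<Rightarrow> bool) \<Rightarrow> 'a \<Rightarrow> 'a \<Rightarrow> bool" where
  "is_power M E x p \<longleftrightarrow> (\<forall>z\<in>M. E z p \<longleftrightarrow> subset_in M E z x)"

definition is_succ :: "'a set \<Rightarrow> ('a \<Rightarrow> 'a \<Rightarrow> bool) \<Rightarrow> 'a \<Rightarrow> 'a \<Rightarrow> bool" where
  "is_succ M E x y \<longleftrightarrow> (\<forall>z\<in>M. E z y \<longleftrightarrow> E z x \<or> z = x)"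

definition is_upair :: "'a set \<Rightarrow> ('a \<Rightarrow> 'a \<Rightarrow> bool) \<Rightarrow> 'a \<Rightarrow> 'a \<Rightarrow> 'a \<Rightarrow> bool" where
  "is_upair M E a b u \<longleftrightarrow> (\<forall>z\<in>M. E z u \<longleftrightarrow> z = a \<or> z = b)"

text \<open>Kuratowski pairs: \<open>p = {{a}, {a, b}}\<close>.\<close>

definition is_pair :: "'a set \<Rightarrow> ('a \<Rightarrow> 'a \<Rightarrow> bool) \<Rightarrow> 'a \<Rightarrow> 'a \<Rightarrow> 'a \<Rightarrow> bool" where
  "is_pair M E a b p \<longleftrightarrow>
     (\<exists>u\<in>M. \<exists>v\<in>M. is_upair M E a a u \<and> is_upair M E a b v \<and> is_upair M E u v p)"

definition transitive_in :: "'a set \<Rightarrow> ('a \<Rightarrow> 'a \<Rightarrow> bool) \<Rightarrow> 'a \<Rightarrow> bool" where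
  "transitive_in M E x \<longleftrightarrow> (\<forall>y\<in>M. E y x \<longrightarrow> subset_in M E y x)"

text \<open>
  The transitive closure is that of the structure (the least transitive set \<open>t\<close> of \<open>M\<close>
  including \<open>x\<close>), not the closure under \<open>E\<close> computed outside \<open>M\<close>.
\<close>

definition is_trcl :: "'a set \<Rightarrow> ('a \<Rightarrow> 'a \<Rightarrow> bool) \<Rightarrow> 'a \<Rightarrow> 'a \<Rightarrow> bool" where
  "is_trcl M E x t \<longleftrightarrow>
     transitive_in M E t \<and> subset_in M E x t \<and>
     (\<forall>u\<in>M. transitive_in M E u \<and> subset_in M E x u \<longrightarrow> subset_in M E t u)"

definition is_app :: "'a set \<Rightarrow> ('a \<Rightarrow> 'a \<Rightarrow> bool) \<Rightarrow> 'a \<Rightarrow> 'a \<Rightarrow> 'a \<Rightarrow> bool" where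
  "is_app M E f a b \<longleftrightarrow> (\<exists>p\<in>M. is_pair M E a b p \<and> E p f)"

definition is_fun :: "'a set \<Rightarrow> ('a \<Rightarrow> 'a \<Rightarrow> bool) \<Rightarrow> 'a \<Rightarrow> 'a \<Rightarrow> 'a \<Rightarrow> bool" where
  "is_fun M E f A B \<longleftrightarrow>
     (\<forall>p\<in>M. E p f \<longrightarrow> (\<exists>a\<in>M. \<exists>b\<in>M. E a A \<and> E b B \<and> is_pair M E a b p)) \<and>
     (\<forall>a\<in>M. E a A \<longrightarrow> (\<exists>!b. b \<in> M \<and> is_app M E f a b))"

definition is_bij :: "'a set \<Rightarrow> ('a \<Rightarrow> 'a \<Rightarrow> bool) \<Rightarrow> 'a \<Rightarrow> 'a \<Rightarrow> 'a \<Rightarrow> bool" where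
  "is_bij M E f A B \<longleftrightarrow>
     is_fun M E f A B \<and> (\<forall>b\<in>M. E b B \<longrightarrow> (\<exists>!a. a \<in> M \<and> is_app M E f a b))"

definition equipotent :: "'a set \<Rightarrow> ('a \<Rightarrow> 'a \<Rightarrow> bool) \<Rightarrow> 'a \<Rightarrow> 'a \<Rightarrow> bool" where
  "equipotent M E A B \<longleftrightarrow> (\<exists>f\<in>M. is_bij M E f A B)"


subsection \<open>Models of ZFC\<close>

definition extensionality :: "'a set \<Rightarrow> ('a \<Rightarrow> 'a \<Rightarrow> bool) \<Rightarrow> bool" where
  "extensionality M E \<longleftrightarrow> (\<forall>x\<in>M. \<forall>y\<in>M. (\<forall>z\<in>M. E z x \<longleftrightarrow> E z y) \<longrightarrow> x = y)"

definition foundation :: "'a set \<Rightarrow> ('a \<Rightarrow> 'a \<Rightarrow> bool) \<Rightarrow> bool" where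
  "foundation M E \<longleftrightarrow>
     (\<forall>x\<in>M. \<not> is_empty M E x \<longrightarrow> (\<exists>y\<in>M. E y x \<and> (\<forall>z\<in>M. \<not> (E z y \<and> E z x))))"

definition pairing :: "'a set \<Rightarrow> ('a \<Rightarrow> 'a \<Rightarrow> bool) \<Rightarrow> bool" where
  "pairing M E \<longleftrightarrow> (\<forall>a\<in>M. \<forall>b\<in>M. \<exists>u\<in>M. is_upair M E a b u)"

definition union_axiom :: "'a set \<Rightarrow> ('a \<Rightarrow> 'a \<Rightarrow> bool) \<Rightarrow> bool" where
  "union_axiom M E \<longleftrightarrow> (\<forall>x\<in>M. \<exists>u\<in>M. \<forall>z\<in>M. E z u \<longleftrightarrow> (\<exists>y\<in>M. E y x \<and> E z y))"

definition power_axiom :: "'a set \<Rightarrow> ('a \<Rightarrow> 'a \<Rightarrow> bool) \<Rightarrow> bool" where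
  "power_axiom M E \<longleftrightarrow> (\<forall>x\<in>M. \<exists>p\<in>M. is_power M E x p)"

definition infinity_axiom :: "'a set \<Rightarrow> ('a \<Rightarrow> 'a \<Rightarrow> bool) \<Rightarrow> bool" where
  "infinity_axiom M E \<longleftrightarrow>
     (\<exists>w\<in>M. (\<exists>x\<in>M. is_empty M E x \<and> E x w) \<and>
            (\<forall>x\<in>M. E x w \<longrightarrow> (\<exists>y\<in>M. is_succ M E x y \<and> E y w)))"

definition separation :: "'a set \<Rightarrow> ('a \<Rightarrow> 'a \<Rightarrow> bool) \<Rightarrow> bool" where
  "separation M E \<longleftrightarrow>
     (\<forall>p s. range s \<subseteq> M \<longrightarrow>
        (\<forall>x\<in>M. \<exists>y\<in>M. \<forall>z\<in>M. E z y \<longleftrightarrow> E z x \<and> sat M E (s(0 := z)) p))"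

definition replacement :: "'a set \<Rightarrow> ('a \<Rightarrow> 'a \<Rightarrow> bool) \<Rightarrow> bool" where
  "replacement M E \<longleftrightarrow>
     (\<forall>p s. range s \<subseteq> M \<longrightarrow>
        (\<forall>a\<in>M. (\<forall>x\<in>M. E x a \<longrightarrow> (\<exists>!y. y \<in> M \<and> sat M E (s(0 := x, 1 := y)) p)) \<longrightarrow>
           (\<exists>b\<in>M. \<forall>y\<in>M. E y b \<longleftrightarrow> (\<exists>x\<in>M. E x a \<and> sat M E (s(0 := x, 1 := y)) p))))"

text \<open>Every family of nonempty, pairwise disjoint sets has a transversal.\<close>

definition choice_axiom :: "'a set \<Rightarrow> ('a \<Rightarrow> 'a \<Rightarrow> bool) \<Rightarrow> bool" where
  "choice_axiom M E \<longleftrightarrow>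
     (\<forall>x\<in>M.
        (\<forall>y\<in>M. E y x \<longrightarrow> \<not> is_empty M E y) \<and>
        (\<forall>y\<in>M. \<forall>y'\<in>M. E y x \<and> E y' x \<and> y \<noteq> y' \<longrightarrow> (\<forall>z\<in>M. \<not> (E z y \<and> E z y'))) \<longrightarrow>
        (\<exists>c\<in>M. \<forall>y\<in>M. E y x \<longrightarrow> (\<exists>!z. z \<in> M \<and> E z y \<and> E z c)))"

definition ZFC_model :: "'a set \<Rightarrow> ('a \<Rightarrow> 'a \<Rightarrow> bool) \<Rightarrow> bool" where
  "ZFC_model M E \<longleftrightarrow>
     extensionality M E \<and> foundation M E \<and> pairing M E \<and> union_axiom M E \<and>
     power_axiom M E \<and> infinity_axiom M E \<and> separation M E \<and> replacement M E \<and>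
     choice_axiom M E"


subsection \<open>Ordinals and strongly inaccessible cardinals\<close>

text \<open>The ordinals of the structure: transitive sets well-ordered by membership.\<close>

definition Ords :: "'a set \<Rightarrow> ('a \<Rightarrow> 'a \<Rightarrow> bool) \<Rightarrow> 'a set" where
  "Ords M E = {x \<in> M. transitive_in M E x \<and>
     (\<forall>a\<in>M. E a x \<longrightarrow> \<not> E a a) \<and>
     (\<forall>a\<in>M. \<forall>b\<in>M. \<forall>c\<in>M. E a x \<and> E b x \<and> E c x \<and> E a b \<and> E b c \<longrightarrow> E a c) \<and>
     (\<forall>a\<in>M. \<forall>b\<in>M. E a x \<and> E b x \<longrightarrow> E a b \<or> a = b \<or> E b a) \<and>
     (\<forall>u\<in>M. subset_in M E u x \<and> \<not> is_empty M E u \<longrightarrow>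
        (\<exists>a\<in>M. E a u \<and> (\<forall>b\<in>M. E b u \<longrightarrow> a = b \<or> E a b)))}"

definition is_limit :: "'a set \<Rightarrow> ('a \<Rightarrow> 'a \<Rightarrow> bool) \<Rightarrow> 'a \<Rightarrow> bool" where
  "is_limit M E x \<longleftrightarrow>
     x \<in> Ords M E \<and> \<not> is_empty M E x \<and> (\<forall>y\<in>M. E y x \<longrightarrow> (\<exists>z\<in>M. E z x \<and> E y z))"

definition is_omega :: "'a set \<Rightarrow> ('a \<Rightarrow> 'a \<Rightarrow> bool) \<Rightarrow> 'a \<Rightarrow> bool" where
  "is_omega M E w \<longleftrightarrow> is_limit M E w \<and> (\<forall>x\<in>M. E x w \<longrightarrow> \<not> is_limit M E x)"

definition is_cardinal :: "'a set \<Rightarrow> ('a \<Rightarrow> 'a \<Rightarrow> bool) \<Rightarrow> 'a \<Rightarrow> bool" where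
  "is_cardinal M E k \<longleftrightarrow> k \<in> Ords M E \<and> (\<forall>a\<in>M. E a k \<longrightarrow> \<not> equipotent M E a k)"

text \<open>No function from a smaller ordinal into the cardinal \<open>k\<close> has range unbounded in \<open>k\<close>.\<close>

definition is_regular :: "'a set \<Rightarrow> ('a \<Rightarrow> 'a \<Rightarrow> bool) \<Rightarrow> 'a \<Rightarrow> bool" where
  "is_regular M E k \<longleftrightarrow>
     is_cardinal M E k \<and> is_limit M E k \<and>
     (\<forall>a\<in>M. \<forall>f\<in>M. E a k \<and> is_fun M E f a k \<longrightarrow>
        (\<exists>b\<in>M. E b k \<and> (\<forall>x\<in>M. \<forall>y\<in>M. is_app M E f x y \<longrightarrow> E y b)))"

text \<open>\<open>2\<^sup>l < k\<close> for every cardinal \<open>l < k\<close>.\<close>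

definition is_strong_limit :: "'a set \<Rightarrow> ('a \<Rightarrow> 'a \<Rightarrow> bool) \<Rightarrow> 'a \<Rightarrow> bool" where
  "is_strong_limit M E k \<longleftrightarrow>
     is_cardinal M E k \<and>
     (\<forall>l\<in>M. is_cardinal M E l \<and> E l k \<longrightarrow>
        (\<exists>p\<in>M. \<exists>m\<in>M. is_power M E l p \<and> is_cardinal M E m \<and> equipotent M E p m \<and> E m k))"

definition strongly_inaccessible :: "'a set \<Rightarrow> ('a \<Rightarrow> 'a \<Rightarrow> bool) \<Rightarrow> 'a \<Rightarrow> bool" where
  "strongly_inaccessible M E k \<longleftrightarrow>
     (\<exists>w\<in>M. is_omega M E w \<and> E w k) \<and> is_regular M E k \<and> is_strong_limit M E k"


subsection \<open>Hereditarily ordinal definable sets\<close>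

text \<open>
  A set is ordinal definable if it is the unique solution in \<open>M\<close> of a formula with ordinal
  parameters. Although the formula ranges over genuine formulas, in a model of ZFC this is the
  same class as the internal one, given by definability in some \<open>V\<^sub>\<theta>\<close>, even if \<open>M\<close> has
  nonstandard integers: one inclusion is the reflection theorem; for the other, \<open>\<theta>\<close>, the
  (possibly nonstandard) formula code and the code of the finite sequence of ordinals are
  themselves ordinal parameters of one fixed formula.
\<close>

definition OD :: "'a set \<Rightarrow> ('a \<Rightarrow> 'a \<Rightarrow> bool) \<Rightarrow> 'a set" where
  "OD M E = {x \<in> M. \<exists>p s. range s \<subseteq> Ords M E \<and>
                (\<forall>y\<in>M. sat M E (s(0 := y)) p \<longleftrightarrow> y = x)}"

definition HOD :: "'a set \<Rightarrow> ('a \<Rightarrow> 'a \<Rightarrow> bool) \<Rightarrow> 'a set" where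
  "HOD M E = {x \<in> OD M E. \<exists>t\<in>M. is_trcl M E x t \<and> (\<forall>y\<in>M. E y t \<longrightarrow> y \<in> OD M E)}"


subsection \<open>Essential faintness of Ord\<close>

text \<open>\<open>F\<close> restricted to the ordinals is a class function definable over \<open>M\<close> with parameters.\<close>

definition definable_Ord_sequence ::
    "'a set \<Rightarrow> ('a \<Rightarrow> 'a \<Rightarrow> bool) \<Rightarrow> ('a \<Rightarrow> 'a) \<Rightarrow> bool" where
  "definable_Ord_sequence M E F \<longleftrightarrow>
     (\<forall>a\<in>Ords M E. F a \<in> M) \<and>
     (\<exists>p s. range s \<subseteq> M \<and>
        (\<forall>a\<in>Ords M E. \<forall>y\<in>M. sat M E (s(0 := a, 1 := y)) p \<longleftrightarrow> y = F a))"

definition Ord_essentially_faint :: "'a set \<Rightarrow> ('a \<Rightarrow> 'a \<Rightarrow> bool) \<Rightarrow> bool" where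
  "Ord_essentially_faint M E \<longleftrightarrow>
     (\<forall>F. definable_Ord_sequence M E F \<and>
          (\<forall>a\<in>Ords M E. \<not> is_empty M E (F a) \<and> (\<forall>A\<in>M. E A (F a) \<longrightarrow> subset_in M E A a)) \<longrightarrow>
        (\<forall>\<xi>\<in>Ords M E. \<exists>\<alpha>\<in>Ords M E. \<exists>\<beta>\<in>Ords M E. E \<xi> \<alpha> \<and> E \<alpha> \<beta> \<and>
           (\<exists>A\<in>M. \<exists>B\<in>M. E A (F \<beta>) \<and> is_inter M E A \<alpha> B \<and> E B (F \<alpha>))))"

end

theory Submission
  imports Defs
begin

text \<open>
  Suppose no ordinal above \<open>y \<ge> \<omega>\<close> is strongly inaccessible in HOD. For \<open>k > y\<close> let \<open>F k\<close> consist of the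
  subsets of \<open>k\<close> that code a reason for this failure: the predecessor of \<open>k\<close>; the cofinality \<open>a\<close> of \<open>k\<close>
  in HOD together with the range of an increasing cofinal map in HOD; or a limit \<open>l < k\<close> and a
  subset of \<open>l\<close> that has rank \<open>k\<close> in the canonical well-order of the power set of \<open>l\<close> in HOD (rank \<open>0\<close>
  if \<open>k\<close> is its order type). If \<open>k < k'\<close> and a code of \<open>k'\<close> restricts to a code of \<open>k\<close>, then in the
  second case the map for \<open>k'\<close>, cut off where it reaches \<open>k\<close>, is a cofinal map into \<open>k\<close> with domain
  smaller than \<open>a\<close>, and in the third case \<open>k\<close> and \<open>k'\<close> are read off from the same subset of the
  same \<open>l\<close>.

  For \<open>F\<close> to be definable, the class of ordinal definable sets must have a definable enumeration \<open>U\<close>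
  along the ordinals. Instead of the reflection theorem, each quantifier of a
  formula gets its own bound \<open>V c\<close>, which collection provides. The satisfaction relation of
  such bounded formulas, coded by ordinals, is a recursion along the ordinals.
\<close>

text \<open>Since \<open>F k\<close> may hold all reasons for failure at once, no choice among
  cofinal maps or subsets is ever made. What does have to be canonical is the order of the power set
  of \<open>l\<close>, because the same subset of \<open>l\<close> must have one rank for both
  \<open>k\<close> and \<open>k'\<close>; HOD supplies such an order through least indices under
  \<open>U\<close>. In the cofinality case the contradiction is with minimality: \<open>a\<close> is
  least for \<open>k\<close>, and it can be read off from the part that the two codes share. If
  \<open>k\<close> is the order type itself, no subset has rank \<open>k\<close>; rank 0 is free for
  this purpose, because a limit \<open>k\<close> is never 0. Order types of power sets stand in for
  cardinals, and it suffices to bound them at limit ordinals \<open>l\<close>, which are unbounded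
  in every \<open>k > \<omega>\<close> that is regular in HOD. Since \<open>M\<close> may be
  ill-founded, induction, recursion and least elements are available for definable classes only;
  closure rules for \<open>D\<close> and \<open>DT\<close> carry this bookkeeping in place of
  explicit formulas.\<close>

primrec vars :: "fm \<Rightarrow> nat set" where
  "vars (Mem i j) = {i, j}"
| "vars (Eql i j) = {i, j}"
| "vars (Neg p) = vars p"
| "vars (Conj p q) = vars p \<union> vars q"
| "vars (All n p) = insert n (vars p)"

lemma finite_vars: "finite (vars p)"
  by (induction p) auto

primrec ren :: "(nat \<Rightarrow> nat) \<Rightarrow> fm \<Rightarrow> fm" where
  "ren f (Mem i j) = Mem (f i) (f j)"
| "ren f (Eql i j) = Eql (f i) (f j)"
| "ren f (Neg p) = Neg (ren f p)"
| "ren f (Conj p q) = Conj (ren f p) (ren f q)"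
| "ren f (All n p) = All (f n) (ren f p)"

lemma sat_cong: "(\<And>i. i \<in> vars p \<Longrightarrow> s i = s' i) \<Longrightarrow> sat M E s p = sat M E s' p"
proof (induction p arbitrary: s s')
  case (All n p)
  have "sat M E (s(n := a)) p = sat M E (s'(n := a)) p" for a
    by (rule All.IH) (use All.prems in auto)
  then show ?case by simp
next
  case (Conj p q)
  then show ?case by (metis UnCI sat.simps(4) vars.simps(4))
next
  case (Neg p)
  then show ?case by (metis sat.simps(3) vars.simps(3))
qed simp_all

text \<open>\<open>ren\<close> also renames bound variables; injectivity on all of
  \<open>vars p\<close> is what prevents capture.\<close>

lemma sat_ren: "inj_on f (vars p) \<Longrightarrow> sat M E s (ren f p) = sat M E (s \<circ> f) p"
proof (induction p arbitrary: s)
  case (All n p)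
  have inj: "inj_on f (vars p)" using All.prems by (simp add: inj_on_insert)
  have "sat M E (s(f n := a)) (ren f p) = sat M E ((s \<circ> f)(n := a)) p" for a
    unfolding All.IH[OF inj]
    by (rule sat_cong) (use All.prems in \<open>auto simp: inj_on_def\<close>)
  then show ?case by (simp add: comp_def)
qed (auto simp: inj_on_Un)

text \<open>Even variables carry the arguments of a definable predicate, odd ones its parameters.\<close>

definition mix :: "(nat \<Rightarrow> 'a) \<Rightarrow> (nat \<Rightarrow> 'a) \<Rightarrow> nat \<Rightarrow> 'a" where
  "mix c s n = (if even n then s (n div 2) else c (n div 2))"

lemma range_mix: "range c \<subseteq> A \<Longrightarrow> range s \<subseteq> A \<Longrightarrow> range (mix c s) \<subseteq> A"
  by (auto simp: mix_def)

lemma range_upd: "range s \<subseteq> A \<Longrightarrow> x \<in> A \<Longrightarrow> range (s(n := x)) \<subseteq> A"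
  by auto

section \<open>Sets of the model and their extensions\<close>

locale zfc =
  fixes M :: "'a set" and E :: "'a \<Rightarrow> 'a \<Rightarrow> bool"
  assumes zfc: "ZFC_model M E"
begin

abbreviation "Ord \<equiv> Ords M E"

text \<open>Elements of the model are handled through their extensions; the axioms then say which
  HOL sets satisfy \<open>isset\<close>.\<close>

definition ext :: "'a \<Rightarrow> 'a set" where
  "ext y = {z \<in> M. E z y}"

definition isset :: "'a set \<Rightarrow> bool" where
  "isset A \<longleftrightarrow> (\<exists>y\<in>M. ext y = A)"

lemma ext_iff: "z \<in> ext y \<longleftrightarrow> z \<in> M \<and> E z y"
  by (simp add: ext_def)

lemma ext_M [dest]: "z \<in> ext y \<Longrightarrow> z \<in> M"
  by (simp add: ext_def)

lemma ext_inj: "x \<in> M \<Longrightarrow> y \<in> M \<Longrightarrow> ext x = ext y \<Longrightarrow> x = y"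
  using zfc unfolding ZFC_model_def extensionality_def ext_def by blast

lemma isset_ext [simp, intro]: "y \<in> M \<Longrightarrow> isset (ext y)"
  by (auto simp: isset_def)

lemma isset_empty [simp, intro]: "isset {}"
proof -
  have "\<exists>x\<in>M. is_empty M E x"
    using zfc unfolding ZFC_model_def infinity_axiom_def by blast
  then show ?thesis by (auto simp: isset_def is_empty_def ext_def)
qed

definition e0 :: 'a where "e0 = (THE y. y \<in> M \<and> ext y = {})"

lemma e0: "e0 \<in> M" "ext e0 = {}"
proof -
  have "\<exists>!y. y \<in> M \<and> ext y = {}"
    using isset_empty ext_inj unfolding isset_def by metis
  from theI'[OF this] show "e0 \<in> M" "ext e0 = {}" by (auto simp: e0_def)
qed

declare e0 [simp]

lemma e0_Ord [simp]: "e0 \<in> Ord"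
proof -
  have "\<And>z. z \<in> M \<Longrightarrow> \<not> E z e0" using e0(2) by (auto simp: ext_def)
  then show ?thesis unfolding Ords_def transitive_in_def subset_in_def is_empty_def by auto
qed

lemma Ord_sub: "Ord \<subseteq> M" by (auto simp: Ords_def)

lemma Ord_M [simp, dest]: "x \<in> Ord \<Longrightarrow> x \<in> M" by (auto simp: Ords_def)

text \<open>The code of a set; the empty set for proper classes.\<close>

definition mk :: "'a set \<Rightarrow> 'a" where
  "mk A = (if isset A then THE y. y \<in> M \<and> ext y = A else e0)"

lemma mk_ext [simp]: "y \<in> M \<Longrightarrow> mk (ext y) = y"
  unfolding mk_def using ext_inj by (auto intro!: the_equality)

lemma mk_M [simp]: "mk A \<in> M"
  by (metis e0(1) isset_def mk_def mk_ext)

lemma ext_mk: "isset A \<Longrightarrow> ext (mk A) = A"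
  by (metis isset_def mk_ext)

text \<open>A total description operator: thanks to the default \<open>e0\<close>, terms built with
  it are definable before unique existence has been proved.\<close>

definition thep :: "('a \<Rightarrow> bool) \<Rightarrow> 'a" where
  "thep P = (if \<exists>!x. x \<in> M \<and> P x then THE x. x \<in> M \<and> P x else e0)"

lemma thep_M [simp]: "thep P \<in> M"
proof (cases "\<exists>!x. x \<in> M \<and> P x")
  case True
  from theI'[OF True] True show ?thesis unfolding thep_def by simp
qed (simp add: thep_def)

lemma thep_eq: "x \<in> M \<Longrightarrow> P x \<Longrightarrow> (\<And>y. y \<in> M \<Longrightarrow> P y \<Longrightarrow> y = x) \<Longrightarrow> thep P = x"
proof -
  assume x: "x \<in> M" "P x" and u: "\<And>y. y \<in> M \<Longrightarrow> P y \<Longrightarrow> y = x"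
  have "(THE x. x \<in> M \<and> P x) = x" by (rule the_equality) (use x u in blast)+
  moreover have "\<exists>!x. x \<in> M \<and> P x" by (rule ex1I[of _ x]) (use x u in blast)+
  ultimately show ?thesis by (simp add: thep_def)
qed

subsection \<open>Definability\<close>

text \<open>
  In \<open>D b P\<close> and \<open>DT b t\<close> a predicate or function of assignments is definable with parameters from
  \<open>M\<close> if \<open>b\<close> holds, and with ordinal parameters otherwise. Thus \<open>b = True\<close> is what separation and
  replacement need, while \<open>x\<close> is ordinal definable iff \<open>DT False (\<lambda>s. x)\<close>. Quantifiers are treated
  in de Bruijn style: below a binder, position \<open>0\<close> of the assignment is the bound variable.
\<close>

definition PB :: "bool \<Rightarrow> 'a set" where
  "PB b = (if b then M else Ord)"

definition D :: "bool \<Rightarrow> ((nat \<Rightarrow> 'a) \<Rightarrow> bool) \<Rightarrow> bool" where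
  "D b P \<longleftrightarrow> (\<exists>p c. range c \<subseteq> PB b \<and> (\<forall>s. range s \<subseteq> M \<longrightarrow> sat M E (mix c s) p = P s))"

definition DT :: "bool \<Rightarrow> ((nat \<Rightarrow> 'a) \<Rightarrow> 'a) \<Rightarrow> bool" where
  "DT b t \<longleftrightarrow> (\<forall>s. range s \<subseteq> M \<longrightarrow> t s \<in> M) \<and> D b (\<lambda>s. s 0 = t (\<lambda>n. s (Suc n)))"

named_theorems dfn

lemma PB_sub: "PB b \<subseteq> M" using Ord_sub by (auto simp: PB_def)

lemma e0_PB: "e0 \<in> PB b" by (auto simp: PB_def)

lemma D_cong: "D b P \<Longrightarrow> (\<And>s. range s \<subseteq> M \<Longrightarrow> Q s = P s) \<Longrightarrow> D b Q"
  unfolding D_def by metis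

lemma D_mono: "D False P \<Longrightarrow> D b P"
  unfolding D_def PB_def using Ord_sub by (cases b) (auto, blast)

lemma D_neg [dfn]: "D b P \<Longrightarrow> D b (\<lambda>s. \<not> P s)"
  unfolding D_def by (metis sat.simps(3))

lemma D_conj [dfn]:
  assumes "D b P" "D b Q" shows "D b (\<lambda>s. P s \<and> Q s)"
proof -
  obtain p c where p: "range c \<subseteq> PB b" "\<And>s. range s \<subseteq> M \<Longrightarrow> sat M E (mix c s) p = P s"
    using assms(1) unfolding D_def by blast
  obtain q d where q: "range d \<subseteq> PB b" "\<And>s. range s \<subseteq> M \<Longrightarrow> sat M E (mix d s) q = Q s"
    using assms(2) unfolding D_def by blast
  \<comment> \<open>The two parameter lists are interleaved as \<open>mix d c\<close>, with
    \<open>c\<close> at even and \<open>d\<close> at odd places; so variable 2k+1 moves to 4k+1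
    under \<open>f\<close> and to 4k+3 under \<open>g\<close>.\<close>
  define f where "f n = (if even n then n else 2 * n - 1)" for n :: nat
  define g where "g n = (if even n then n else 2 * n + 1)" for n :: nat
  have inj: "inj f" "inj g"
    unfolding inj_def f_def g_def by (auto split: if_splits; presburger)+
  have f: "mix (mix d c) s \<circ> f = mix c s" for s
  proof (rule HOL.ext)
    fix n show "(mix (mix d c) s \<circ> f) n = mix c s n"
      by (cases "even n") (auto simp: f_def mix_def elim: oddE)
  qed
  have g: "mix (mix d c) s \<circ> g = mix d s" for s
  proof (rule HOL.ext)
    fix n show "(mix (mix d c) s \<circ> g) n = mix d s n"
      by (cases "even n") (auto simp: g_def mix_def elim: oddE)
  qed
  have "sat M E (mix (mix d c) s) (Conj (ren f p) (ren g q)) \<longleftrightarrow> P s \<and> Q s"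
    if "range s \<subseteq> M" for s
    using that p q f g by (simp add: sat_ren inj_on_subset[OF inj(1)] inj_on_subset[OF inj(2)])
  moreover have "range (mix d c) \<subseteq> PB b" using p q by (simp add: range_mix)
  ultimately show ?thesis unfolding D_def by blast
qed

lemma D_rename:
  assumes "D b P" "inj g" shows "D b (\<lambda>s. P (\<lambda>n. s (g n)))"
proof -
  obtain p c where p: "range c \<subseteq> PB b" "\<And>s. range s \<subseteq> M \<Longrightarrow> sat M E (mix c s) p = P s"
    using assms(1) unfolding D_def by blast
  define f where "f n = (if even n then 2 * g (n div 2) else n)" for n :: nat
  have inj: "inj f"
  proof (rule injI)
    fix x y assume *: "f x = f y"
    then have "even x = even y" unfolding f_def by (auto split: if_splits)
    then show "x = y"
      using * assms(2) by (auto simp: f_def inj_def split: if_splits) (metis dvd_mult_div_cancel)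
  qed
  have f: "mix c s \<circ> f = mix c (\<lambda>n. s (g n))" for s
    by (rule HOL.ext) (auto simp: f_def mix_def)
  have "sat M E (mix c s) (ren f p) \<longleftrightarrow> P (\<lambda>n. s (g n))" if "range s \<subseteq> M" for s
  proof -
    have "range (\<lambda>n. s (g n)) \<subseteq> M" using that by auto
    then show ?thesis using p f by (simp add: sat_ren inj_on_subset[OF inj])
  qed
  then show ?thesis using p(1) unfolding D_def by blast
qed

text \<open>Inserts an idle position 1 behind the bound variable, as required when a definable
  predicate is moved below one more quantifier.\<close>

lemma D_lift:
  assumes "D b (\<lambda>s. P (s 0) (\<lambda>n. s (Suc n)))"
  shows "D b (\<lambda>s. P (s 0) (\<lambda>n. s (Suc (Suc n))))"
  using D_rename[OF assms, of "\<lambda>n. if n = 0 then 0 else Suc n"] by (auto simp: inj_def)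

lemma D_all [dfn]:
  assumes "D b (\<lambda>s. P (s 0) (\<lambda>n. s (Suc n)))" shows "D b (\<lambda>s. \<forall>x\<in>M. P x s)"
proof -
  obtain p c where p: "range c \<subseteq> PB b"
      "\<And>s. range s \<subseteq> M \<Longrightarrow> sat M E (mix c s) p = P (s 0) (\<lambda>n. s (Suc n))"
    using assms(1) unfolding D_def by blast
  obtain N where N: "\<And>i. i \<in> vars p \<Longrightarrow> i < 2 * N"
    using finite_vars[of p] unfolding finite_nat_set_iff_bounded
    by (metis less_le_trans mult_2 le_add1)
  \<comment> \<open>\<open>All\<close> binds a named variable: position 0 becomes the fresh variable
    2N, and the other argument variables move down one position to undo the de Bruijn shift.\<close>
  define f where "f n = (if n = 0 then 2 * N else if even n then n - 2 else n)" for n :: nat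
  have inj: "inj_on f (vars p)"
  proof (rule inj_onI)
    fix x y assume "x \<in> vars p" "y \<in> vars p" "f x = f y"
    then have "x < 2 * N" "y < 2 * N" "f x = f y" using N by auto
    then show "x = y" unfolding f_def
      by (simp split: if_splits; presburger)
  qed
  have "sat M E ((mix c s)(2 * N := x)) (ren f p) \<longleftrightarrow> P x s" if "range s \<subseteq> M" "x \<in> M" for s x
  proof -
    have "range (case_nat x s) \<subseteq> M" using that by (auto split: nat.splits intro: range_subsetD)
    from p(2)[OF this] have "sat M E (mix c (case_nat x s)) p = P x s" by simp
    moreover have "sat M E ((mix c s)(2 * N := x) \<circ> f) p = sat M E (mix c (case_nat x s)) p"
    proof (rule sat_cong)
      fix i assume i: "i \<in> vars p"
      show "((mix c s)(2 * N := x) \<circ> f) i = mix c (case_nat x s) i"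
      proof (cases "i = 0 \<or> odd i")
        case True
        then show ?thesis by (auto simp: f_def mix_def)
      next
        case False
        then obtain k where k: "i = 2 * Suc k" by (metis evenE mult_0_right not0_implies_Suc)
        then show ?thesis using N[OF i] by (auto simp: f_def mix_def)
      qed
    qed
    ultimately show ?thesis using inj by (simp add: sat_ren)
  qed
  then have "sat M E (mix c s) (All (2 * N) (ren f p)) \<longleftrightarrow> (\<forall>x\<in>M. P x s)" if "range s \<subseteq> M" for s
    using that by simp
  then show ?thesis using p(1) unfolding D_def by blast
qed

lemma D_imp [dfn]: "D b P \<Longrightarrow> D b Q \<Longrightarrow> D b (\<lambda>s. P s \<longrightarrow> Q s)"
  by (rule D_cong[OF D_neg[OF D_conj[OF _ D_neg]]]) auto

lemma D_disj [dfn]: "D b P \<Longrightarrow> D b Q \<Longrightarrow> D b (\<lambda>s. P s \<or> Q s)"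
  by (rule D_cong[OF D_neg[OF D_conj[OF D_neg D_neg]]]) auto

lemma D_iff [dfn]: "D b P \<Longrightarrow> D b Q \<Longrightarrow> D b (\<lambda>s. P s \<longleftrightarrow> Q s)"
  by (rule D_cong[OF D_conj[OF D_imp[of b P Q] D_imp[of b Q P]]]) auto

lemma D_ex [dfn]:
  assumes "D b (\<lambda>s. P (s 0) (\<lambda>n. s (Suc n)))" shows "D b (\<lambda>s. \<exists>x\<in>M. P x s)"
  by (rule D_cong[OF D_neg[OF D_all[where P = "\<lambda>x s. \<not> P x s", OF D_neg[OF assms]]]]) simp

lemma D_ball_class:
  assumes "D b (\<lambda>s. s 0 \<in> X)" "X \<subseteq> M" "D b (\<lambda>s. P (s 0) (\<lambda>n. s (Suc n)))"
  shows "D b (\<lambda>s. \<forall>x\<in>X. P x s)"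
  by (rule D_cong[OF D_all[where P = "\<lambda>x s. x \<in> X \<longrightarrow> P x s", OF D_imp[OF assms(1,3)]]])
    (use assms(2) in auto)

lemma D_bex_class:
  assumes "D b (\<lambda>s. s 0 \<in> X)" "X \<subseteq> M" "D b (\<lambda>s. P (s 0) (\<lambda>n. s (Suc n)))"
  shows "D b (\<lambda>s. \<exists>x\<in>X. P x s)"
  by (rule D_cong[OF D_ex[where P = "\<lambda>x s. x \<in> X \<and> P x s", OF D_conj[OF assms(1,3)]]])
    (use assms(2) in auto)

lemma D_atom:
  "D b (\<lambda>s. E (s i) (s j))" "D b (\<lambda>s. s i = s j)"
proof -
  have "range (\<lambda>_. e0) \<subseteq> PB b" using e0_PB by auto
  moreover have "sat M E (mix (\<lambda>_. e0) s) (Mem (2 * i) (2 * j)) = E (s i) (s j)"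
    "sat M E (mix (\<lambda>_. e0) s) (Eql (2 * i) (2 * j)) = (s i = s j)" for s
    by (auto simp: mix_def)
  ultimately show "D b (\<lambda>s. E (s i) (s j))" "D b (\<lambda>s. s i = s j)"
    unfolding D_def by blast+
qed

lemma DT_var [dfn]: "DT b (\<lambda>s. s i)"
  unfolding DT_def by (auto intro: D_atom)

lemma DT_M: "DT b t \<Longrightarrow> range s \<subseteq> M \<Longrightarrow> t s \<in> M"
  unfolding DT_def by auto

lemma D_subst:
  assumes "D b (\<lambda>s. P (s 0) (\<lambda>n. s (Suc n)))" "DT b t"
  shows "D b (\<lambda>s. P (t s) s)"
proof -
  have "D b (\<lambda>s. \<exists>y\<in>M. y = t s \<and> P y s)"
    using assms unfolding DT_def by (intro D_ex D_conj) auto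
  then show ?thesis by (rule D_cong) (use DT_M[OF assms(2)] in auto)
qed

lemma DT_shift: "DT b t \<Longrightarrow> DT b (\<lambda>s. t (\<lambda>n. s (Suc n)))"
proof -
  assume t: "DT b t"
  have "inj (\<lambda>n. case n of 0 \<Rightarrow> 0 | Suc n \<Rightarrow> Suc (Suc n))"
    by (auto simp: inj_def split: nat.splits)
  from D_rename[OF _ this, of b "\<lambda>s. s 0 = t (\<lambda>n. s (Suc n))"] t
  have "D b (\<lambda>s. s 0 = t (\<lambda>n. s (Suc (Suc n))))"
    unfolding DT_def by simp
  moreover have "t (\<lambda>n. s (Suc n)) \<in> M" if "range s \<subseteq> M" for s
    by (rule DT_M[OF t]) (use that in auto)
  ultimately show ?thesis unfolding DT_def by simp
qed

lemma D1: "D b (\<lambda>s. R (s 0)) \<Longrightarrow> DT b t \<Longrightarrow> D b (\<lambda>s. R (t s))"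
  by (rule D_subst[where P = "\<lambda>y s. R y"])

text \<open>Reduces arbitrary terms to variables; \<open>t\<close> goes in first, shifted past the
  variable that is still waiting for \<open>u\<close>.\<close>

lemma D2:
  assumes "D b (\<lambda>s. R (s 0) (s 1))" "DT b t" "DT b u"
  shows "D b (\<lambda>s. R (t s) (u s))"
proof -
  have "D b (\<lambda>s. R (t (\<lambda>n. s (Suc n))) (s 0))"
    by (rule D_subst[where P = "\<lambda>x s. R x (s 0)"]) (use assms DT_shift in auto)
  then show ?thesis by (rule D_subst[where P = "\<lambda>y s. R (t s) y"]) fact
qed

lemma D3:
  assumes "D b (\<lambda>s. R (s 0) (s 1) (s 2))" "DT b t" "DT b u" "DT b v"
  shows "D b (\<lambda>s. R (t s) (u s) (v s))"
proof -
  have "D b (\<lambda>s. R (t (\<lambda>n. s (Suc (Suc n)))) (s 0) (s 1))"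
    by (rule D_subst[where P = "\<lambda>x s. R x (s 0) (s 1)"])
      (use assms DT_shift[OF DT_shift[OF assms(2)]] in \<open>auto simp: numeral_2_eq_2\<close>)
  then have "D b (\<lambda>s. R (t (\<lambda>n. s (Suc n))) (u (\<lambda>n. s (Suc n))) (s 0))"
    by (intro D_subst[where P = "\<lambda>x s. R (t (\<lambda>n. s (Suc n))) x (s 0)"])
      (use assms DT_shift[OF assms(3)] in auto)
  then show ?thesis by (rule D_subst[where P = "\<lambda>y s. R (t s) (u s) y"]) fact
qed

lemma D_E [dfn]: "DT b t \<Longrightarrow> DT b u \<Longrightarrow> D b (\<lambda>s. E (t s) (u s))"
  by (rule D2[where R = E, OF D_atom(1)])

lemma D_eq [dfn]: "DT b t \<Longrightarrow> DT b u \<Longrightarrow> D b (\<lambda>s. t s = u s)"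
  by (rule D2[where R = "(=)", OF D_atom(2)])

lemma D_const [dfn]: "D b (\<lambda>s. True)" "D b (\<lambda>s. False)"
  using D_neg[of b "\<lambda>s. True"] D_cong[OF D_atom(2)[of b 0 0], of "\<lambda>_. True"] by auto

lemma D_M [dfn]: "DT b t \<Longrightarrow> D b (\<lambda>s. t s \<in> M)"
  by (rule D_cong[OF D_const(1)]) (simp add: DT_M)

lemma D_ext [dfn]: "DT b t \<Longrightarrow> DT b u \<Longrightarrow> D b (\<lambda>s. t s \<in> ext (u s))"
  unfolding ext_iff by (intro dfn)

lemma D_ball_ext [dfn]:
  assumes "DT b t" "D b (\<lambda>s. P (s 0) (\<lambda>n. s (Suc n)))"
  shows "D b (\<lambda>s. \<forall>x\<in>ext (t s). P x s)"
  by (rule D_cong[OF D_all[where P = "\<lambda>x s. x \<in> ext (t s) \<longrightarrow> P x s",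
      OF D_imp[OF D_ext[OF DT_var DT_shift[OF assms(1)]] assms(2)]]]) auto

lemma D_bex_ext [dfn]:
  assumes "DT b t" "D b (\<lambda>s. P (s 0) (\<lambda>n. s (Suc n)))"
  shows "D b (\<lambda>s. \<exists>x\<in>ext (t s). P x s)"
  by (rule D_cong[OF D_ex[where P = "\<lambda>x s. x \<in> ext (t s) \<and> P x s",
      OF D_conj[OF D_ext[OF DT_var DT_shift[OF assms(1)]] assms(2)]]]) auto

lemma D_subset [dfn]: "DT b t \<Longrightarrow> DT b u \<Longrightarrow> D b (\<lambda>s. ext (t s) \<subseteq> ext (u s))"
  unfolding subset_iff Ball_def[symmetric] by (intro dfn DT_shift)

lemma DTI: "(\<And>s. range s \<subseteq> M \<Longrightarrow> t s \<in> M) \<Longrightarrow> D b (\<lambda>s. s 0 = t (\<lambda>n. s (Suc n))) \<Longrightarrow> DT b t"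
  unfolding DT_def by auto

lemma DT_subst:
  assumes "DT b (\<lambda>s. F (s 0) (\<lambda>n. s (Suc n)))" "DT b t"
  shows "DT b (\<lambda>s. F (t s) s)"
proof (rule DTI)
  fix s :: "nat \<Rightarrow> 'a" assume s: "range s \<subseteq> M"
  then have "range (case_nat (t s) s) \<subseteq> M"
    using DT_M[OF assms(2) s] by (auto split: nat.splits intro: range_subsetD)
  from DT_M[OF assms(1) this] show "F (t s) s \<in> M" by simp
next
  have "D b (\<lambda>s. s 0 = F (s 1) (\<lambda>n. s (Suc (Suc n))))" using assms(1) by (simp add: DT_def)
  then have "D b (\<lambda>s. s 1 = F (s 0) (\<lambda>n. s (Suc (Suc n))))"
    using D_rename[of b "\<lambda>s. s 0 = F (s 1) (\<lambda>n. s (Suc (Suc n)))"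
        "\<lambda>n. if n = 0 then 1 else if n = 1 then 0 else n"]
    by (auto simp: inj_def)
  then show "D b (\<lambda>s. s 0 = F (t (\<lambda>n. s (Suc n))) (\<lambda>n. s (Suc n)))"
    by (intro D_subst[where P = "\<lambda>x s. s 0 = F x (\<lambda>n. s (Suc n))"])
      (use DT_shift[OF assms(2)] in auto)
qed

lemma DT1: "DT b (\<lambda>s. F (s 0)) \<Longrightarrow> DT b t \<Longrightarrow> DT b (\<lambda>s. F (t s))"
  by (rule DT_subst[where F = "\<lambda>y s. F y"])

lemma DT2:
  assumes "DT b (\<lambda>s. F (s 0) (s 1))" "DT b t" "DT b u"
  shows "DT b (\<lambda>s. F (t s) (u s))"
proof -
  have "DT b (\<lambda>s. F (t (\<lambda>n. s (Suc n))) (s 0))"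
    by (rule DT_subst[where F = "\<lambda>x s. F x (s 0)"]) (use assms DT_shift in auto)
  then show ?thesis by (rule DT_subst[where F = "\<lambda>y s. F (t s) y"]) fact
qed

lemma DT3:
  assumes "DT b (\<lambda>s. F (s 0) (s 1) (s 2))" "DT b t" "DT b u" "DT b v"
  shows "DT b (\<lambda>s. F (t s) (u s) (v s))"
proof -
  have "DT b (\<lambda>s. F (t (\<lambda>n. s (Suc (Suc n)))) (s 0) (s 1))"
    by (rule DT_subst[where F = "\<lambda>x s. F x (s 0) (s 1)"])
      (use assms DT_shift[OF DT_shift[OF assms(2)]] in \<open>auto simp: numeral_2_eq_2\<close>)
  then have "DT b (\<lambda>s. F (t (\<lambda>n. s (Suc n))) (u (\<lambda>n. s (Suc n))) (s 0))"
    by (intro DT_subst[where F = "\<lambda>x s. F (t (\<lambda>n. s (Suc n))) x (s 0)"])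
      (use assms DT_shift[OF assms(3)] in auto)
  then show ?thesis by (rule DT_subst[where F = "\<lambda>y s. F (t s) (u s) y"]) fact
qed

text \<open>No existence premise: the graph says that the value collects the right elements, or that
  no set does and the value is empty.\<close>

lemma DT_mk [dfn]:
  assumes "D b (\<lambda>s. P (s 0) (\<lambda>n. s (Suc n)))"
  shows "DT b (\<lambda>s. mk {z. z \<in> M \<and> P z s})"
proof (rule DTI)
  let ?A = "\<lambda>s. {z. z \<in> M \<and> P z s}"
  have *: "y = mk (?A s) \<longleftrightarrow> (\<forall>z\<in>M. E z y \<longleftrightarrow> P z s) \<or>
     ((\<not> (\<exists>w\<in>M. \<forall>z\<in>M. E z w \<longleftrightarrow> P z s)) \<and> (\<forall>z\<in>M. \<not> E z y))" if "y \<in> M" for y s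
  proof -
    have 1: "ext w = ?A s \<longleftrightarrow> (\<forall>z\<in>M. E z w \<longleftrightarrow> P z s)" for w by (auto simp: ext_def)
    have 2: "y = e0 \<longleftrightarrow> (\<forall>z\<in>M. \<not> E z y)"
      using ext_inj[OF that e0(1)] e0(2) that by (auto simp: ext_def)
    show ?thesis
    proof (cases "isset (?A s)")
      case True
      then have "y = mk (?A s) \<longleftrightarrow> ext y = ?A s" using that ext_mk mk_ext by metis
      then show ?thesis using True 1 unfolding isset_def by auto
    next
      case False
      then have "y = mk (?A s) \<longleftrightarrow> y = e0" by (simp add: mk_def)
      then show ?thesis using False 1 2 that unfolding isset_def by auto
    qed
  qed
  note sw = D_lift[OF assms]
  note sw2 = D_lift[where P = "\<lambda>x s. P x (\<lambda>n. s (Suc n))", OF sw]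
  have "D b (\<lambda>s. (\<forall>z\<in>M. E z (s 0) \<longleftrightarrow> P z (\<lambda>n. s (Suc n))) \<or>
     ((\<not> (\<exists>w\<in>M. \<forall>z\<in>M. E z w \<longleftrightarrow> P z (\<lambda>n. s (Suc n)))) \<and> (\<forall>z\<in>M. \<not> E z (s 0))))"
    by (intro dfn) (use sw sw2 in auto)
  then show "D b (\<lambda>s. s 0 = mk (?A (\<lambda>n. s (Suc n))))"
    by (rule D_cong) (subst *, auto)
qed auto

lemma DT_thep [dfn]:
  assumes "D b (\<lambda>s. P (s 0) (\<lambda>n. s (Suc n)))"
  shows "DT b (\<lambda>s. thep (\<lambda>x. P x s))"
proof (rule DTI)
  have *: "y = thep Q \<longleftrightarrow> (Q y \<and> (\<forall>z\<in>M. Q z \<longrightarrow> z = y)) \<or>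
     ((\<not> (\<exists>w\<in>M. Q w \<and> (\<forall>z\<in>M. Q z \<longrightarrow> z = w))) \<and> (\<forall>z\<in>M. \<not> E z y))" if "y \<in> M" for y Q
  proof -
    have 2: "y = e0 \<longleftrightarrow> (\<forall>z\<in>M. \<not> E z y)"
      using ext_inj[OF that e0(1)] e0(2) that by (auto simp: ext_def)
    show ?thesis
    proof (cases "\<exists>w\<in>M. Q w \<and> (\<forall>z\<in>M. Q z \<longrightarrow> z = w)")
      case True
      then obtain w where w: "w \<in> M" "Q w" "\<forall>z\<in>M. Q z \<longrightarrow> z = w" by auto
      have "thep Q = w" by (rule thep_eq) (use w in blast)+
      then show ?thesis using w that by metis
    next
      case False
      then have "thep Q = e0" unfolding thep_def by (auto simp: Ex1_def)
      then show ?thesis using False 2 that by auto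
    qed
  qed
  note sw = D_lift[OF assms]
  note sw2 = D_lift[where P = "\<lambda>x s. P x (\<lambda>n. s (Suc n))", OF sw]
  have "D b (\<lambda>s. (P (s 0) (\<lambda>n. s (Suc n)) \<and> (\<forall>z\<in>M. P z (\<lambda>n. s (Suc n)) \<longrightarrow> z = s 0)) \<or>
     ((\<not> (\<exists>w\<in>M. P w (\<lambda>n. s (Suc n)) \<and> (\<forall>z\<in>M. P z (\<lambda>n. s (Suc n)) \<longrightarrow> z = w))) \<and> (\<forall>z\<in>M. \<not> E z (s 0))))"
    by (intro dfn) (use sw sw2 assms in auto)
  then show "D b (\<lambda>s. s 0 = thep (\<lambda>x. P x (\<lambda>n. s (Suc n))))"
    by (rule D_cong) (subst *, auto)
qed auto

lemma DT_param:
  assumes "a \<in> PB b" shows "DT b (\<lambda>s. a)"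
proof (rule DTI)
  show "a \<in> M" using assms PB_sub by auto
  have "sat M E (mix (\<lambda>_. a) s) (Eql 0 1) = (s 0 = a)" for s by (auto simp: mix_def)
  then show "D b (\<lambda>s. s 0 = a)" unfolding D_def using assms
    by (intro exI[of _ "Eql 0 1"] exI[of _ "\<lambda>_. a"]) auto
qed

lemma DT_M_const: "a \<in> M \<Longrightarrow> DT True (\<lambda>s. a)"
  by (rule DT_param) (simp add: PB_def)

lemma DT_Ord_const: "a \<in> Ord \<Longrightarrow> DT b (\<lambda>s. a)"
  by (rule DT_param) (auto simp: PB_def)

lemma DT_e0 [dfn]: "DT b (\<lambda>s. e0)"
  by (rule DT_Ord_const) simp

lemma DT_mono: "DT False t \<Longrightarrow> DT b t"
  unfolding DT_def using D_mono by auto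

text \<open>An induction on an actual formula \<open>q\<close>, not a truth definition inside
  \<open>M\<close>: every \<open>q\<close> receives a defining formula of its own.\<close>

lemma D_sat:
  assumes "\<And>i. DT b (t i)"
  shows "D b (\<lambda>s. sat M E (\<lambda>i. t i s) q)"
  using assms
proof (induction q arbitrary: t)
  case (All n q)
  have *: "DT b (\<lambda>s. if i = n then s 0 else t i (\<lambda>k. s (Suc k)))" for i
    using DT_shift[OF All.prems] DT_var by (cases "i = n") simp_all
  have "D b (\<lambda>s. sat M E (\<lambda>i. (if i = n then s 0 else t i (\<lambda>k. s (Suc k)))) q)"
    by (rule All.IH[where t = "\<lambda>i s. if i = n then s 0 else t i (\<lambda>k. s (Suc k))"])
       (rule *)
  then have "D b (\<lambda>s. \<forall>a\<in>M. sat M E (\<lambda>i. (if i = n then a else t i s)) q)"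
    by (rule D_all)
  moreover have "(\<lambda>i. t i s)(n := a) = (\<lambda>i. (if i = n then a else t i s))" for s a by auto
  ultimately show ?case by simp
qed (auto intro!: dfn)

lemma OD_iff: "x \<in> OD M E \<longleftrightarrow> x \<in> M \<and> DT False (\<lambda>s. x)"
proof
  assume "x \<in> OD M E"
  then obtain p s where x: "x \<in> M" and s: "range s \<subseteq> Ord"
    and p: "\<And>y. y \<in> M \<Longrightarrow> sat M E (s(0 := y)) p \<longleftrightarrow> y = x"
    unfolding OD_def by blast
  \<comment> \<open>Variable n > 0 of the given definition is a parameter and goes to the odd slot
    2n+1; variable 0 is the argument.\<close>
  define f where "f n = (if n = 0 then 0 else 2 * n + 1)" for n :: nat
  have "inj f" by (auto simp: inj_def f_def split: if_splits; presburger)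
  moreover have "mix s t \<circ> f = s(0 := t 0)" for t by (rule HOL.ext) (auto simp: mix_def f_def)
  ultimately have "sat M E (mix s t) (ren f p) = (t 0 = x)" if "range t \<subseteq> M" for t
    using p[of "t 0"] that by (simp add: sat_ren inj_on_subset range_subsetD)
  then have "D False (\<lambda>t. t 0 = x)" using s unfolding D_def PB_def by auto
  then show "x \<in> M \<and> DT False (\<lambda>s. x)" using x by (simp add: DT_def)
next
  assume "x \<in> M \<and> DT False (\<lambda>s. x)"
  then obtain p c where x: "x \<in> M" and c: "range c \<subseteq> Ord"
    and p: "\<And>s. range s \<subseteq> M \<Longrightarrow> sat M E (mix c s) p \<longleftrightarrow> s 0 = x"
    unfolding DT_def D_def PB_def by auto
  \<comment> \<open>The idle argument slots are filled with the ordinal \<open>e0\<close>, so that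
    the whole assignment consists of ordinals.\<close>
  have "sat M E ((mix c (\<lambda>_. e0))(0 := y)) p \<longleftrightarrow> y = x" if "y \<in> M" for y
  proof -
    have "(mix c (\<lambda>_. e0))(0 := y) = mix c ((\<lambda>_. e0)(0 := y))"
      by (rule HOL.ext) (auto simp: mix_def elim!: evenE)
    moreover have "range ((\<lambda>_. e0)(0 := y)) \<subseteq> M" using that by (intro range_upd) auto
    note p[OF this]
    ultimately show ?thesis by simp
  qed
  moreover have "range (mix c (\<lambda>_. e0)) \<subseteq> Ord" using c by (intro range_mix) auto
  ultimately show "x \<in> OD M E" using x unfolding OD_def by blast
qed

lemma OD_M [dest]: "x \<in> OD M E \<Longrightarrow> x \<in> M" by (simp add: OD_def)

lemma DT_OD_const: "a \<in> OD M E \<Longrightarrow> DT b (\<lambda>s. a)"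
  using OD_iff DT_mono by blast

subsection \<open>Set existence\<close>

lemma sep:
  assumes "x \<in> M" "D True (\<lambda>s. P (s 0))" shows "isset {z \<in> ext x. P z}"
proof -
  obtain p c where c: "range c \<subseteq> M" and p: "\<And>s. range s \<subseteq> M \<Longrightarrow> sat M E (mix c s) p = P (s 0)"
    using assms(2) unfolding D_def PB_def by auto
  have "range (mix c (\<lambda>_. e0)) \<subseteq> M" using c by (intro range_mix) auto
  then obtain y where y: "y \<in> M"
    "\<And>z. z \<in> M \<Longrightarrow> E z y \<longleftrightarrow> E z x \<and> sat M E ((mix c (\<lambda>_. e0))(0 := z)) p"
    using zfc assms(1) unfolding ZFC_model_def separation_def by meson
  moreover have "sat M E ((mix c (\<lambda>_. e0))(0 := z)) p \<longleftrightarrow> P z" if "z \<in> M" for z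
  proof -
    have "(mix c (\<lambda>_. e0))(0 := z) = mix c ((\<lambda>_. e0)(0 := z))"
      by (rule HOL.ext) (auto simp: mix_def elim!: evenE)
    moreover have "range ((\<lambda>_. e0)(0 := z)) \<subseteq> M" using that by (intro range_upd) auto
    note p[OF this]
    ultimately show ?thesis by simp
  qed
  ultimately have "ext y = {z \<in> ext x. P z}" by (auto simp: ext_def)
  then show ?thesis using y(1) unfolding isset_def by blast
qed

text \<open>Replacement and definable sequences take their arguments from variables 0 and 1, whereas
  position 1 is variable 2 in \<open>mix\<close>. Variables 1 and 2 are swapped, which sends the
  parameter \<open>c 0\<close> to variable 2.\<close>

lemma D_sat2:
  assumes "D True (\<lambda>s. R (s 0) (s 1))"
  obtains p s where "range s \<subseteq> M"
    "\<And>x y. x \<in> M \<Longrightarrow> y \<in> M \<Longrightarrow> sat M E (s(0 := x, 1 := y)) p \<longleftrightarrow> R x y"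
proof -
  obtain p c where c: "range c \<subseteq> M"
    and p: "\<And>s. range s \<subseteq> M \<Longrightarrow> sat M E (mix c s) p = R (s 0) (s 1)"
    using assms unfolding D_def PB_def by auto
  define f where "f n = (if n = 2 then 1 else if n = 1 then 2 else n)" for n :: nat
  have inj: "inj f" by (auto simp: inj_def f_def split: if_splits)
  let ?s = "\<lambda>n. if n = 2 then c 0 else mix c (\<lambda>_. e0) n"
  have "sat M E (?s(0 := x, 1 := y)) (ren f p) \<longleftrightarrow> R x y" if "x \<in> M" "y \<in> M" for x y
  proof -
    have "mix c ((\<lambda>_. e0)(0 := x, 1 := y)) = ?s(0 := x, 1 := y) \<circ> f"
      by (rule HOL.ext) (auto simp: mix_def f_def elim!: evenE)
    moreover have "range ((\<lambda>_. e0)(0 := x, 1 := y)) \<subseteq> M" using that by (intro range_upd) auto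
    from p[OF this] have "sat M E (mix c ((\<lambda>_. e0)(0 := x, 1 := y))) p = R x y" by simp
    ultimately show ?thesis by (simp add: sat_ren inj_on_subset[OF inj])
  qed
  moreover have "range ?s \<subseteq> M" using c by (auto simp: mix_def)
  ultimately show thesis using that by blast
qed

lemma repl:
  assumes "a \<in> M" "DT True (\<lambda>s. F (s 0))" shows "isset (F ` ext a)"
proof -
  have "D True (\<lambda>s. s 1 = F (s 0))" by (intro dfn DT1[where F = F, OF assms(2)])
  then obtain p s where s: "range s \<subseteq> M"
    and sat: "\<And>x y. x \<in> M \<Longrightarrow> y \<in> M \<Longrightarrow> sat M E (s(0 := x, 1 := y)) p \<longleftrightarrow> y = F x"
    by (rule D_sat2[where R = "\<lambda>x y. y = F x"]) blast
  have FM: "F x \<in> M" if "x \<in> M" for x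
    using DT_M[OF assms(2), of "\<lambda>_. x"] that by auto
  have H: "\<forall>x\<in>M. E x a \<longrightarrow> (\<exists>!y. y \<in> M \<and> sat M E (s(0 := x, 1 := y)) p)"
    using sat FM by auto
  have "replacement M E" using zfc by (simp add: ZFC_model_def)
  from this[unfolded replacement_def, THEN spec, THEN spec, THEN mp, OF s, THEN bspec,
      OF assms(1), THEN mp, OF H]
  obtain b where b: "b \<in> M"
    "\<And>y. y \<in> M \<Longrightarrow> E y b \<longleftrightarrow> (\<exists>x\<in>M. E x a \<and> sat M E (s(0 := x, 1 := y)) p)"
    by blast
  then have "ext b = F ` ext a" using sat FM by (auto simp: ext_def)
  then show ?thesis using b(1) unfolding isset_def by blast
qed

lemma ext_mk_image:
  assumes "a \<in> M" "DT True (\<lambda>s. F (s 0))"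
  shows "ext (mk {z. z \<in> M \<and> (\<exists>y\<in>ext a. z = F y)}) = F ` ext a"
proof -
  have "F x \<in> M" if "x \<in> M" for x
    using DT_M[OF assms(2), of "\<lambda>_. x"] that by auto
  then have "{z. z \<in> M \<and> (\<exists>y\<in>ext a. z = F y)} = F ` ext a" by auto
  then show ?thesis using repl[OF assms] by (simp add: ext_mk)
qed

lemma ext_mk_sep:
  assumes "a \<in> M" "D True (\<lambda>s. P (s 0))"
  shows "ext (mk {z. z \<in> M \<and> (z \<in> ext a \<and> P z)}) = {z \<in> ext a. P z}"
proof -
  have "{z. z \<in> M \<and> (z \<in> ext a \<and> P z)} = {z \<in> ext a. P z}" by blast
  then show ?thesis using ext_mk[OF sep[where P = P, OF assms]] by argo
qed

lemma isset_sub: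
  assumes "isset A" "D True (\<lambda>s. P (s 0))" shows "isset {z \<in> A. P z}"
proof -
  obtain y where y: "y \<in> M" "ext y = A" using assms(1) unfolding isset_def by blast
  show ?thesis using sep[where P = P, OF y(1) assms(2)] unfolding y(2) .
qed

lemma ext_eqI: "x \<in> M \<Longrightarrow> y \<in> M \<Longrightarrow> (\<And>z. z \<in> M \<Longrightarrow> z \<in> ext x \<longleftrightarrow> z \<in> ext y) \<Longrightarrow> x = y"
  using ext_inj ext_M by blast

section \<open>Pairs, unions, successors and graphs\<close>

lemma isset_upair: "a \<in> M \<Longrightarrow> b \<in> M \<Longrightarrow> isset {z. z \<in> M \<and> (z = a \<or> z = b)}"
proof -
  assume ab: "a \<in> M" "b \<in> M"
  have "pairing M E" using zfc by (simp add: ZFC_model_def)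
  then obtain u where "u \<in> M" "is_upair M E a b u" using ab unfolding pairing_def by blast
  then show ?thesis unfolding isset_def is_upair_def ext_def by auto
qed

definition up :: "'a \<Rightarrow> 'a \<Rightarrow> 'a" where
  "up a b = mk {z. z \<in> M \<and> (z = a \<or> z = b)}"

lemma up_M [simp]: "up a b \<in> M" by (simp add: up_def)

lemma ext_up [simp]: "a \<in> M \<Longrightarrow> b \<in> M \<Longrightarrow> ext (up a b) = {a, b}"
  unfolding up_def by (subst ext_mk[OF isset_upair]) auto

lemma DT_up [dfn]: "DT b t \<Longrightarrow> DT b u \<Longrightarrow> DT b (\<lambda>s. up (t s) (u s))"
  by (rule DT2[where F = up]) (unfold up_def, intro dfn)

definition pair :: "'a \<Rightarrow> 'a \<Rightarrow> 'a" where
  "pair a b = up (up a a) (up a b)"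

lemma pair_M [simp]: "pair a b \<in> M" by (simp add: pair_def)

lemma DT_pair [dfn]: "DT b t \<Longrightarrow> DT b u \<Longrightarrow> DT b (\<lambda>s. pair (t s) (u s))"
  unfolding pair_def by (intro dfn)

lemma pair_inj [simp]:
  assumes "a \<in> M" "b \<in> M" "c \<in> M" "d \<in> M"
  shows "pair a b = pair c d \<longleftrightarrow> a = c \<and> b = d"
proof
  assume "pair a b = pair c d"
  then have "ext (pair a b) = ext (pair c d)" by simp
  then have *: "{up a a, up a b} = {up c c, up c d}" using assms by (simp add: pair_def)
  have up: "up x y = up z w \<longleftrightarrow> {x, y} = {z, w}" if "x \<in> M" "y \<in> M" "z \<in> M" "w \<in> M" for x y z w
    using that ext_up up_M ext_inj by metis
  show "a = c \<and> b = d" using * assms by (auto simp: doubleton_eq_iff up)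
qed simp

lemma isset_Union: "x \<in> M \<Longrightarrow> isset {z. z \<in> M \<and> (\<exists>y\<in>ext x. z \<in> ext y)}"
proof -
  assume x: "x \<in> M"
  have "union_axiom M E" using zfc by (simp add: ZFC_model_def)
  then obtain u where "u \<in> M" "\<forall>z\<in>M. E z u \<longleftrightarrow> (\<exists>y\<in>M. E y x \<and> E z y)"
    using x unfolding union_axiom_def by blast
  then show ?thesis unfolding isset_def ext_def by (intro bexI[of _ u]) auto
qed

definition Uni :: "'a \<Rightarrow> 'a" where
  "Uni x = mk {z. z \<in> M \<and> (\<exists>y\<in>ext x. z \<in> ext y)}"

lemma Un_M [simp]: "Uni x \<in> M" by (simp add: Uni_def)

lemma ext_Un [simp]: "x \<in> M \<Longrightarrow> ext (Uni x) = (\<Union>y\<in>ext x. ext y)"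
  unfolding Uni_def by (subst ext_mk[OF isset_Union]) auto

lemma DT_Un [dfn]: "DT b t \<Longrightarrow> DT b (\<lambda>s. Uni (t s))"
  by (rule DT1[where F = Uni]) (unfold Uni_def, intro dfn)

lemma isset_Pow: "x \<in> M \<Longrightarrow> isset {z. z \<in> M \<and> ext z \<subseteq> ext x}"
proof -
  assume x: "x \<in> M"
  have "power_axiom M E" using zfc by (simp add: ZFC_model_def)
  then obtain u where "u \<in> M" "is_power M E x u"
    using x unfolding power_axiom_def by blast
  then show ?thesis unfolding isset_def ext_def is_power_def subset_in_def
    by (intro bexI[of _ u]) auto
qed

lemma isset_Un2: "isset A \<Longrightarrow> isset B \<Longrightarrow> isset (A \<union> B)"
proof -
  assume "isset A" "isset B"
  then obtain a b where ab: "a \<in> M" "ext a = A" "b \<in> M" "ext b = B" unfolding isset_def by blast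
  have "ext (Uni (up a b)) = A \<union> B" using ab by simp
  then show ?thesis unfolding isset_def by (intro bexI[of _ "Uni (up a b)"]) auto
qed

lemma isset_sing [simp, intro]: "a \<in> M \<Longrightarrow> isset {a}"
  using ext_up[of a a] unfolding isset_def by (intro bexI[of _ "up a a"]) auto

lemma isset_insert [simp, intro]: "a \<in> M \<Longrightarrow> isset A \<Longrightarrow> isset (insert a A)"
  using isset_Un2[of "{a}" A] by simp

definition sc :: "'a \<Rightarrow> 'a" where
  "sc x = mk {z. z \<in> M \<and> (z \<in> ext x \<or> z = x)}"

lemma sc_M [simp]: "sc x \<in> M" by (simp add: sc_def)

lemma ext_sc [simp]: "x \<in> M \<Longrightarrow> ext (sc x) = insert x (ext x)"
proof -
  assume x: "x \<in> M"
  have "{z. z \<in> M \<and> (z \<in> ext x \<or> z = x)} = insert x (ext x)" using x by auto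
  then show ?thesis using x by (simp add: sc_def ext_mk)
qed

lemma DT_sc [dfn]: "DT b t \<Longrightarrow> DT b (\<lambda>s. sc (t s))"
  by (rule DT1[where F = sc]) (unfold sc_def, intro dfn)

definition lam :: "'a \<Rightarrow> ('a \<Rightarrow> 'a) \<Rightarrow> 'a" where
  "lam a F = mk {z. z \<in> M \<and> (\<exists>y\<in>ext a. z = pair y (F y))}"

lemma lam_M [simp]: "lam a F \<in> M" by (simp add: lam_def)

lemma ext_lam:
  assumes "a \<in> M" "DT True (\<lambda>s. F (s 0))"
  shows "ext (lam a F) = (\<lambda>y. pair y (F y)) ` ext a"
  unfolding lam_def by (rule ext_mk_image[OF assms(1)]) (intro dfn assms)

lemma lam_iff:
  assumes "a \<in> M" "DT True (\<lambda>s. F (s 0))" "y \<in> M" "w \<in> M"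
  shows "pair y w \<in> ext (lam a F) \<longleftrightarrow> y \<in> ext a \<and> w = F y"
proof -
  have "F y \<in> M" if "y \<in> M" for y
    using DT_M[OF assms(2), of "\<lambda>_. y"] that by auto
  then have "pair y w = pair x (F x) \<longleftrightarrow> x = y \<and> w = F y" if "x \<in> ext a" for x
    using that assms ext_M[OF that] by auto
  then show ?thesis using ext_lam[OF assms(1,2)] by auto
qed

lemma foundation_ax:
  assumes "x \<in> M" "ext x \<noteq> {}" shows "\<exists>y\<in>ext x. ext y \<inter> ext x = {}"
proof -
  have "foundation M E" using zfc by (simp add: ZFC_model_def)
  then have "\<not> is_empty M E x \<longrightarrow> (\<exists>y\<in>M. E y x \<and> (\<forall>z\<in>M. \<not> (E z y \<and> E z x)))"
    using assms(1) unfolding foundation_def by blast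
  then show ?thesis using assms(2) unfolding is_empty_def ext_def by auto
qed

lemma isset_found: "isset A \<Longrightarrow> A \<noteq> {} \<Longrightarrow> \<exists>y\<in>A. ext y \<inter> A = {}"
  using foundation_ax unfolding isset_def by blast

lemma mem_irrefl [simp]: "x \<notin> ext x"
proof
  assume "x \<in> ext x"
  moreover from this have "x \<in> M" by auto
  ultimately show False using isset_found[of "{x}"] by auto
qed

lemma no_2cycle: "x \<in> ext y \<Longrightarrow> y \<in> ext x \<Longrightarrow> False"
proof -
  assume xy: "x \<in> ext y" "y \<in> ext x"
  then have "isset {x, y}" by (intro isset_insert isset_empty) auto
  from isset_found[OF this] show False using xy by blast
qed

lemma no_3cycle: "x \<in> ext y \<Longrightarrow> y \<in> ext z \<Longrightarrow> z \<in> ext x \<Longrightarrow> False"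
proof -
  assume xyz: "x \<in> ext y" "y \<in> ext z" "z \<in> ext x"
  then have "isset {x, y, z}" by (intro isset_insert isset_empty) auto
  from isset_found[OF this] show False using xyz by blast
qed

subsection \<open>Ordinals\<close>

text \<open>Foundation provides irreflexivity and least elements, and with trichotomy the absence of
  2- and 3-cycles gives transitivity of the order.\<close>

lemma Ord_iff: "x \<in> Ord \<longleftrightarrow> x \<in> M \<and> (\<forall>y\<in>ext x. ext y \<subseteq> ext x) \<and>
  (\<forall>a\<in>ext x. \<forall>b\<in>ext x. a \<in> ext b \<or> a = b \<or> b \<in> ext a)" (is "_ \<longleftrightarrow> ?R")
proof
  assume "x \<in> Ord"
  then show ?R unfolding Ords_def transitive_in_def subset_in_def ext_def by auto
next
  assume R: ?R
  have 1: "transitive_in M E x"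
    using R unfolding transitive_in_def subset_in_def ext_def by auto
  have 2: "\<not> E a a" if "a \<in> M" for a using mem_irrefl[of a] that by (auto simp: ext_def)
  have 3: "E a c" if "a \<in> M" "b \<in> M" "c \<in> M" "E a x" "E b x" "E c x" "E a b" "E b c" for a b c
  proof -
    have m: "a \<in> ext x" "c \<in> ext x" "a \<in> ext b" "b \<in> ext c" using that by (auto simp: ext_def)
    then have "a \<in> ext c \<or> a = c \<or> c \<in> ext a" using R by blast
    then have "a \<in> ext c" using no_2cycle[of a b] no_3cycle[of a b c] m by auto
    then show ?thesis by (simp add: ext_def)
  qed
  have 4: "E a b \<or> a = b \<or> E b a" if "a \<in> M" "b \<in> M" "E a x" "E b x" for a b
    using R that by (auto simp: ext_def)
  have 5: "\<exists>a\<in>M. E a u \<and> (\<forall>b\<in>M. E b u \<longrightarrow> a = b \<or> E a b)"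
    if u: "u \<in> M" "subset_in M E u x" "\<not> is_empty M E u" for u
  proof -
    have "ext u \<noteq> {}" "ext u \<subseteq> ext x" using u by (auto simp: ext_def is_empty_def subset_in_def)
    then obtain a where a: "a \<in> ext u" "ext a \<inter> ext u = {}" using foundation_ax u(1) by metis
    then have "\<forall>b\<in>ext u. a = b \<or> a \<in> ext b" using R \<open>ext u \<subseteq> ext x\<close> by blast
    then show ?thesis using a(1) by (auto simp: ext_def)
  qed
  have x: "x \<in> M" using R by blast
  have 6: "\<forall>a\<in>M. E a x \<longrightarrow> \<not> E a a" using 2 by blast
  have 7: "\<forall>a\<in>M. \<forall>b\<in>M. \<forall>c\<in>M. E a x \<and> E b x \<and> E c x \<and> E a b \<and> E b c \<longrightarrow> E a c"
    by (intro ballI impI) (elim conjE, rule 3)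
  have 8: "\<forall>a\<in>M. \<forall>b\<in>M. E a x \<and> E b x \<longrightarrow> E a b \<or> a = b \<or> E b a" using 4 by blast
  have 9: "\<forall>u\<in>M. subset_in M E u x \<and> \<not> is_empty M E u \<longrightarrow>
        (\<exists>a\<in>M. E a u \<and> (\<forall>b\<in>M. E b u \<longrightarrow> a = b \<or> E a b))"
    by (intro ballI impI 5) blast+
  show "x \<in> Ord" unfolding Ords_def by (intro CollectI conjI x 1 6 7 8 9)
qed

lemma Ord_trans: "x \<in> Ord \<Longrightarrow> y \<in> ext x \<Longrightarrow> z \<in> ext y \<Longrightarrow> z \<in> ext x"
  unfolding Ord_iff by blast

lemma Ord_elt: "x \<in> Ord \<Longrightarrow> y \<in> ext x \<Longrightarrow> y \<in> Ord"
proof -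
  assume x: "x \<in> Ord" and y: "y \<in> ext x"
  have sub: "ext y \<subseteq> ext x" using x y by (auto intro: Ord_trans)
  have "ext z \<subseteq> ext y" if z: "z \<in> ext y" for z
  proof
    fix w assume w: "w \<in> ext z"
    have "w \<in> ext x" using x z w sub by (auto intro: Ord_trans)
    then have "w \<in> ext y \<or> w = y \<or> y \<in> ext w" using x y unfolding Ord_iff by blast
    then show "w \<in> ext y" using no_2cycle[of w z] no_3cycle[of w z y] w z by auto
  qed
  then show ?thesis unfolding Ord_iff using sub x y by (auto simp: Ord_iff; blast)
qed

lemma D_Ord [dfn]: "DT b t \<Longrightarrow> D b (\<lambda>s. t s \<in> Ord)"
  unfolding Ord_iff by (rule D1[where R = "\<lambda>x. x \<in> M \<and> (\<forall>y\<in>ext x. ext y \<subseteq> ext x) \<and>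
  (\<forall>a\<in>ext x. \<forall>b\<in>ext x. a \<in> ext b \<or> a = b \<or> b \<in> ext a)"]) (intro dfn)

lemma Ord_proper_sub:
  assumes a: "a \<in> Ord" and c: "c \<in> M" "ext c \<subseteq> ext a" "\<And>y. y \<in> ext c \<Longrightarrow> ext y \<subseteq> ext c" "c \<noteq> a"
  shows "c \<in> ext a"
proof -
  have "isset {z \<in> ext a. z \<notin> ext c}"
    by (rule sep) (use a c in \<open>auto intro!: dfn DT_M_const\<close>)
  moreover have "{z \<in> ext a. z \<notin> ext c} \<noteq> {}" using ext_inj[of c a] a c by auto
  ultimately obtain m where m: "m \<in> ext a" "m \<notin> ext c" "ext m \<inter> {z \<in> ext a. z \<notin> ext c} = {}"
    using isset_found by blast
  have "ext m = ext c"
  proof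
    show "ext m \<subseteq> ext c" using m a by (auto dest: Ord_trans)
    show "ext c \<subseteq> ext m"
    proof
      fix y assume y: "y \<in> ext c"
      then have "y \<in> ext m \<or> y = m \<or> m \<in> ext y" using a m c(2) unfolding Ord_iff by blast
      then show "y \<in> ext m" using m y c(3) by blast
    qed
  qed
  then have "m = c" using ext_inj m c by auto
  then show ?thesis using m by simp
qed

text \<open>The intersection of \<open>a\<close> and \<open>b\<close> is transitive; if it were
  proper in both, it would belong to both and hence to itself.\<close>

lemma Ord_linear:
  assumes "a \<in> Ord" "b \<in> Ord" shows "a \<in> ext b \<or> a = b \<or> b \<in> ext a"
proof -
  have "isset {z \<in> ext a. z \<in> ext b}"
    by (rule sep) (use assms in \<open>auto intro!: dfn DT_M_const\<close>)
  then obtain c where c: "c \<in> M" "ext c = {z \<in> ext a. z \<in> ext b}" unfolding isset_def by blast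
  have tr: "ext y \<subseteq> ext c" if "y \<in> ext c" for y
    using that assms unfolding c(2) by (auto intro: Ord_trans)
  have "c = a \<or> c \<in> ext a" using Ord_proper_sub[OF assms(1) c(1) _ tr] c(2) by auto
  moreover have "c = b \<or> c \<in> ext b" using Ord_proper_sub[OF assms(2) c(1) _ tr] c(2) by auto
  ultimately show ?thesis using c(2) mem_irrefl[of c] by auto
qed

lemma OrdI:
  assumes "x \<in> M" "ext x \<subseteq> Ord" "\<And>y. y \<in> ext x \<Longrightarrow> ext y \<subseteq> ext x" shows "x \<in> Ord"
  unfolding Ord_iff using assms Ord_linear by blast

lemma Ord_sc [simp]: "x \<in> Ord \<Longrightarrow> sc x \<in> Ord"
  by (rule OrdI) (auto intro: Ord_elt Ord_trans)

lemma Ord_Un: "x \<in> M \<Longrightarrow> ext x \<subseteq> Ord \<Longrightarrow> Uni x \<in> Ord"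
proof (rule OrdI)
  assume x: "x \<in> M" "ext x \<subseteq> Ord"
  show "ext (Uni x) \<subseteq> Ord" using x by (auto intro: Ord_elt)
  show "ext y \<subseteq> ext (Uni x)" if "y \<in> ext (Uni x)" for y
  proof -
    obtain u where u: "u \<in> ext x" "y \<in> ext u" using \<open>y \<in> _\<close> ext_Un[OF x(1)] by auto
    then have "ext y \<subseteq> ext u" using x(2) Ord_trans[of u y] by blast
    then show ?thesis using u ext_Un[OF x(1)] by auto
  qed
qed simp

lemma Ord_bound: "x \<in> M \<Longrightarrow> ext x \<subseteq> Ord \<Longrightarrow> \<exists>a\<in>Ord. ext x \<subseteq> ext a"
proof -
  assume x: "x \<in> M" "ext x \<subseteq> Ord"
  have "y \<in> ext (sc (Uni x))" if "y \<in> ext x" for y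
  proof -
    have "y \<in> Ord" "Uni x \<in> Ord" using that x Ord_Un by auto
    then have "y \<in> ext (Uni x) \<or> y = Uni x \<or> Uni x \<in> ext y" by (rule Ord_linear)
    moreover have "Uni x \<notin> ext y" using mem_irrefl[of "Uni x"] that ext_Un[OF x(1)] by auto
    ultimately show ?thesis by auto
  qed
  then show ?thesis using x Ord_Un by (intro bexI[of _ "sc (Uni x)"]) auto
qed

text \<open>\<open>M\<close> may be ill-founded from outside, so least ordinals exist only for
  properties to which separation applies. This is the source of the definability premises in all
  later inductions.\<close>

lemma Ord_least:
  assumes "D True (\<lambda>s. P (s 0))" "a \<in> Ord" "P a"
  shows "\<exists>b\<in>Ord. P b \<and> (\<forall>c\<in>ext b. \<not> P c) \<and> (b = a \<or> b \<in> ext a)"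
proof -
  have "isset {z \<in> ext a. P z}" by (rule sep) (use assms in auto)
  show ?thesis
  proof (cases "{z \<in> ext a. P z} = {}")
    case True
    then show ?thesis using assms by auto
  next
    case False
    from isset_found[OF \<open>isset _\<close> this] obtain b where
      b: "b \<in> ext a" "P b" "ext b \<inter> {z \<in> ext a. P z} = {}" by blast
    then have "\<forall>c\<in>ext b. \<not> P c" using Ord_trans[OF assms(2)] by blast
    then show ?thesis using b Ord_elt[OF assms(2)] by blast
  qed
qed

lemma Ord_induct:
  assumes "D True (\<lambda>s. P (s 0))" "a \<in> Ord" "\<And>a. a \<in> Ord \<Longrightarrow> \<forall>b\<in>ext a. P b \<Longrightarrow> P a"
  shows "P a"
proof (rule ccontr)
  assume "\<not> P a"
  then obtain b where "b \<in> Ord" "\<not> P b" "\<forall>c\<in>ext b. \<not> \<not> P c"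
    using Ord_least[of "\<lambda>x. \<not> P x" a, OF D_neg[OF assms(1)] assms(2)] by blast
  then show False using assms(3)[of b] by blast
qed

lemma Ord_sub_iff: "a \<in> Ord \<Longrightarrow> b \<in> Ord \<Longrightarrow> ext a \<subseteq> ext b \<longleftrightarrow> a = b \<or> a \<in> ext b"
  using Ord_linear[of a b] Ord_trans[of b a] mem_irrefl by blast

lemma sc_inj: "x \<in> Ord \<Longrightarrow> y \<in> Ord \<Longrightarrow> sc x = sc y \<longleftrightarrow> x = y"
proof
  assume xy: "x \<in> Ord" "y \<in> Ord" "sc x = sc y"
  then have "ext (sc x) = ext (sc y)" by simp
  then have "insert x (ext x) = insert y (ext y)"
    unfolding ext_sc[OF Ord_M[OF xy(1)]] ext_sc[OF Ord_M[OF xy(2)]] .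
  then have "x \<in> insert y (ext y)" "y \<in> insert x (ext x)" by (metis insertI1)+
  then show "x = y" using no_2cycle[of x y] by blast
qed simp

lemma sc_mono: "x \<in> ext y \<Longrightarrow> y \<in> Ord \<Longrightarrow> sc x \<in> ext y \<or> sc x = y"
proof -
  assume x: "x \<in> ext y" and y: "y \<in> Ord"
  then have "x \<in> Ord" by (rule Ord_elt[rotated])
  then have "sc x \<in> ext y \<or> sc x = y \<or> y \<in> ext (sc x)" using y Ord_linear[of "sc x" y] by auto
  moreover have "y \<notin> ext (sc x)" using x no_2cycle[of x y] \<open>x \<in> Ord\<close> by auto
  ultimately show ?thesis by blast
qed

section \<open>Limit ordinals and omega\<close>

definition lim :: "'a \<Rightarrow> bool" where
  "lim x \<longleftrightarrow> x \<in> Ord \<and> e0 \<in> ext x \<and> (\<forall>y\<in>ext x. sc y \<in> ext x)"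

lemma D_lim [dfn]: "DT b t \<Longrightarrow> D b (\<lambda>s. lim (t s))"
  by (rule D1[where R = lim]) (unfold lim_def, intro dfn)

lemma e0_least: "x \<in> Ord \<Longrightarrow> x = e0 \<or> e0 \<in> ext x"
  using Ord_linear[of e0 x] by auto

lemma sc_neq_e0 [simp]: "x \<in> M \<Longrightarrow> sc x \<noteq> e0" 
  by (metis e0(2) ext_sc insert_not_empty)

lemma lim_or_sc: "x \<in> Ord \<Longrightarrow> x = e0 \<or> (\<exists>y\<in>Ord. x = sc y) \<or> lim x"
  unfolding lim_def using e0_least[of x] sc_mono[of _ x] Ord_elt[of x] by blast

lemma lim_not_sc: "lim (sc x) \<Longrightarrow> x \<in> M \<Longrightarrow> False"
  unfolding lim_def using mem_irrefl[of "sc x"] ext_sc[of x] by (metis insertI1)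

lemma lim_sc: "lim l \<Longrightarrow> x \<in> ext l \<Longrightarrow> sc x \<in> ext l"
  unfolding lim_def by blast

text \<open>The axiom of infinity yields an inductive set \<open>w\<close>, not an ordinal; the
  least ordinal outside \<open>w\<close> is a limit, because \<open>w\<close> is closed under
  successors.\<close>

lemma ex_lim: "\<exists>l. lim l"
proof -
  have "infinity_axiom M E" using zfc by (simp add: ZFC_model_def)
  then obtain w where w: "w \<in> M" "\<exists>x\<in>M. is_empty M E x \<and> E x w"
    "\<forall>x\<in>M. E x w \<longrightarrow> (\<exists>y\<in>M. is_succ M E x y \<and> E y w)" unfolding infinity_axiom_def by blast
  have z: "e0 \<in> ext w"
  proof -
    obtain x where "x \<in> M" "is_empty M E x" "E x w" using w by blast
    moreover then have "x = e0" by (intro ext_inj) (auto simp: is_empty_def ext_iff)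
    ultimately show ?thesis by (simp add: ext_iff)
  qed
  have s: "sc x \<in> ext w" if x: "x \<in> ext w" for x
  proof -
    obtain y where "y \<in> M" "is_succ M E x y" "E y w" using w(3) x by (auto simp: ext_iff)
    moreover then have "y = sc x" using x by (intro ext_inj) (auto simp: is_succ_def ext_iff ext_M)
    ultimately show ?thesis by (simp add: ext_iff)
  qed
  \<comment> \<open>Burali-Forti: a set including all ordinals would separate out an ordinal that is
    an element of itself.\<close>
  have "\<exists>a\<in>Ord. a \<notin> ext w"
  proof (rule ccontr)
    assume "\<not> ?thesis"
    then have a: "Ord \<subseteq> ext w" by blast
    have "isset {z \<in> ext w. z \<in> Ord}" by (rule sep) (use w in \<open>auto intro!: dfn\<close>)
    then obtain r where r: "r \<in> M" "ext r = Ord" using a unfolding isset_def by blast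
    then have "r \<in> Ord" by (intro OrdI) (auto intro: Ord_elt)
    then show False using r mem_irrefl by blast
  qed
  then obtain a0 where a0: "a0 \<in> Ord" "a0 \<notin> ext w" by blast
  have "D True (\<lambda>s. s 0 \<notin> ext w)" by (intro dfn DT_M_const w)
  from Ord_least[OF this a0] obtain l where l: "l \<in> Ord" "l \<notin> ext w" "\<forall>c\<in>ext l. c \<in> ext w" by blast
  have "l \<noteq> e0" using l z by blast
  then have "e0 \<in> ext l" using l e0_least by blast
  moreover have "sc y \<in> ext l" if y: "y \<in> ext l" for y
    using sc_mono[OF y l(1)] s[of y] l y by blast
  ultimately show ?thesis using l unfolding lim_def by blast
qed

definition om :: 'a where "om = thep (\<lambda>w. lim w \<and> (\<forall>x\<in>ext w. \<not> lim x))"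

lemma om: "lim om" "x \<in> ext om \<Longrightarrow> \<not> lim x"
proof -
  obtain l where l: "lim l" "l \<in> Ord" using ex_lim lim_def by blast
  have "D True (\<lambda>s. lim (s 0))" by (intro dfn)
  from Ord_least[OF this l(2,1)] obtain w where
    w: "w \<in> Ord" "lim w" "\<forall>c\<in>ext w. \<not> lim c" by blast
  have "om = w" unfolding om_def
  proof (rule thep_eq)
    fix y assume "y \<in> M" and y: "lim y \<and> (\<forall>x\<in>ext y. \<not> lim x)"
    then have "y \<in> Ord" by (simp add: lim_def)
    then show "y = w" using Ord_linear[of y w] y w by blast
  qed (use w in auto)
  then show "lim om" "x \<in> ext om \<Longrightarrow> \<not> lim x" using w by auto
qed

lemma om_Ord [simp]: "om \<in> Ord" using om by (simp add: lim_def)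

lemma DT_om [dfn]: "DT b (\<lambda>s. om)" unfolding om_def by (intro dfn)

subsection \<open>Recursion along transitive well-founded set-like relations\<close>

definition preds :: "('a \<Rightarrow> 'a \<Rightarrow> 'a \<Rightarrow> bool) \<Rightarrow> 'a \<Rightarrow> 'a \<Rightarrow> 'a" where
  "preds R p x = mk {y. y \<in> M \<and> R p y x}"

definition restr :: "'a \<Rightarrow> 'a \<Rightarrow> 'a" where
  "restr f a = mk {z. z \<in> M \<and> z \<in> ext f \<and> (\<exists>y\<in>ext a. \<exists>w\<in>M. z = pair y w)}"

text \<open>\<open>f\<close> is the approximation to the recursion whose domain is exactly the class
  of predecessors of \<open>x\<close>. Since the relation is transitive, restricting it to the
  predecessors of some smaller \<open>y\<close> gives the approximation at \<open>y\<close>.\<close>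

definition att where
  "att R G p x f \<longleftrightarrow> (\<forall>z\<in>M. z \<in> ext f \<longleftrightarrow>
     (\<exists>y\<in>M. R p y x \<and> z = pair y (G p y (restr f (preds R p y)))))"

text \<open>\<open>p\<close> is an argument rather than a fixed parameter, so the value is definable
  from \<open>p\<close> and \<open>x\<close> even when \<open>b = False\<close>, as HOD will
  require.\<close>

definition recF :: "('a \<Rightarrow> 'a \<Rightarrow> 'a \<Rightarrow> bool) \<Rightarrow> ('a \<Rightarrow> 'a \<Rightarrow> 'a \<Rightarrow> 'a) \<Rightarrow> 'a \<Rightarrow> 'a \<Rightarrow> 'a" where
  "recF R G p x = G p x (thep (\<lambda>f. att R G p x f))"

definition wfr :: "('a \<Rightarrow> 'a \<Rightarrow> 'a \<Rightarrow> bool) \<Rightarrow> 'a \<Rightarrow> bool" where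
  "wfr R p \<longleftrightarrow> (\<forall>x\<in>M. isset {y. y \<in> M \<and> R p y x}) \<and>
     (\<forall>x\<in>M. \<forall>y\<in>M. \<forall>z\<in>M. R p x y \<longrightarrow> R p y z \<longrightarrow> R p x z) \<and>
     (\<forall>a\<in>M. ext a \<noteq> {} \<longrightarrow> (\<exists>m\<in>ext a. \<forall>y\<in>ext a. \<not> R p y m))"

lemma preds_M [simp]: "preds R p x \<in> M" by (simp add: preds_def)
lemma restr_M [simp]: "restr f a \<in> M" by (simp add: restr_def)

lemma ext_preds: "wfr R p \<Longrightarrow> x \<in> M \<Longrightarrow> ext (preds R p x) = {y. y \<in> M \<and> R p y x}"
  unfolding preds_def wfr_def by (simp add: ext_mk)

lemma DT_restr [dfn]: "DT b t \<Longrightarrow> DT b u \<Longrightarrow> DT b (\<lambda>s. restr (t s) (u s))"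
  by (rule DT2[where F = restr]) (unfold restr_def, intro dfn)

lemma ext_restr:
  assumes "f \<in> M" "a \<in> M"
  shows "ext (restr f a) = {z \<in> ext f. \<exists>y\<in>ext a. \<exists>w\<in>M. z = pair y w}"
  unfolding restr_def by (rule ext_mk_sep[OF assms(1)]) (intro dfn DT_M_const assms)

lemma DT_preds:
  assumes "D b (\<lambda>s. R (s 0) (s 1) (s 2))" "DT b t" "DT b u"
  shows "DT b (\<lambda>s. preds R (t s) (u s))"
proof (rule DT2[where F = "preds R"])
  show "DT b (\<lambda>s. preds R (s 0) (s 1))"
    unfolding preds_def by (intro dfn D3[where R = R, OF assms(1)])
qed fact+

lemma D_att:
  assumes "D b (\<lambda>s. R (s 0) (s 1) (s 2))" "DT b (\<lambda>s. G (s 0) (s 1) (s 2))"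
    "DT b t" "DT b u" "DT b v"
  shows "D b (\<lambda>s. att R G (t s) (u s) (v s))"
proof (rule D3[where R = "att R G"])
  show "D b (\<lambda>s. att R G (s 0) (s 1) (s 2))"
    unfolding att_def by (intro dfn D3[where R = R, OF assms(1)] DT3[where F = G, OF assms(2)] DT_preds[OF assms(1)])
qed fact+

lemma DT_recF:
  assumes "D b (\<lambda>s. R (s 0) (s 1) (s 2))" "DT b (\<lambda>s. G (s 0) (s 1) (s 2))" "DT b t" "DT b u"
  shows "DT b (\<lambda>s. recF R G (t s) (u s))"
proof (rule DT2[where F = "recF R G"])
  show "DT b (\<lambda>s. recF R G (s 0) (s 1))"
    unfolding recF_def by (intro dfn DT3[where F = G, OF assms(2)] D_att[OF assms(1,2)])
qed fact+

text \<open>\<open>x\<close> together with its predecessors is a set closed under predecessors, so a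
  minimal counterexample inside it is minimal outright.\<close>

lemma wfr_induct:
  assumes "wfr R p" "p \<in> M" "D True (\<lambda>s. R (s 0) (s 1) (s 2))" "D True (\<lambda>s. P (s 0))" "x \<in> M"
    and step: "\<And>x. x \<in> M \<Longrightarrow> (\<And>y. y \<in> M \<Longrightarrow> R p y x \<Longrightarrow> P y) \<Longrightarrow> P x"
  shows "P x"
proof (rule ccontr)
  assume "\<not> P x"
  let ?A = "insert x (ext (preds R p x))"
  have "isset {z \<in> ?A. \<not> P z}"
    by (rule isset_sub) (use assms in \<open>auto intro: D_neg\<close>)
  then obtain a where a: "a \<in> M" "ext a = {z \<in> ?A. \<not> P z}" unfolding isset_def by blast
  then have "ext a \<noteq> {}" using \<open>\<not> P x\<close> by auto
  then obtain m where m: "m \<in> ext a" "\<forall>y\<in>ext a. \<not> R p y m"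
    using assms(1) a(1) unfolding wfr_def by blast
  have mM: "m \<in> M" using m by auto
  have mx: "m = x \<or> R p m x" "\<not> P m" using m(1) ext_preds[OF assms(1,5)] unfolding a(2) by auto
  have "P y" if y: "y \<in> M" "R p y m" for y
  proof (rule ccontr)
    assume "\<not> P y"
    have "R p y x" using mx(1) y mM assms(1,5) unfolding wfr_def by blast
    then have "y \<in> ext a" using \<open>\<not> P y\<close> y ext_preds[OF assms(1,5)] unfolding a(2) by auto
    then show False using m(2) y by blast
  qed
  then show False using step[OF mM] mx(2) by blast
qed

context
  fixes R :: "'a \<Rightarrow> 'a \<Rightarrow> 'a \<Rightarrow> bool" and G :: "'a \<Rightarrow> 'a \<Rightarrow> 'a \<Rightarrow> 'a" and p :: 'a
  assumes wf: "wfr R p" and p: "p \<in> M"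
    and R: "D True (\<lambda>s. R (s 0) (s 1) (s 2))"
    and G: "DT True (\<lambda>s. G (s 0) (s 1) (s 2))"
begin

lemma R_trans: "x \<in> M \<Longrightarrow> y \<in> M \<Longrightarrow> z \<in> M \<Longrightarrow> R p x y \<Longrightarrow> R p y z \<Longrightarrow> R p x z"
  using wf unfolding wfr_def by blast

lemma G_M: "x \<in> M \<Longrightarrow> f \<in> M \<Longrightarrow> G p x f \<in> M"
  using DT_M[OF G, of "\<lambda>n. if n = 0 then p else if n = 1 then x else f"] p by auto

lemma att_restr:
  assumes f: "f \<in> M" "att R G p y f" and yz: "y \<in> M" "z \<in> M" "R p z y"
  shows "att R G p z (restr f (preds R p z))"
proof -
  have rr: "restr (restr f (preds R p z)) (preds R p w) = restr f (preds R p w)"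
    if w: "w \<in> M" "R p w z" for w
  proof (rule ext_inj)
    have "ext (preds R p w) \<subseteq> ext (preds R p z)"
      using w yz by (auto simp: ext_preds[OF wf] intro: R_trans[of _ w z])
    then show "ext (restr (restr f (preds R p z)) (preds R p w)) = ext (restr f (preds R p w))"
      using f by (auto simp: ext_restr)
  qed auto
  have "u \<in> ext (restr f (preds R p z)) \<longleftrightarrow>
      (\<exists>w\<in>M. R p w z \<and> u = pair w (G p w (restr f (preds R p w))))" if u: "u \<in> M" for u
  proof -
    have 1: "u \<in> ext f \<longleftrightarrow> (\<exists>w\<in>M. R p w y \<and> u = pair w (G p w (restr f (preds R p w))))"
      using f(2) u unfolding att_def by blast
    have 2: "u \<in> ext (restr f (preds R p z)) \<longleftrightarrow> u \<in> ext f \<and> (\<exists>w\<in>M. \<exists>v\<in>M. R p w z \<and> u = pair w v)"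
      using ext_restr[OF f(1), of "preds R p z"] ext_preds[OF wf yz(2)] by auto
    show ?thesis
    proof
      assume "u \<in> ext (restr f (preds R p z))"
      then obtain w v w' where w: "w \<in> M" "v \<in> M" "R p w z" "u = pair w v"
        "w' \<in> M" "u = pair w' (G p w' (restr f (preds R p w')))" using 1 2 by blast
      then have "w = w'" using G_M[OF w(5) restr_M] by simp
      then show "\<exists>w\<in>M. R p w z \<and> u = pair w (G p w (restr f (preds R p w)))" using w by blast
    next
      assume "\<exists>w\<in>M. R p w z \<and> u = pair w (G p w (restr f (preds R p w)))"
      then obtain w where w: "w \<in> M" "R p w z" "u = pair w (G p w (restr f (preds R p w)))" by blast
      then have "R p w y" using R_trans[of w z y] yz by blast
      then show "u \<in> ext (restr f (preds R p z))"
        unfolding 2 1 using w G_M[OF w(1) restr_M] by blast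
    qed
  qed
  then show ?thesis unfolding att_def using rr by auto
qed

text \<open>Below \<open>x\<close> the approximations exist by induction, so \<open>recF\<close>
  already has its intended values there; the graph of \<open>recF\<close> on the predecessors of
  \<open>x\<close> is then the approximation at \<open>x\<close>.\<close>

lemma att_ex1: 
  assumes "x \<in> M" shows "\<exists>f\<in>M. att R G p x f \<and> (\<forall>g\<in>M. att R G p x g \<longrightarrow> g = f)"
proof (rule wfr_induct[OF wf p R _ assms])
  show "D True (\<lambda>s. \<exists>f\<in>M. att R G p (s 0) f \<and> (\<forall>g\<in>M. att R G p (s 0) g \<longrightarrow> g = f))"
    by (intro dfn D_att[OF R G] DT_M_const p)
next
  fix x assume x: "x \<in> M"
    and IH: "\<And>y. y \<in> M \<Longrightarrow> R p y x \<Longrightarrow> \<exists>f\<in>M. att R G p y f \<and> (\<forall>g\<in>M. att R G p y g \<longrightarrow> g = f)"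
  have IH1: "thep (att R G p y) = f" if "y \<in> M" "R p y x" "f \<in> M" "att R G p y f" for y f
    using IH[OF that(1,2)] that(3,4) by (intro thep_eq) blast+
  have IH2: "att R G p y (thep (att R G p y))" if "y \<in> M" "R p y x" for y
    using IH[OF that] IH1[OF that] by metis
  let ?F = "recF R G p"
  have Fdef: "?F w = G p w (thep (att R G p w))" for w by (simp add: recF_def)
  have DF: "DT True (\<lambda>s. ?F (s 0))" by (intro dfn DT_recF[OF R G] DT_M_const p)
  have FM: "?F y \<in> M" if "y \<in> M" for y unfolding recF_def by (intro G_M that thep_M)
  let ?f = "\<lambda>y. lam (preds R p y) ?F"
  have extf: "ext (?f y) = {pair z (?F z) | z. z \<in> M \<and> R p z y}" if "y \<in> M" for y
    using ext_lam[OF preds_M DF] ext_preds[OF wf that] by auto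
  have 1: "thep (att R G p y) = ?f y" if y: "y \<in> M" "R p y x" for y
  proof (rule ext_eqI)
    fix z assume z: "z \<in> M"
    let ?g = "thep (att R G p y)"
    have *: "restr ?g (preds R p w) = thep (att R G p w)" if w: "w \<in> M" "R p w y" for w
      using IH1[of w, OF w(1) R_trans[OF w(1) y(1) x w(2) y(2)] _
          att_restr[OF _ IH2[OF y] y(1) w]] by simp
    have "z \<in> ext ?g \<longleftrightarrow> (\<exists>w\<in>M. R p w y \<and> z = pair w (G p w (restr ?g (preds R p w))))"
      using IH2[OF y] z unfolding att_def[of R G p y] by blast
    also have "\<dots> \<longleftrightarrow> (\<exists>w\<in>M. R p w y \<and> z = pair w (?F w))"
      by (intro bex_cong refl conj_cong) (simp add: * Fdef)
    finally have "z \<in> ext ?g \<longleftrightarrow> (\<exists>w\<in>M. R p w y \<and> z = pair w (?F w))" .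
    then show "z \<in> ext ?g \<longleftrightarrow> z \<in> ext (?f y)" using extf[OF y(1)] by auto
  qed auto
  have 2: "restr (?f x) (preds R p y) = ?f y" if y: "y \<in> M" "R p y x" for y
  proof (rule ext_eqI)
    fix z assume "z \<in> M"
    have "z \<in> ext (?f x) \<and> (\<exists>w\<in>M. R p w y \<and> (\<exists>v\<in>M. z = pair w v)) \<longleftrightarrow> z \<in> ext (?f y)"
    proof
      assume "z \<in> ext (?f x) \<and> (\<exists>w\<in>M. R p w y \<and> (\<exists>v\<in>M. z = pair w v))"
      then obtain w v w' where "w \<in> M" "v \<in> M" "R p w y" "z = pair w v" "w' \<in> M" "z = pair w' (?F w')"
        using extf[OF x] by blast
      moreover then have "w = w'" using FM by simp
      ultimately show "z \<in> ext (?f y)" using extf[OF y(1)] by blast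
    next
      assume "z \<in> ext (?f y)"
      then obtain w where w: "w \<in> M" "R p w y" "z = pair w (?F w)" using extf[OF y(1)] by blast
      then have "R p w x" using R_trans y x by blast
      then show "z \<in> ext (?f x) \<and> (\<exists>w\<in>M. R p w y \<and> (\<exists>v\<in>M. z = pair w v))"
        using w extf[OF x] FM by blast
    qed
    then show "z \<in> ext (restr (?f x) (preds R p y)) \<longleftrightarrow> z \<in> ext (?f y)"
      using ext_restr[of "?f x" "preds R p y"] ext_preds[OF wf y(1)] by auto
  qed auto
  have Feq: "?F y = G p y (?f y)" if "y \<in> M" "R p y x" for y
    unfolding recF_def[of R G p y] using 1[OF that] by simp
  have "att R G p x (?f x)"
    unfolding att_def
  proof
    fix z assume "z \<in> M"
    have "z \<in> ext (?f x) \<longleftrightarrow> (\<exists>y\<in>M. R p y x \<and> z = pair y (?F y))" using extf[OF x] by auto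
    also have "\<dots> \<longleftrightarrow> (\<exists>y\<in>M. R p y x \<and> z = pair y (G p y (restr (?f x) (preds R p y))))"
      by (intro bex_cong refl conj_cong) (simp add: 2 Feq[symmetric])
    finally show "z \<in> ext (?f x) \<longleftrightarrow>
      (\<exists>y\<in>M. R p y x \<and> z = pair y (G p y (restr (?f x) (preds R p y))))" .
  qed
  moreover have "g = ?f x" if g: "g \<in> M" "att R G p x g" for g
  proof (rule ext_eqI)
    fix z assume z: "z \<in> M"
    have *: "restr g (preds R p y) = ?f y" if "y \<in> M" "R p y x" for y
      using IH1[OF that _ att_restr[OF g x that]] 1[OF that] by simp
    have "z \<in> ext g \<longleftrightarrow> (\<exists>y\<in>M. R p y x \<and> z = pair y (G p y (restr g (preds R p y))))"
      using g(2) z unfolding att_def[of R G p x] by blast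
    also have "\<dots> \<longleftrightarrow> (\<exists>w\<in>M. R p w x \<and> z = pair w (?F w))"
      by (intro bex_cong refl conj_cong) (simp add: * Feq)
    finally have "z \<in> ext g \<longleftrightarrow> (\<exists>y\<in>M. R p y x \<and> z = pair y (?F y))" .
    then show "z \<in> ext g \<longleftrightarrow> z \<in> ext (?f x)" using extf[OF x] by auto
  qed (use g in auto)
  ultimately show "\<exists>f\<in>M. att R G p x f \<and> (\<forall>g\<in>M. att R G p x g \<longrightarrow> g = f)" by auto
qed

lemma DT_recF_p: "DT True (\<lambda>s. recF R G p (s 0))"
  by (intro dfn DT_recF[OF R G] DT_M_const p)

lemma recF_eq:
  assumes x: "x \<in> M" shows "recF R G p x = G p x (lam (preds R p x) (recF R G p))"
proof -
  let ?F = "recF R G p"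
  have th: "thep (att R G p y) = f" if "y \<in> M" "f \<in> M" "att R G p y f" for y f
    using att_ex1[OF that(1)] that(2,3) by (intro thep_eq) blast+
  have th2: "att R G p x (thep (att R G p x))" using att_ex1[OF x] th[OF x] by metis
  have "thep (att R G p x) = lam (preds R p x) ?F"
  proof (rule ext_eqI)
    fix z assume z: "z \<in> M"
    have *: "restr (thep (att R G p x)) (preds R p y) = thep (att R G p y)" if "y \<in> M" "R p y x" for y
      using th[OF that(1) _ att_restr[OF _ th2 x that]] by simp
    have "z \<in> ext (thep (att R G p x)) \<longleftrightarrow>
        (\<exists>y\<in>M. R p y x \<and> z = pair y (G p y (restr (thep (att R G p x)) (preds R p y))))"
      using th2 z unfolding att_def[of R G p x] by blast
    also have "\<dots> \<longleftrightarrow> (\<exists>w\<in>M. R p w x \<and> z = pair w (?F w))"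
      by (intro bex_cong refl conj_cong) (simp add: * recF_def)
    finally have "z \<in> ext (thep (att R G p x)) \<longleftrightarrow> (\<exists>y\<in>M. R p y x \<and> z = pair y (?F y))" .
    then show "z \<in> ext (thep (att R G p x)) \<longleftrightarrow> z \<in> ext (lam (preds R p x) ?F)"
      using ext_lam[OF preds_M DT_recF_p] ext_preds[OF wf x] by auto
  qed auto
  then show ?thesis unfolding recF_def[of R G p x] by simp
qed

lemma recF_pair:
  assumes "x \<in> M" "y \<in> M" "w \<in> M"
  shows "pair y w \<in> ext (lam (preds R p x) (recF R G p)) \<longleftrightarrow> R p y x \<and> w = recF R G p y"
  using lam_iff[OF preds_M DT_recF_p assms(2,3)] ext_preds[OF wf assms(1)] assms by auto

end

lemma D_bex_Ord [dfn]:
  "D b (\<lambda>s. P (s 0) (\<lambda>n. s (Suc n))) \<Longrightarrow> D b (\<lambda>s. \<exists>x\<in>Ord. P x s)"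
  by (rule D_bex_class) (intro dfn, rule Ord_sub)

lemma isset_UN:
  assumes "a \<in> M" "DT True (\<lambda>s. F (s 0))" shows "isset (\<Union>y\<in>ext a. ext (F y))"
proof -
  obtain u where u: "u \<in> M" "ext u = F ` ext a" using repl[OF assms] unfolding isset_def by blast
  have "ext (Uni u) = (\<Union>y\<in>ext a. ext (F y))" using ext_Un[OF u(1)] u(2) by simp
  then show ?thesis unfolding isset_def by (intro bexI[of _ "Uni u"]) auto
qed

lemma DT_app: "DT b (\<lambda>s. F (s 0)) \<Longrightarrow> s \<in> M \<Longrightarrow> F s \<in> M"
  using DT_M[of b "\<lambda>s. F (s 0)" "\<lambda>_. s"] by auto

definition lst :: "('a \<Rightarrow> bool) \<Rightarrow> 'a" where
  "lst P = thep (\<lambda>a. a \<in> Ord \<and> P a \<and> (\<forall>c\<in>ext a. \<not> P c))"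

lemma thep_cases: "thep P = e0 \<or> P (thep P)"
proof (cases "\<exists>!x. x \<in> M \<and> P x")
  case True
  from theI'[OF True] True show ?thesis unfolding thep_def by simp
qed (simp add: thep_def)

lemma lst_Ord [simp]: "lst P \<in> Ord"
proof -
  have "lst P = e0 \<or> (lst P \<in> Ord \<and> P (lst P) \<and> (\<forall>c\<in>ext (lst P). \<not> P c))"
    unfolding lst_def by (rule thep_cases)
  then show ?thesis using e0_Ord by presburger
qed

lemma lst:
  assumes "D True (\<lambda>s. P (s 0))" "a \<in> Ord" "P a"
  shows "P (lst P)" "\<And>c. c \<in> ext (lst P) \<Longrightarrow> \<not> P c"
proof -
  obtain b where b: "b \<in> Ord" "P b" "\<forall>c\<in>ext b. \<not> P c" using Ord_least[OF assms] by blast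
  have "lst P = b" unfolding lst_def
  proof (rule thep_eq)
    fix y assume "y \<in> M" and y: "y \<in> Ord \<and> P y \<and> (\<forall>c\<in>ext y. \<not> P c)"
    then show "y = b" using Ord_linear[of y b] b by blast
  qed (use b in auto)
  then show "P (lst P)" "\<And>c. c \<in> ext (lst P) \<Longrightarrow> \<not> P c" using b by auto
qed

lemma DT_lst [dfn]:
  assumes "D b (\<lambda>s. P (s 0) (\<lambda>n. s (Suc n)))"
  shows "DT b (\<lambda>s. lst (\<lambda>x. P x s))"
  unfolding lst_def using D_lift[OF assms] by (intro dfn assms) auto

subsection \<open>The cumulative hierarchy\<close>

definition ordlt :: "'a \<Rightarrow> 'a \<Rightarrow> 'a \<Rightarrow> bool" where
  "ordlt p y x \<longleftrightarrow> x \<in> Ord \<and> y \<in> ext x"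

lemma D_ordlt: "D b (\<lambda>s. ordlt (s 0) (s 1) (s 2))"
  unfolding ordlt_def by (intro dfn)

lemma wfr_ordlt: "wfr ordlt p"
proof -
  have "isset {y. y \<in> M \<and> ordlt p y x}" if "x \<in> M" for x
  proof (cases "x \<in> Ord")
    case True
    then have *: "{y. y \<in> M \<and> ordlt p y x} = ext x" by (auto simp: ordlt_def)
    show ?thesis unfolding * using that by simp
  qed (simp add: ordlt_def)
  moreover have "\<exists>m\<in>ext a. \<forall>y\<in>ext a. \<not> ordlt p y m" if "a \<in> M" "ext a \<noteq> {}" for a
    using foundation_ax[OF that] unfolding ordlt_def by blast
  ultimately show ?thesis unfolding wfr_def ordlt_def using Ord_trans by blast
qed

definition Pw :: "'a \<Rightarrow> 'a" where "Pw x = mk {z. z \<in> M \<and> ext z \<subseteq> ext x}"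

lemma Pw_M [simp]: "Pw x \<in> M" by (simp add: Pw_def)

lemma ext_Pw [simp]: "x \<in> M \<Longrightarrow> ext (Pw x) = {z. z \<in> M \<and> ext z \<subseteq> ext x}"
  unfolding Pw_def by (rule ext_mk[OF isset_Pow])

lemma DT_Pw [dfn]: "DT b t \<Longrightarrow> DT b (\<lambda>s. Pw (t s))"
  by (rule DT1[where F = Pw]) (unfold Pw_def, intro dfn)

definition GV where
  "GV p x f = mk {z. z \<in> M \<and> (\<exists>y\<in>ext x. \<exists>w\<in>M. pair y w \<in> ext f \<and> ext z \<subseteq> ext w)}"

definition V :: "'a \<Rightarrow> 'a" where "V x = recF ordlt GV e0 x"

lemma DT_GV: "DT b (\<lambda>s. GV (s 0) (s 1) (s 2))"
  unfolding GV_def by (intro dfn)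

lemma DT_V [dfn]: "DT b t \<Longrightarrow> DT b (\<lambda>s. V (t s))"
  unfolding V_def by (intro DT_recF[OF D_ordlt DT_GV] dfn)

lemma V_M [simp]: "x \<in> M \<Longrightarrow> V x \<in> M"
  using DT_app[OF DT_V[OF DT_var]] .

lemma ext_V:
  assumes x: "x \<in> Ord" shows "ext (V x) = {z. z \<in> M \<and> (\<exists>y\<in>ext x. ext z \<subseteq> ext (V y))}"
proof -
  have xM: "x \<in> M" using x by simp
  have eq: "recF ordlt GV e0 = V" by (rule HOL.ext) (simp add: V_def)
  have "V x = GV e0 x (lam (preds ordlt e0 x) V)"
    using recF_eq[OF wfr_ordlt e0(1) D_ordlt DT_GV xM] unfolding eq .
  also have "\<dots> = mk {z. z \<in> M \<and> (\<exists>y\<in>ext x. ext z \<subseteq> ext (V y))}"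
  proof -
    have "(\<exists>w\<in>M. pair y w \<in> ext (lam (preds ordlt e0 x) V) \<and> ext z \<subseteq> ext w) \<longleftrightarrow> ext z \<subseteq> ext (V y)"
      if "y \<in> ext x" for y z
    proof -
      have o: "ordlt e0 y x" using that x by (simp add: ordlt_def)
      show ?thesis
        using recF_pair[OF wfr_ordlt e0(1) D_ordlt DT_GV xM ext_M[OF that]]
          V_M[OF ext_M[OF that]] o unfolding eq by auto
    qed
    then show ?thesis unfolding GV_def by (intro arg_cong[of _ _ mk]) blast
  qed
  finally have "V x = mk {z. z \<in> M \<and> (\<exists>y\<in>ext x. ext z \<subseteq> ext (V y))}" .
  moreover have "(\<Union>y\<in>ext x. ext (Pw (V y))) = (\<Union>y\<in>ext x. {z. z \<in> M \<and> ext z \<subseteq> ext (V y)})"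
    by (intro SUP_cong refl ext_Pw V_M ext_M)
  then have "{z. z \<in> M \<and> (\<exists>y\<in>ext x. ext z \<subseteq> ext (V y))} = (\<Union>y\<in>ext x. ext (Pw (V y)))"
    by auto
  moreover have "isset (\<Union>y\<in>ext x. ext (Pw (V y)))"
    by (rule isset_UN[OF xM]) (intro dfn)
  ultimately show ?thesis by (simp add: ext_mk)
qed

lemma V_trans: "x \<in> Ord \<Longrightarrow> z \<in> ext (V x) \<Longrightarrow> ext z \<subseteq> ext (V x)"
proof -
  assume x: "x \<in> Ord"
  have "\<forall>z\<in>ext (V x). ext z \<subseteq> ext (V x)"
  proof (rule Ord_induct[where P = "\<lambda>x. \<forall>z\<in>ext (V x). ext z \<subseteq> ext (V x)", OF _ x])
    show "D True (\<lambda>s. \<forall>z\<in>ext (V (s 0)). ext z \<subseteq> ext (V (s 0)))" by (intro dfn)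
    fix a assume a: "a \<in> Ord" and IH: "\<forall>b\<in>ext a. \<forall>z\<in>ext (V b). ext z \<subseteq> ext (V b)"
    then show "\<forall>z\<in>ext (V a). ext z \<subseteq> ext (V a)" unfolding ext_V[OF a] by blast
  qed
  then show "z \<in> ext (V x) \<Longrightarrow> ext z \<subseteq> ext (V x)" by blast
qed

lemma V_mono: "x \<in> Ord \<Longrightarrow> y \<in> ext x \<Longrightarrow> ext (V y) \<subseteq> ext (V x)"
  using V_trans[of y] Ord_elt[of x y] unfolding ext_V[of x] by blast

text \<open>The step of T(x) = p \<union> \<Union>{\<Union>T(y) | y < x}; its value at omega is a
  transitive set that includes p.\<close>

definition GT where
  "GT p x f = mk {z. z \<in> M \<and> (z \<in> ext p \<or>
     (\<exists>y\<in>ext x. \<exists>w\<in>M. pair y w \<in> ext f \<and> (\<exists>u\<in>ext w. z \<in> ext u)))}"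

lemma DT_GT: "DT b (\<lambda>s. GT (s 0) (s 1) (s 2))"
  unfolding GT_def by (intro dfn)

lemma ex_transitive:
  assumes p: "p \<in> M" shows "\<exists>t\<in>M. ext p \<subseteq> ext t \<and> (\<forall>y\<in>ext t. ext y \<subseteq> ext t)"
proof -
  define T where "T = recF ordlt GT p"
  have DTT: "DT True (\<lambda>s. T (s 0))" unfolding T_def by (intro DT_recF[OF D_ordlt DT_GT] dfn DT_M_const p)
  have TM: "T x \<in> M" if "x \<in> M" for x using DT_app[OF DTT that] .
  have extT: "ext (T x) = ext p \<union> (\<Union>y\<in>ext x. \<Union>u\<in>ext (T y). ext u)" if x: "x \<in> Ord" for x
  proof -
    have xM: "x \<in> M" using x by simp
    have 1: "(\<exists>w\<in>M. pair y w \<in> ext (lam (preds ordlt p x) T) \<and> (\<exists>u\<in>ext w. z \<in> ext u)) \<longleftrightarrow>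
      (\<exists>u\<in>ext (T y). z \<in> ext u)" if "y \<in> ext x" for y z
    proof -
      have o: "ordlt p y x" using that x by (simp add: ordlt_def)
      show ?thesis
        using recF_pair[OF wfr_ordlt p D_ordlt DT_GT xM ext_M[OF that]] TM[OF ext_M[OF that]] o
        unfolding T_def[symmetric] by auto
    qed
    have "T x = GT p x (lam (preds ordlt p x) T)"
      using recF_eq[OF wfr_ordlt p D_ordlt DT_GT xM] unfolding T_def .
    also have "\<dots> = mk {z. z \<in> M \<and> (z \<in> ext p \<or> (\<exists>y\<in>ext x. \<exists>u\<in>ext (T y). z \<in> ext u))}"
      unfolding GT_def using 1 by (intro arg_cong[of _ _ mk]) blast
    finally have Tx: "T x = mk {z. z \<in> M \<and> (z \<in> ext p \<or> (\<exists>y\<in>ext x. \<exists>u\<in>ext (T y). z \<in> ext u))}" .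
    have "isset (\<Union>y\<in>ext x. ext (Uni (T y)))"
      by (rule isset_UN[OF xM]) (intro dfn DTT)
    moreover have "(\<Union>y\<in>ext x. ext (Uni (T y))) = (\<Union>y\<in>ext x. \<Union>u\<in>ext (T y). ext u)"
      by (intro SUP_cong refl ext_Un TM ext_M)
    ultimately have "isset (ext p \<union> (\<Union>y\<in>ext x. \<Union>u\<in>ext (T y). ext u))"
      using isset_Un2[OF isset_ext[OF p]] by simp
    moreover have "{z. z \<in> M \<and> (z \<in> ext p \<or> (\<exists>y\<in>ext x. \<exists>u\<in>ext (T y). z \<in> ext u))} =
      ext p \<union> (\<Union>y\<in>ext x. \<Union>u\<in>ext (T y). ext u)" by auto
    ultimately show ?thesis unfolding Tx by (simp add: ext_mk)
  qed
  have "ext y \<subseteq> ext (T om)" if y: "y \<in> ext (T om)" for y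
  proof (cases "y \<in> ext p")
    case True
    then have "y \<in> ext (T e0)" using extT[OF e0_Ord] by simp
    moreover have "e0 \<in> ext om" using om by (simp add: lim_def)
    ultimately show ?thesis using extT[OF om_Ord] by blast
  next
    case False
    then obtain x where x: "x \<in> ext om" "\<exists>u\<in>ext (T x). y \<in> ext u" using y extT[OF om_Ord] by auto
    then have xO: "x \<in> Ord" using Ord_elt om_Ord by blast
    have "y \<in> ext (T (sc x))" using x extT[OF Ord_sc[OF xO]] ext_sc[of x] xO by auto
    moreover have "sc x \<in> ext om" using om x lim_sc by blast
    ultimately show ?thesis using extT[OF om_Ord] by blast
  qed
  moreover have "ext p \<subseteq> ext (T om)" using extT[OF om_Ord] by auto
  ultimately show ?thesis using TM by (intro bexI[of _ "T om"]) auto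
qed

text \<open>Each \<open>s\<close> is sent to the least level containing a witness; replacement and
  \<open>Ord_bound\<close> give a common bound for these levels.\<close>

lemma V_collect:
  assumes x: "x \<in> M" and R: "D True (\<lambda>s. R (s 0) (s 1))"
  shows "\<exists>t\<in>Ord. \<forall>s\<in>ext x. (\<exists>u\<in>Ord. \<exists>a\<in>ext (V u). R s a) \<longrightarrow> (\<exists>a\<in>ext (V t). R s a)"
proof -
  define F where "F s = lst (\<lambda>u. \<exists>a\<in>ext (V u). R s a)" for s
  have F: "DT True (\<lambda>s. F (s 0))" unfolding F_def by (intro dfn D2[where R = R, OF R])
  obtain y where y: "y \<in> M" "ext y = F ` ext x" using repl[OF x F] unfolding isset_def by blast
  then have "ext y \<subseteq> Ord" by (auto simp: F_def)
  then obtain t where t: "t \<in> Ord" "ext y \<subseteq> ext t" using Ord_bound y(1) by blast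
  have "\<exists>a\<in>ext (V t). R s a" if s: "s \<in> ext x" "u \<in> Ord" "\<exists>a\<in>ext (V u). R s a" for s u
  proof -
    have "D True (\<lambda>v. \<exists>a\<in>ext (V (v 0)). R s a)"
      by (intro dfn D2[where R = R, OF R] DT_M_const) (use s in auto)
    from lst(1)[OF this s(2,3)] have "\<exists>a\<in>ext (V (F s)). R s a" unfolding F_def .
    moreover have "F s \<in> ext t" using s(1) y(2) t(2) by blast
    ultimately show ?thesis using V_mono[OF t(1)] by blast
  qed
  then show ?thesis using t(1) by blast
qed

text \<open>A membership-minimal set outside the hierarchy, taken inside a transitive set, has all
  its elements in the hierarchy. Collection puts them into one level, and the set itself into the
  next.\<close>

lemma V_cover: "x \<in> M \<Longrightarrow> \<exists>t\<in>Ord. x \<in> ext (V t)"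
proof (rule ccontr)
  assume x: "x \<in> M" and no: "\<not> (\<exists>t\<in>Ord. x \<in> ext (V t))"
  have step: "\<exists>t\<in>Ord. m \<in> ext (V t)" if m: "m \<in> M" "\<forall>y\<in>ext m. \<exists>t\<in>Ord. y \<in> ext (V t)" for m
  proof -
    have "D True (\<lambda>s. s 0 = s 1)" by (intro dfn)
    from V_collect[where R = "(=)", OF m(1) this] obtain t where t: "t \<in> Ord"
      "\<forall>s\<in>ext m. (\<exists>u\<in>Ord. \<exists>a\<in>ext (V u). s = a) \<longrightarrow> (\<exists>a\<in>ext (V t). s = a)" by blast
    then have "ext m \<subseteq> ext (V t)" using m(2) by blast
    then have "m \<in> ext (V (sc t))" using ext_V[OF Ord_sc[OF t(1)]] ext_sc[of t] t(1) m(1) by auto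
    then show ?thesis using t(1) Ord_sc by blast
  qed
  obtain t where t: "t \<in> M" "ext x \<subseteq> ext t" "\<forall>y\<in>ext t. ext y \<subseteq> ext t" using ex_transitive[OF x] by blast
  have "D True (\<lambda>s. \<not> (\<exists>t\<in>Ord. s 0 \<in> ext (V t)))" by (intro dfn)
  then have "isset {z \<in> insert x (ext t). \<not> (\<exists>t\<in>Ord. z \<in> ext (V t))}"
    using isset_sub[where P = "\<lambda>z. \<not> (\<exists>t\<in>Ord. z \<in> ext (V t))" and A = "insert x (ext t)"]
      isset_insert[OF x isset_ext[OF t(1)]] by blast
  from isset_found[OF this] obtain m where m: "m \<in> insert x (ext t)" "\<not> (\<exists>t\<in>Ord. m \<in> ext (V t))"
    "ext m \<inter> {z \<in> insert x (ext t). \<not> (\<exists>t\<in>Ord. z \<in> ext (V t))} = {}" using no by blast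
  have "ext m \<subseteq> ext t" using m(1) t by blast
  then have "\<forall>y\<in>ext m. \<exists>t\<in>Ord. y \<in> ext (V t)" using m(3) by blast
  then show False using step m(1,2) x by blast
qed

lemma V_sub: "x \<in> M \<Longrightarrow> \<exists>t\<in>Ord. ext x \<subseteq> ext (V t)"
  using V_cover V_trans by blast

lemma V_collectM:
  assumes x: "x \<in> M" and R: "D True (\<lambda>s. R (s 0) (s 1))"
  shows "\<exists>t\<in>Ord. \<forall>s\<in>ext x. (\<exists>a\<in>M. R s a) \<longrightarrow> (\<exists>a\<in>ext (V t). R s a)"
  using V_collect[OF assms] V_cover by meson

subsection \<open>Collapsing well-founded relations\<close>

text \<open>The range of \<open>f\<close>: recursion with this step is the Mostowski
  collapse.\<close>

definition Gc :: "'a \<Rightarrow> 'a \<Rightarrow> 'a \<Rightarrow> 'a" where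
  "Gc p x f = mk {z. z \<in> M \<and> (\<exists>y\<in>M. pair y z \<in> ext f)}"

definition clp where "clp R p x = recF R Gc p x"

lemma DT_Gc: "DT b (\<lambda>s. Gc (s 0) (s 1) (s 2))"
  unfolding Gc_def by (intro dfn)

lemma DT_clp:
  assumes "D b (\<lambda>s. R (s 0) (s 1) (s 2))" "DT b t" "DT b u"
  shows "DT b (\<lambda>s. clp R (t s) (u s))"
  unfolding clp_def by (intro DT_recF[OF assms(1) DT_Gc] assms)

lemma ext_clp:
  assumes "wfr R p" "p \<in> M" and R: "D True (\<lambda>s. R (s 0) (s 1) (s 2))" and x: "x \<in> M"
  shows "ext (clp R p x) = {clp R p y | y. y \<in> M \<and> R p y x}"
proof -
  have eq: "recF R Gc p = clp R p" by (rule HOL.ext) (simp add: clp_def)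
  have DTc: "DT True (\<lambda>s. clp R p (s 0))" by (intro DT_clp[OF R] dfn DT_M_const assms(2))
  have M: "clp R p y \<in> M" if "y \<in> M" for y using DT_app[OF DTc that] .
  have "clp R p x = Gc p x (lam (preds R p x) (clp R p))"
    using recF_eq[OF assms(1,2) R DT_Gc x] unfolding eq .
  also have "\<dots> = mk {clp R p y | y. y \<in> M \<and> R p y x}"
    unfolding Gc_def using recF_pair[OF assms(1,2) R DT_Gc x] M unfolding eq
    by (intro arg_cong[of _ _ mk]) blast
  finally have "clp R p x = mk {clp R p y | y. y \<in> M \<and> R p y x}" .
  moreover have "isset (clp R p ` ext (preds R p x))" by (rule repl[OF preds_M DTc])
  moreover have "clp R p ` ext (preds R p x) = {clp R p y | y. y \<in> M \<and> R p y x}"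
    using ext_preds[OF assms(1) x] by auto
  ultimately show ?thesis by (simp add: ext_mk)
qed

text \<open>As the relation is transitive, every value of the collapse is a transitive set; its
  elements are ordinals by induction.\<close>

lemma clp_Ord:
  assumes "wfr R p" "p \<in> M" and R: "D True (\<lambda>s. R (s 0) (s 1) (s 2))" and x: "x \<in> M"
  shows "clp R p x \<in> Ord"
proof (rule wfr_induct[OF assms(1,2) R _ x])
  have DTc: "DT True (\<lambda>s. clp R p (s 0))" by (intro DT_clp[OF R] dfn DT_M_const assms(2))
  show "D True (\<lambda>s. clp R p (s 0) \<in> Ord)" by (intro dfn DTc)
  fix x assume x: "x \<in> M" and IH: "\<And>y. y \<in> M \<Longrightarrow> R p y x \<Longrightarrow> clp R p y \<in> Ord"
  note e = ext_clp[OF assms(1-3)]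
  show "clp R p x \<in> Ord"
  proof (rule OrdI)
    show "clp R p x \<in> M" using DT_app[OF DTc x] .
    show "ext (clp R p x) \<subseteq> Ord" using IH e[OF x] by auto
    fix z assume "z \<in> ext (clp R p x)"
    then obtain y where y: "y \<in> M" "R p y x" "z = clp R p y" using e[OF x] by blast
    show "ext z \<subseteq> ext (clp R p x)"
    proof
      fix w assume "w \<in> ext z"
      then obtain v where v: "v \<in> M" "R p v y" "w = clp R p v" using y(3) e[OF y(1)] by blast
      then have "R p v x" using y x assms(1) unfolding wfr_def by blast
      then show "w \<in> ext (clp R p x)" using v e[OF x] by blast
    qed
  qed
qed

lemma clp_less:
  assumes "wfr R p" "p \<in> M" and R: "D True (\<lambda>s. R (s 0) (s 1) (s 2))" and x: "x \<in> M" "y \<in> M" "R p y x"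
  shows "clp R p y \<in> ext (clp R p x)"
  using ext_clp[OF assms(1-4)] x by blast

subsection \<open>Pairing of ordinals\<close>

definition mx :: "'a \<Rightarrow> 'a \<Rightarrow> 'a" where "mx a b = Uni (up a b)"

lemma DT_mx [dfn]: "DT b t \<Longrightarrow> DT b u \<Longrightarrow> DT b (\<lambda>s. mx (t s) (u s))"
  unfolding mx_def by (intro dfn)

lemma mx:
  assumes "a \<in> Ord" "b \<in> Ord"
  shows "mx a b \<in> Ord" "a = mx a b \<or> a \<in> ext (mx a b)" "b = mx a b \<or> b \<in> ext (mx a b)"
    "mx a b = a \<or> mx a b = b"
proof -
  have M: "a \<in> M" "b \<in> M" using assms by auto
  have e: "ext (mx a b) = ext a \<union> ext b" using M by (simp add: mx_def)
  show 1: "mx a b \<in> Ord" unfolding mx_def using assms M by (intro Ord_Un) auto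
  show "a = mx a b \<or> a \<in> ext (mx a b)" "b = mx a b \<or> b \<in> ext (mx a b)"
    using Ord_sub_iff[OF assms(1) 1] Ord_sub_iff[OF assms(2) 1] unfolding e by blast+
  have "ext (mx a b) = ext a \<or> ext (mx a b) = ext b"
    using e Ord_linear[OF assms] Ord_trans assms by blast
  then show "mx a b = a \<or> mx a b = b" using ext_inj 1 M by auto
qed

text \<open>Goedel's order of pairs. Comparing maxima before going lexicographic leaves each pair
  with only a set of predecessors; the collapse \<open>J\<close> is his pairing function.\<close>

definition god_lt :: "'a \<Rightarrow> 'a \<Rightarrow> 'a \<Rightarrow> 'a \<Rightarrow> bool" where
  "god_lt a b c d \<longleftrightarrow> mx a b \<in> ext (mx c d) \<or>
     (mx a b = mx c d \<and> (a \<in> ext c \<or> (a = c \<and> b \<in> ext d)))"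

definition god :: "'a \<Rightarrow> 'a \<Rightarrow> 'a \<Rightarrow> bool" where
  "god p y x \<longleftrightarrow> (\<exists>a\<in>Ord. \<exists>b\<in>Ord. \<exists>c\<in>Ord. \<exists>d\<in>Ord. y = pair a b \<and> x = pair c d \<and> god_lt a b c d)"

lemma D_god: "D b (\<lambda>s. god (s 0) (s 1) (s 2))"
  unfolding god_def god_lt_def by (intro dfn)

lemma god_pair: "a \<in> Ord \<Longrightarrow> b \<in> Ord \<Longrightarrow> c \<in> Ord \<Longrightarrow> d \<in> Ord \<Longrightarrow>
  god p (pair a b) (pair c d) \<longleftrightarrow> god_lt a b c d"
  unfolding god_def by auto

lemma god_lt_trans:
  assumes O: "a \<in> Ord" "b \<in> Ord" "c \<in> Ord" "d \<in> Ord" "e \<in> Ord" "f \<in> Ord"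
    and "god_lt a b c d" "god_lt c d e f"
  shows "god_lt a b e f"
proof -
  note tr = Ord_trans[OF mx(1)[OF O(5,6)]] Ord_trans[OF O(5)] Ord_trans[OF O(6)]
  show ?thesis using assms(7,8) tr unfolding god_lt_def by metis
qed

lemma god_lt_linear:
  assumes O: "a \<in> Ord" "b \<in> Ord" "c \<in> Ord" "d \<in> Ord"
  shows "god_lt a b c d \<or> (a = c \<and> b = d) \<or> god_lt c d a b"
  using Ord_linear[OF mx(1)[OF O(1,2)] mx(1)[OF O(3,4)]] Ord_linear[OF O(1,3)] Ord_linear[OF O(2,4)]
  unfolding god_lt_def by metis

lemma isset_prod:
  assumes "x \<in> M" "y \<in> M" shows "isset {pair a b | a b. a \<in> ext x \<and> b \<in> ext y}"
proof -
  have 1: "ext (mk {z. z \<in> M \<and> (\<exists>b\<in>ext y. z = pair a b)}) = pair a ` ext y" if a: "a \<in> M" for a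
    by (rule ext_mk_image[OF assms(2)]) (intro dfn DT_M_const a)
  have "isset (\<Union>a\<in>ext x. ext (mk {z. z \<in> M \<and> (\<exists>b\<in>ext y. z = pair a b)}))"
    by (rule isset_UN[OF assms(1)]) (intro dfn DT_M_const assms)
  moreover have "(\<Union>a\<in>ext x. ext (mk {z. z \<in> M \<and> (\<exists>b\<in>ext y. z = pair a b)})) =
     (\<Union>a\<in>ext x. pair a ` ext y)"
    by (intro SUP_cong refl 1 ext_M)
  moreover have "\<dots> = {pair a b | a b. a \<in> ext x \<and> b \<in> ext y}" by auto
  ultimately show ?thesis by simp
qed

lemma wfr_god: "wfr god p"
  unfolding wfr_def
proof (intro conjI ballI impI)
  fix x assume x: "x \<in> M"
  show "isset {y. y \<in> M \<and> god p y x}"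
  proof (cases "\<exists>c\<in>Ord. \<exists>d\<in>Ord. x = pair c d")
    case False
    then have *: "{y. y \<in> M \<and> god p y x} = {}" unfolding god_def by blast
    show ?thesis unfolding * by simp
  next
    case True
    then obtain c d where cd: "c \<in> Ord" "d \<in> Ord" "x = pair c d" by blast
    let ?m = "sc (mx c d)"
    have m: "mx c d \<in> Ord" using mx(1) cd by blast
    have sub: "y \<in> {pair a b | a b. a \<in> ext ?m \<and> b \<in> ext ?m}" if y: "god p y x" for y
    proof -
      from y obtain a b c' d' where ab: "a \<in> Ord" "b \<in> Ord" "c' \<in> Ord" "d' \<in> Ord" "y = pair a b"
        "x = pair c' d'" "god_lt a b c' d'" unfolding god_def by blast
      then have "c' = c" "d' = d" using cd by auto
      then have "mx a b \<in> ext ?m" using ab(7) m unfolding god_lt_def by auto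
      then have "a \<in> ext ?m" "b \<in> ext ?m"
        using mx(2,3)[OF ab(1,2)] Ord_trans[OF Ord_sc[OF m]] by metis+
      then show ?thesis using ab(5) by blast
    qed
    have "D True (\<lambda>s. god p (s 0) x)"
      unfolding god_def god_lt_def by (intro dfn DT_M_const x)
    from isset_sub[where P = "\<lambda>y. god p y x", OF isset_prod[of ?m ?m] this]
    have "isset {y \<in> {pair a b | a b. a \<in> ext ?m \<and> b \<in> ext ?m}. god p y x}" by simp
    moreover have "{y \<in> {pair a b | a b. a \<in> ext ?m \<and> b \<in> ext ?m}. god p y x} = {y. y \<in> M \<and> god p y x}"
      using sub by (auto simp: god_def)
    ultimately show ?thesis by simp
  qed
next
  fix x y z assume "god p x y" "god p y z"
  then show "god p x z" unfolding god_def using god_lt_trans by (metis Ord_M pair_inj)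
next
  fix a assume a: "a \<in> M" "ext a \<noteq> {}"
  show "\<exists>m\<in>ext a. \<forall>y\<in>ext a. \<not> god p y m"
  proof (cases "\<exists>z\<in>ext a. \<not> (\<exists>c\<in>Ord. \<exists>d\<in>Ord. z = pair c d)")
    case True
    then show ?thesis unfolding god_def by blast
  next
    case False
    obtain z where z: "z \<in> ext a" using a(2) by auto
    with False obtain c d where "c \<in> Ord" "d \<in> Ord" "z = pair c d" by blast
    then have cd: "c \<in> Ord" "d \<in> Ord" "pair c d \<in> ext a" using z by auto
    \<comment> \<open>A minimal pair is found by minimising the maximum, then the first and then the
      second component.\<close>
    let ?P = "\<lambda>m. \<exists>c\<in>Ord. \<exists>d\<in>Ord. pair c d \<in> ext a \<and> m = mx c d"
    have "D True (\<lambda>s. ?P (s 0))" by (intro dfn DT_M_const a)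
    from Ord_least[where P = ?P, OF this mx(1)[OF cd(1,2)]] cd
    obtain m where m: "m \<in> Ord" "?P m" "\<forall>k\<in>ext m. \<not> ?P k" by blast
    let ?Q = "\<lambda>c. \<exists>d\<in>Ord. pair c d \<in> ext a \<and> m = mx c d"
    have "D True (\<lambda>s. ?Q (s 0))" by (intro dfn DT_M_const a Ord_M m)
    from Ord_least[where P = ?Q, OF this] m(2)
    obtain c where c: "c \<in> Ord" "?Q c" "\<forall>k\<in>ext c. \<not> ?Q k" by blast
    let ?R = "\<lambda>d. pair c d \<in> ext a \<and> m = mx c d"
    have "D True (\<lambda>s. ?R (s 0))" by (intro dfn DT_M_const a Ord_M m c)
    from Ord_least[where P = ?R, OF this] c(2)
    obtain d where d: "d \<in> Ord" "?R d" "\<forall>k\<in>ext d. \<not> ?R k" by blast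
    have "\<not> god p y (pair c d)" if y: "y \<in> ext a" for y
    proof
      assume "god p y (pair c d)"
      then obtain a' b' where ab: "a' \<in> Ord" "b' \<in> Ord" "y = pair a' b'" "god_lt a' b' c d"
        unfolding god_def using c(1) d(1) by auto
      have md: "mx c d = m" using d(2) by simp
      have y': "pair a' b' \<in> ext a" using y ab(3) by simp
      from ab(4) consider "mx a' b' \<in> ext m" | "mx a' b' = m" "a' \<in> ext c"
        | "mx a' b' = m" "a' = c" "b' \<in> ext d"
        unfolding god_lt_def md by metis
      then show False
      proof cases
        case 1
        then show False using m(3) ab(1,2) y' by blast
      next
        case 2
        then have "?Q a'" using ab(1,2) y' by blast
        then show False using c(3) 2 by blast
      next
        case 3
        then have "?R b'" using y' by blast
        then show False using d(3) 3 by blast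
      qed
    qed
    then show ?thesis using d by blast
  qed
qed

definition J :: "'a \<Rightarrow> 'a \<Rightarrow> 'a" where "J a b = clp god e0 (pair a b)"

lemma DT_J [dfn]: "DT b t \<Longrightarrow> DT b u \<Longrightarrow> DT b (\<lambda>s. J (t s) (u s))"
  unfolding J_def by (intro DT_clp[OF D_god] dfn)

lemma J_Ord [simp]: "J a b \<in> Ord"
  unfolding J_def by (rule clp_Ord[OF wfr_god e0(1) D_god pair_M])

lemma J_less:
  assumes "a \<in> Ord" "b \<in> Ord" "c \<in> Ord" "d \<in> Ord" "god_lt a b c d"
  shows "J a b \<in> ext (J c d)"
  unfolding J_def by (rule clp_less[OF wfr_god e0(1) D_god]) (use assms god_pair in auto)

lemma J_inj:
  assumes "a \<in> Ord" "b \<in> Ord" "c \<in> Ord" "d \<in> Ord" shows "J a b = J c d \<longleftrightarrow> a = c \<and> b = d"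
  using god_lt_linear[OF assms] J_less assms mem_irrefl by metis

lemma god_lt_mono:
  assumes a: "a \<in> Ord" "b \<in> Ord" and less: "a' \<in> ext a \<and> b' = b \<or> a' = a \<and> b' \<in> ext b"
  shows "god_lt a' b' a b"
proof -
  have a': "a' \<in> Ord" "b' \<in> Ord" using a less Ord_elt by blast+
  have "ext (mx a' b') \<subseteq> ext (mx a b)"
    using a a' less Ord_trans[OF a(1)] Ord_trans[OF a(2)] by (auto simp: mx_def)
  then have "mx a' b' = mx a b \<or> mx a' b' \<in> ext (mx a b)"
    using Ord_sub_iff mx(1) a a' by blast
  then show ?thesis using less unfolding god_lt_def by blast
qed

text \<open>At a least \<open>a\<close> with F(a) < a, monotonicity would give F(F(a)) < F(a), a
  smaller counterexample.\<close>

lemma Ord_increasing: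
  assumes F: "DT True (\<lambda>s. F (s 0))" and O: "\<And>a. a \<in> Ord \<Longrightarrow> F a \<in> Ord"
    and mono: "\<And>a b. a \<in> Ord \<Longrightarrow> b \<in> ext a \<Longrightarrow> F b \<in> ext (F a)" and a: "a \<in> Ord"
  shows "F a = a \<or> a \<in> ext (F a)"
proof -
  have "F a \<notin> ext a"
  proof (rule Ord_induct[where P = "\<lambda>a. F a \<notin> ext a", OF _ a])
    show "D True (\<lambda>s. F (s 0) \<notin> ext (s 0))" by (intro dfn F)
    fix a assume "a \<in> Ord" "\<forall>b\<in>ext a. F b \<notin> ext b"
    then show "F a \<notin> ext a" using mono by blast
  qed
  then show ?thesis using Ord_linear[OF O[OF a] a] by blast
qed

lemma J_ge1: "a \<in> Ord \<Longrightarrow> b \<in> Ord \<Longrightarrow> J a b = a \<or> a \<in> ext (J a b)"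
  by (rule Ord_increasing[where F = "\<lambda>a. J a b"])
    (auto intro!: dfn DT_Ord_const J_less god_lt_mono intro: Ord_elt)

lemma J_ge2: "a \<in> Ord \<Longrightarrow> b \<in> Ord \<Longrightarrow> J a b = b \<or> b \<in> ext (J a b)"
  by (rule Ord_increasing[where F = "\<lambda>b. J a b"])
    (auto intro!: dfn DT_Ord_const J_less god_lt_mono intro: Ord_elt)

text \<open>Strict growth needs a nonzero first component, since J(0,0) = 0. This is why every tag
  of a code below is a nonzero numeral.\<close>

lemma J_gt2: "a \<in> Ord \<Longrightarrow> b \<in> Ord \<Longrightarrow> a \<noteq> e0 \<Longrightarrow> b \<in> ext (J a b)"
proof -
  assume a: "a \<in> Ord" "b \<in> Ord" "a \<noteq> e0"
  then have "e0 \<in> ext a" using e0_least by blast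
  then have "J e0 b \<in> ext (J a b)" using a by (intro J_less god_lt_mono) auto
  then show ?thesis using J_ge2[of e0 b] Ord_trans[of "J a b" "J e0 b" b] a by auto
qed

subsection \<open>A definable enumeration of the ordinal definable sets\<close>

text \<open>Only standard numbers get numerals; they serve as tags and as the variable indices of
  actual formulas, while codes may use any ordinals.\<close>

primrec num :: "nat \<Rightarrow> 'a" where
  "num 0 = e0"
| "num (Suc n) = sc (num n)"

lemma num_Ord [simp]: "num n \<in> Ord"
  by (induction n) auto

lemma num_inj [simp]: "num m = num n \<longleftrightarrow> m = n"
proof (induction m arbitrary: n)
  case 0
  then show ?case by (cases n) (auto dest: sym)
next
  case (Suc m)
  then show ?case by (cases n) (auto simp: sc_inj)
qed

lemma DT_num [dfn]: "DT b (\<lambda>s. num n)"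
  by (rule DT_Ord_const) simp

text \<open>
  Every set serves as an assignment of values to ordinals, so that all assignments from some
  \<open>V v\<close> form a set without further work; \<open>val s i\<close> is meaningful only if \<open>s\<close> is single-valued at \<open>i\<close>.
\<close>

definition val :: "'a \<Rightarrow> 'a \<Rightarrow> 'a" where
  "val s i = Uni (mk {y. y \<in> M \<and> pair i y \<in> ext s})"

definition upd :: "'a \<Rightarrow> 'a \<Rightarrow> 'a \<Rightarrow> 'a" where
  "upd s n a = mk {z. z \<in> M \<and> ((z \<in> ext s \<and> \<not> (\<exists>y\<in>M. z = pair n y)) \<or> z = pair n a)}"

lemma val_M [simp]: "val s i \<in> M" by (simp add: val_def)
lemma upd_M [simp]: "upd s n a \<in> M" by (simp add: upd_def)

lemma DT_val [dfn]: "DT b t \<Longrightarrow> DT b u \<Longrightarrow> DT b (\<lambda>s. val (t s) (u s))"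
  by (rule DT2[where F = val]) (unfold val_def, intro dfn)

lemma DT_upd [dfn]: "DT b t \<Longrightarrow> DT b u \<Longrightarrow> DT b v \<Longrightarrow> DT b (\<lambda>s. upd (t s) (u s) (v s))"
  by (rule DT3[where F = upd]) (unfold upd_def, intro dfn)

lemma ext_upd:
  assumes "s \<in> M" "n \<in> M" "a \<in> M"
  shows "ext (upd s n a) = insert (pair n a) {z \<in> ext s. \<not> (\<exists>y\<in>M. z = pair n y)}"
proof -
  have "isset {z \<in> ext s. \<not> (\<exists>y\<in>M. z = pair n y)}"
    by (rule sep[OF assms(1)]) (intro dfn DT_M_const assms)
  then have "isset (insert (pair n a) {z \<in> ext s. \<not> (\<exists>y\<in>M. z = pair n y)})" by simp
  moreover have "{z. z \<in> M \<and> ((z \<in> ext s \<and> \<not> (\<exists>y\<in>M. z = pair n y)) \<or> z = pair n a)} =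
    insert (pair n a) {z \<in> ext s. \<not> (\<exists>y\<in>M. z = pair n y)}" by auto
  ultimately show ?thesis unfolding upd_def by (simp add: ext_mk)
qed

lemma val_upd:
  assumes M: "s \<in> M" "n \<in> M" "a \<in> M" "i \<in> M"
  shows "val (upd s n a) i = (if i = n then a else val s i)"
proof (cases "i = n")
  case True
  have "{y. y \<in> M \<and> pair i y \<in> ext (upd s n a)} = {a}"
    unfolding ext_upd[OF M(1-3)] using True M by auto
  then have "val (upd s n a) i = Uni (mk {a})" by (simp add: val_def)
  also have "\<dots> = a"
  proof (rule ext_inj)
    show "ext (Uni (mk {a})) = ext a" using M by (simp add: ext_mk)
  qed (use M in auto)
  finally show ?thesis using True by simp
next
  case False
  have "{y. y \<in> M \<and> pair i y \<in> ext (upd s n a)} = {y. y \<in> M \<and> pair i y \<in> ext s}"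
    unfolding ext_upd[OF M(1-3)] using False M by auto
  then show ?thesis using False by (simp add: val_def)
qed

text \<open>\<open>t\<close> is the tag, \<open>v\<close> the level from which assignments are
  taken, and \<open>c\<close> the level bounding a quantifier; depending on the tag,
  \<open>a\<close> and \<open>b\<close> are variable indices, codes of subformulas, or an ordinal
  parameter.\<close>

definition code :: "'a \<Rightarrow> 'a \<Rightarrow> 'a \<Rightarrow> 'a \<Rightarrow> 'a \<Rightarrow> 'a" where
  "code t v a b c = J t (J v (J a (J b c)))"

lemma code_Ord [simp]: "code t v a b c \<in> Ord" by (simp add: code_def)

lemma DT_code [dfn]: "DT x t1 \<Longrightarrow> DT x t2 \<Longrightarrow> DT x t3 \<Longrightarrow> DT x t4 \<Longrightarrow> DT x t5 \<Longrightarrow>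
  DT x (\<lambda>s. code (t1 s) (t2 s) (t3 s) (t4 s) (t5 s))"
  unfolding code_def by (intro dfn)

lemma code_inj:
  assumes "t \<in> Ord" "v \<in> Ord" "a \<in> Ord" "b \<in> Ord" "c \<in> Ord"
    "t' \<in> Ord" "v' \<in> Ord" "a' \<in> Ord" "b' \<in> Ord" "c' \<in> Ord"
  shows "code t v a b c = code t' v' a' b' c' \<longleftrightarrow> t = t' \<and> v = v' \<and> a = a' \<and> b = b' \<and> c = c'"
  unfolding code_def using assms by (simp add: J_inj)

lemma code_gt:
  assumes "t \<in> Ord" "v \<in> Ord" "a \<in> Ord" "b \<in> Ord" "c \<in> Ord" "t \<noteq> e0"
  shows "a \<in> ext (code t v a b c)" "b \<in> ext (code t v a b c)"
proof -
  let ?x = "J b c" let ?y = "J a ?x" let ?z = "J v ?y"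
  have z: "?z \<in> ext (code t v a b c)" unfolding code_def using assms by (intro J_gt2) auto
  note tr = Ord_trans[OF code_Ord[of t v a b c]]
  have y: "?y \<in> ext (code t v a b c)" using J_ge2[of v ?y] assms z tr by auto
  show "a \<in> ext (code t v a b c)" using J_ge1[of a ?x] assms y tr by auto
  have "?x \<in> ext (code t v a b c)" using J_ge2[of a ?x] assms y tr by auto
  then show "b \<in> ext (code t v a b c)" using J_ge1[of b c] assms tr by auto
qed

text \<open>
  One step of the satisfaction recursion, for formulas in which each quantifier carries its own
  bound \<open>V c\<close>. The tags stand for membership, equality, equality with an
  ordinal, joint denial, and bounded universal quantification.
\<close>

definition Hbody :: "('a \<Rightarrow> 'a \<Rightarrow> bool) \<Rightarrow> 'a \<Rightarrow> 'a \<Rightarrow> 'a \<Rightarrow> 'a \<Rightarrow> 'a \<Rightarrow> bool" where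
  "Hbody in_rec t a b c s \<longleftrightarrow>
     (t = num 1 \<and> val s a \<in> ext (val s b)) \<or>
     (t = num 2 \<and> val s a = val s b) \<or>
     (t = num 3 \<and> val s a = b) \<or>
     (t = num 4 \<and> \<not> (in_rec a s \<and> in_rec b s)) \<or>
     (t = num 5 \<and> (\<forall>u\<in>ext (V c). in_rec b (upd s a u)))"

definition GH :: "'a \<Rightarrow> 'a \<Rightarrow> 'a \<Rightarrow> 'a" where
  "GH p g f = mk {s. s \<in> M \<and> (\<exists>t\<in>Ord. \<exists>v\<in>Ord. \<exists>a\<in>Ord. \<exists>b\<in>Ord. \<exists>c\<in>Ord.
     g = code t v a b c \<and> s \<in> ext (V v) \<and>
     Hbody (\<lambda>y z. \<exists>w\<in>M. pair y w \<in> ext f \<and> z \<in> ext w) t a b c s)}"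

text \<open>\<open>H g\<close> is the set of satisfying assignments of the formula coded by
  \<open>g\<close>. A level \<open>V v\<close> is built into each code to keep this a set; a
  quantified subformula brings its own level, large enough for the updated assignments.\<close>

definition H :: "'a \<Rightarrow> 'a" where "H g = recF ordlt GH e0 g"

lemma DT_GH: "DT b (\<lambda>s. GH (s 0) (s 1) (s 2))"
  unfolding GH_def Hbody_def by (intro dfn)

lemma DT_H [dfn]: "DT b t \<Longrightarrow> DT b (\<lambda>s. H (t s))"
  unfolding H_def by (intro DT_recF[OF D_ordlt DT_GH] dfn)

lemma H_M [simp]: "x \<in> M \<Longrightarrow> H x \<in> M"
  using DT_app[OF DT_H[OF DT_var]] .

lemma ext_H:
  assumes O: "t \<in> Ord" "v \<in> Ord" "a \<in> Ord" "b \<in> Ord" "c \<in> Ord" "t \<noteq> e0"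
  shows "ext (H (code t v a b c)) = {s \<in> ext (V v). Hbody (\<lambda>y z. z \<in> ext (H y)) t a b c s}"
proof -
  let ?g = "code t v a b c"
  have gM: "?g \<in> M" by simp
  have eq: "recF ordlt GH e0 = H" by (rule HOL.ext) (simp add: H_def)
  let ?f = "lam (preds ordlt e0 ?g) H"
  have P: "(\<exists>w\<in>M. pair y w \<in> ext ?f \<and> z \<in> ext w) \<longleftrightarrow> z \<in> ext (H y)" if y: "y \<in> ext ?g" for y z
  proof -
    have o: "ordlt e0 y ?g" using y by (simp add: ordlt_def)
    show ?thesis
      using recF_pair[OF wfr_ordlt e0(1) D_ordlt DT_GH gM ext_M[OF y]] H_M[OF ext_M[OF y]] o
      unfolding eq by auto
  qed
  note gt = code_gt[OF O]
  have B: "Hbody (\<lambda>y z. \<exists>w\<in>M. pair y w \<in> ext ?f \<and> z \<in> ext w) t a b c s \<longleftrightarrow>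
    Hbody (\<lambda>y z. z \<in> ext (H y)) t a b c s" for s
    unfolding Hbody_def P[OF gt(1)] P[OF gt(2)] ..
  have "H ?g = GH e0 ?g ?f"
    using recF_eq[OF wfr_ordlt e0(1) D_ordlt DT_GH gM] unfolding eq .
  also have "\<dots> = mk {s \<in> ext (V v). Hbody (\<lambda>y z. z \<in> ext (H y)) t a b c s}"
    unfolding GH_def
  proof (intro arg_cong[of _ _ mk] Collect_cong)
    fix s
    show "(s \<in> M \<and> (\<exists>t'\<in>Ord. \<exists>v'\<in>Ord. \<exists>a'\<in>Ord. \<exists>b'\<in>Ord. \<exists>c'\<in>Ord.
      ?g = code t' v' a' b' c' \<and> s \<in> ext (V v') \<and>
      Hbody (\<lambda>y z. \<exists>w\<in>M. pair y w \<in> ext ?f \<and> z \<in> ext w) t' a' b' c' s)) \<longleftrightarrow>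
      (s \<in> ext (V v) \<and> Hbody (\<lambda>y z. z \<in> ext (H y)) t a b c s)" (is "?L \<longleftrightarrow> ?R")
    proof
      assume ?L
      then obtain t' v' a' b' c' where *: "t' \<in> Ord" "v' \<in> Ord" "a' \<in> Ord" "b' \<in> Ord" "c' \<in> Ord"
        "?g = code t' v' a' b' c'" "s \<in> ext (V v')"
        "Hbody (\<lambda>y z. \<exists>w\<in>M. pair y w \<in> ext ?f \<and> z \<in> ext w) t' a' b' c' s" by blast
      have "t' = t" "v' = v" "a' = a" "b' = b" "c' = c"
        using code_inj[OF O(1-5) *(1-5)] *(6) by auto
      then show ?R using *(7,8) B by simp
    next
      assume ?R
      then show ?L using B O by blast
    qed
  qed
  finally have e: "H ?g = mk {s \<in> ext (V v). Hbody (\<lambda>y z. z \<in> ext (H y)) t a b c s}" .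
  have "isset {s \<in> ext (V v). Hbody (\<lambda>y z. z \<in> ext (H y)) t a b c s}"
  proof (rule sep)
    show "V v \<in> M" using O by simp
    show "D True (\<lambda>s. Hbody (\<lambda>y z. z \<in> ext (H y)) t a b c (s 0))"
      unfolding Hbody_def by (intro dfn DT_Ord_const O)
  qed
  then show ?thesis unfolding e by (rule ext_mk)
qed

text \<open>Closure of this predicate under the logical operations takes the place of an internal
  syntax: codes are produced only for actual formulas.\<close>

definition cod :: "'a \<Rightarrow> ('a \<Rightarrow> bool) \<Rightarrow> bool" where
  "cod v Q \<longleftrightarrow> (\<exists>g\<in>Ord. ext (H g) = {s \<in> ext (V v). Q s})"

lemma codI:
  assumes "t \<in> Ord" "v \<in> Ord" "a \<in> Ord" "b \<in> Ord" "c \<in> Ord" "t \<noteq> e0"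
    "\<And>s. s \<in> ext (V v) \<Longrightarrow> Hbody (\<lambda>y z. z \<in> ext (H y)) t a b c s \<longleftrightarrow> Q s"
  shows "cod v Q"
proof -
  have "ext (H (code t v a b c)) = {s \<in> ext (V v). Q s}"
    unfolding ext_H[OF assms(1-6)] using assms(7) by blast
  then show ?thesis unfolding cod_def by (intro bexI[of _ "code t v a b c"]) auto
qed

lemma num_Suc_neq [simp]: "num (Suc n) \<noteq> e0"
  using num_inj[of "Suc n" 0] by simp

lemma Hbody_simps:
  "Hbody r (num (Suc 0)) a b c s \<longleftrightarrow> val s a \<in> ext (val s b)"
  "Hbody r (num (Suc (Suc 0))) a b c s \<longleftrightarrow> val s a = val s b"
  "Hbody r (num (Suc (Suc (Suc 0)))) a b c s \<longleftrightarrow> val s a = b"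
  "Hbody r (num (Suc (Suc (Suc (Suc 0))))) a b c s \<longleftrightarrow> \<not> (r a s \<and> r b s)"
  "Hbody r (num (Suc (Suc (Suc (Suc (Suc 0)))))) a b c s \<longleftrightarrow> (\<forall>u\<in>ext (V c). r b (upd s a u))"
  unfolding Hbody_def num_inj by auto

lemma cod_mem: "v \<in> Ord \<Longrightarrow> i \<in> Ord \<Longrightarrow> j \<in> Ord \<Longrightarrow> cod v (\<lambda>s. val s i \<in> ext (val s j))"
  by (rule codI[of "num (Suc 0)" v i j e0]) (auto simp: Hbody_simps simp del: num.simps)

lemma cod_eq: "v \<in> Ord \<Longrightarrow> i \<in> Ord \<Longrightarrow> j \<in> Ord \<Longrightarrow> cod v (\<lambda>s. val s i = val s j)"
  by (rule codI[of "num (Suc (Suc 0))" v i j e0]) (auto simp: Hbody_simps simp del: num.simps)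

lemma cod_par: "v \<in> Ord \<Longrightarrow> i \<in> Ord \<Longrightarrow> j \<in> Ord \<Longrightarrow> cod v (\<lambda>s. val s i = j)"
  by (rule codI[of "num (Suc (Suc (Suc 0)))" v i j e0]) (auto simp: Hbody_simps simp del: num.simps)

lemma cod_nand:
  assumes "v \<in> Ord" "cod v P" "cod v Q" shows "cod v (\<lambda>s. \<not> (P s \<and> Q s))"
proof -
  obtain a b where "a \<in> Ord" "ext (H a) = {s \<in> ext (V v). P s}"
    "b \<in> Ord" "ext (H b) = {s \<in> ext (V v). Q s}" using assms unfolding cod_def by blast
  then show ?thesis using assms(1)
    by (intro codI[of "num (Suc (Suc (Suc (Suc 0))))" v a b e0])
      (auto simp: Hbody_simps simp del: num.simps)
qed

lemma cod_all:
  assumes O: "v \<in> Ord" "v' \<in> Ord" "n \<in> Ord"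
    and sub: "\<And>s u. s \<in> ext (V v) \<Longrightarrow> u \<in> ext (V v') \<Longrightarrow> upd s n u \<in> ext (V v'')"
    and Q: "cod v'' Q"
  shows "cod v (\<lambda>s. \<forall>u\<in>ext (V v'). Q (upd s n u))"
proof -
  obtain b where "b \<in> Ord" "ext (H b) = {s \<in> ext (V v''). Q s}" using Q unfolding cod_def by blast
  then show ?thesis using O sub
    by (intro codI[of "num (Suc (Suc (Suc (Suc (Suc 0)))))" v n b v'])
      (auto simp: Hbody_simps simp del: num.simps)
qed

lemma cod_cong: "cod v P \<Longrightarrow> (\<And>s. s \<in> ext (V v) \<Longrightarrow> P s \<longleftrightarrow> Q s) \<Longrightarrow> cod v Q"
  unfolding cod_def by (metis (mono_tags, lifting) Collect_cong)

lemma cod_neg: "v \<in> Ord \<Longrightarrow> cod v P \<Longrightarrow> cod v (\<lambda>s. \<not> P s)"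
  using cod_nand[of v P P] by simp

lemma cod_conj: "v \<in> Ord \<Longrightarrow> cod v P \<Longrightarrow> cod v Q \<Longrightarrow> cod v (\<lambda>s. P s \<and> Q s)"
  using cod_neg[OF _ cod_nand[of v P Q]] by simp

lemma upd_bound:
  assumes x: "x \<in> M" "y \<in> M" "n \<in> M"
  shows "\<exists>w\<in>Ord. \<forall>s\<in>ext x. \<forall>u\<in>ext y. upd s n u \<in> ext (V w)"
proof -
  define F where "F s = mk {z. z \<in> M \<and> (\<exists>u\<in>ext y. z = upd s n u)}" for s
  have eF: "ext (F s) = (\<lambda>u. upd s n u) ` ext y" if s: "s \<in> M" for s
    unfolding F_def by (rule ext_mk_image[OF x(2)]) (intro dfn DT_M_const x s)
  have "isset (\<Union>s\<in>ext x. ext (F s))"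
    by (rule isset_UN[OF x(1)]) (unfold F_def, intro dfn DT_M_const x)
  then obtain z where z: "z \<in> M" "ext z = (\<Union>s\<in>ext x. ext (F s))" unfolding isset_def by blast
  obtain w where w: "w \<in> Ord" "ext z \<subseteq> ext (V w)" using V_sub[OF z(1)] by blast
  have "upd s n u \<in> ext (V w)" if "s \<in> ext x" "u \<in> ext y" for s u
    using that w(2) eF[OF ext_M[OF that(1)]] unfolding z(2) by blast
  then show ?thesis using w(1) by blast
qed

text \<open>On assignments from one level, truth in all of \<open>M\<close> agrees with a formula
  whose quantifiers are bounded; the bounds depend on the level, hence the generalisation over
  \<open>v\<close>.\<close>

lemma cod_sat: "v \<in> Ord \<Longrightarrow> cod v (\<lambda>s. sat M E (\<lambda>i. val s (num i)) p)"
proof (induction p arbitrary: v)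
  case (Mem i j)
  show ?case by (rule cod_cong[OF cod_mem[OF Mem, of "num i" "num j"]]) (auto simp: ext_iff)
next
  case (Eql i j)
  show ?case by (rule cod_cong[OF cod_eq[OF Eql, of "num i" "num j"]]) auto
next
  case (Neg p)
  show ?case using cod_neg[OF Neg.prems Neg.IH[OF Neg.prems]] by simp
next
  case (Conj p q)
  show ?case using cod_conj[OF Conj.prems Conj.IH[OF Conj.prems]] by simp
next
  case (All n p)
  have VM: "V v \<in> M" using All.prems by simp
  \<comment> \<open>Counterexamples, not instances, are collected: if the universal statement fails
    for an assignment in \<open>V v\<close>, it already fails for a value in \<open>V v'\<close>, so
    the bounded quantifier is equivalent to the full one.\<close>
  let ?R = "\<lambda>s a. \<not> sat M E (\<lambda>i. if i = n then a else val s (num i)) p"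
  have "DT True (\<lambda>s. if i = n then s 1 else val (s 0) (num i))" for i
    by (cases "i = n") (auto intro!: dfn)
  then have "D True (\<lambda>s. ?R (s 0) (s 1))" by (intro D_neg D_sat)
  from V_collectM[where R = ?R, OF VM this] obtain v' where v': "v' \<in> Ord"
    "\<And>s. s \<in> ext (V v) \<Longrightarrow> (\<exists>a\<in>M. ?R s a) \<longrightarrow> (\<exists>a\<in>ext (V v'). ?R s a)" by blast
  have V'M: "V v' \<in> M" using v'(1) by simp
  \<comment> \<open>The updated assignments leave \<open>V v\<close>; the induction hypothesis is
    used at the level \<open>v''\<close> containing them.\<close>
  obtain v'' where v'': "v'' \<in> Ord"
    "\<And>s u. s \<in> ext (V v) \<Longrightarrow> u \<in> ext (V v') \<Longrightarrow> upd s (num n) u \<in> ext (V v'')"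
    using upd_bound[OF VM V'M, of "num n"] by auto
  show ?case
  proof (rule cod_cong[OF cod_all[OF All.prems v'(1) num_Ord v''(2) All.IH[OF v''(1)]]])
    fix s assume s: "s \<in> ext (V v)"
    then have sM: "s \<in> M" by auto
    have e: "(\<lambda>i. val (upd s (num n) u) (num i)) = (\<lambda>i. if i = n then u else val s (num i))"
      if "u \<in> M" for u
      by (rule HOL.ext) (use val_upd[OF sM _ that] in simp)
    have e2: "(\<lambda>i. val s (num i))(n := u) = (\<lambda>i. if i = n then u else val s (num i))" for u
      by auto
    have "(\<forall>u\<in>ext (V v'). sat M E (\<lambda>i. val (upd s (num n) u) (num i)) p) \<longleftrightarrow>
      (\<forall>u\<in>ext (V v'). \<not> ?R s u)" using e[OF ext_M] by auto
    also have "\<dots> \<longleftrightarrow> (\<forall>u\<in>M. \<not> ?R s u)" using v'(2)[OF s] ext_M by blast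
    finally show "(\<forall>u\<in>ext (V v'). sat M E (\<lambda>i. val (upd s (num n) u) (num i)) p) \<longleftrightarrow>
      sat M E (\<lambda>i. val s (num i)) (All n p)" by (simp add: e2)
  qed
qed

text \<open>If all satisfying assignments have value \<open>x\<close> at variable 0, the result is
  the union of {x}, that is, \<open>x\<close>. Every other code also yields an ordinal definable
  set, so the range is exactly the class OD.\<close>

definition U :: "'a \<Rightarrow> 'a" where
  "U g = Uni (mk {x. x \<in> M \<and> (\<exists>s\<in>ext (H g). x = val s e0)})"

lemma DT_U [dfn]: "DT b t \<Longrightarrow> DT b (\<lambda>s. U (t s))"
  by (rule DT1[where F = U]) (unfold U_def, intro dfn)

lemma U_M [simp]: "U g \<in> M" by (simp add: U_def)

lemma OD_sub_U: "x \<in> OD M E \<Longrightarrow> \<exists>g\<in>Ord. U g = x"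
proof -
  assume "x \<in> OD M E"
  then obtain p s where x: "x \<in> M" and s: "range s \<subseteq> Ord"
    and p: "\<And>y. y \<in> M \<Longrightarrow> sat M E (s(0 := y)) p \<longleftrightarrow> y = x"
    unfolding OD_def by blast
  have sO: "s i \<in> Ord" for i using s by auto
  obtain k where k: "\<And>i. i \<in> vars p \<Longrightarrow> i \<le> k"
    using finite_vars[of p] unfolding finite_nat_set_iff_bounded_le by blast
  \<comment> \<open>An assignment in \<open>M\<close> with value \<open>x\<close> at 0 and the given
    parameters at 1, ..., n, built by external recursion as only finitely many variables
    matter.\<close>
  define sg where "sg = rec_nat (upd e0 e0 x) (\<lambda>i r. upd r (num (Suc i)) (s (Suc i)))"
  have sgM: "sg n \<in> M" for n by (cases n) (auto simp: sg_def)
  have sg: "val (sg n) (num i) = (if i = 0 then x else s i)" if "i \<le> n" for n i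
    using that
  proof (induction n)
    case 0
    then show ?case using val_upd[of e0 e0 x e0] x by (simp add: sg_def)
  next
    case (Suc n)
    have "sg (Suc n) = upd (sg n) (num (Suc n)) (s (Suc n))" by (simp add: sg_def)
    then have "val (sg (Suc n)) (num i) = (if num i = num (Suc n) then s (Suc n) else val (sg n) (num i))"
      using val_upd[OF sgM, of "num (Suc n)" "s (Suc n)" "num i"] sO[of "Suc n"]
      by (simp only: Ord_M num_Ord)
    then show ?case using Suc by (auto simp del: num.simps)
  qed
  obtain v where v: "v \<in> Ord" "sg k \<in> ext (V v)" using V_cover[OF sgM] by blast
  \<comment> \<open>The parameters are moved into the formula: clauses of tag 3 pin the variables 1,
    ..., n to the ordinals \<open>s i\<close>, so that every solution has value \<open>x\<close> at
    variable 0.\<close>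
  have "cod v (\<lambda>z. sat M E (\<lambda>i. val z (num i)) p \<and> (\<forall>i. 1 \<le> i \<and> i \<le> n \<longrightarrow> val z (num i) = s i))" for n
  proof (induction n)
    case 0
    show ?case by (rule cod_cong[OF cod_sat[OF v(1)]]) auto
  next
    case (Suc n)
    show ?case
      by (rule cod_cong[OF cod_conj[OF v(1) Suc cod_par[OF v(1) num_Ord[of "Suc n"] sO[of "Suc n"]]]])
        (auto simp: le_Suc_eq simp del: num.simps)
  qed
  then obtain g where g: "g \<in> Ord" "ext (H g) =
    {z \<in> ext (V v). sat M E (\<lambda>i. val z (num i)) p \<and> (\<forall>i. 1 \<le> i \<and> i \<le> k \<longrightarrow> val z (num i) = s i)}"
    unfolding cod_def by blast
  have *: "sat M E (\<lambda>i. val z (num i)) p \<longleftrightarrow> val z e0 = x"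
    if "\<forall>i. 1 \<le> i \<and> i \<le> k \<longrightarrow> val z (num i) = s i" for z
  proof -
    have "sat M E (\<lambda>i. val z (num i)) p = sat M E (s(0 := val z e0)) p"
      by (rule sat_cong) (use that k in auto)
    then show ?thesis using p[of "val z e0"] by simp
  qed
  have "\<forall>i. 1 \<le> i \<and> i \<le> k \<longrightarrow> val (sg k) (num i) = s i" using sg by auto
  moreover have "val (sg k) e0 = x" using sg[of 0 k] by simp
  ultimately have "sg k \<in> ext (H g)" using g(2) v(2) * by auto
  then have "{y. y \<in> M \<and> (\<exists>z\<in>ext (H g). y = val z e0)} = {x}"
    using \<open>val (sg k) e0 = x\<close> * x unfolding g(2) by auto
  then have "U g = Uni (mk {x})" by (simp add: U_def)
  also have "\<dots> = x"
  proof (rule ext_inj)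
    show "ext (Uni (mk {x})) = ext x" using x by (simp add: ext_mk)
  qed (use x in auto)
  finally show ?thesis using g(1) by blast
qed

lemma OD_eq: "OD M E = U ` Ord"
proof
  show "OD M E \<subseteq> U ` Ord" using OD_sub_U by blast
  show "U ` Ord \<subseteq> OD M E" using OD_iff DT_U[OF DT_Ord_const] by auto
qed

lemma D_OD [dfn]: "DT b t \<Longrightarrow> D b (\<lambda>s. t s \<in> OD M E)"
proof -
  assume "DT b t"
  then have "D b (\<lambda>s. \<exists>g\<in>Ord. t s = U g)" by (intro dfn DT_shift)
  then show ?thesis by (rule D_cong) (auto simp: OD_eq)
qed

text \<open>Comparing least indices is the definable well-order of the ordinal definable sets from
  which all ranks below are taken.\<close>

definition idx :: "'a \<Rightarrow> 'a" where "idx x = lst (\<lambda>g. U g = x)"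

lemma DT_idx [dfn]: "DT b t \<Longrightarrow> DT b (\<lambda>s. idx (t s))"
  by (rule DT1[where F = idx]) (unfold idx_def, intro dfn)

lemma idx_Ord [simp]: "idx x \<in> Ord" by (simp add: idx_def)

lemma U_idx: "x \<in> OD M E \<Longrightarrow> U (idx x) = x"
proof -
  assume x: "x \<in> OD M E"
  obtain g where "g \<in> Ord" "U g = x" using OD_sub_U[OF x] by blast
  then show ?thesis unfolding idx_def
    by (intro lst(1)[where P = "\<lambda>g. U g = x"] dfn DT_M_const) (use x in auto)
qed

abbreviation "N \<equiv> HOD M E"

subsection \<open>Closure and absoluteness of HOD\<close>

lemma subset_in_iff: "subset_in M E x y \<longleftrightarrow> ext x \<subseteq> ext y"
  unfolding subset_in_def ext_def by blast

lemma transitive_in_iff: "transitive_in M E x \<longleftrightarrow> (\<forall>y\<in>ext x. ext y \<subseteq> ext x)"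
  unfolding transitive_in_def subset_in_iff by (auto simp: ext_def)

lemma trcl_iff: "is_trcl M E x t \<longleftrightarrow> (\<forall>y\<in>ext t. ext y \<subseteq> ext t) \<and> ext x \<subseteq> ext t \<and>
  (\<forall>u\<in>M. (\<forall>y\<in>ext u. ext y \<subseteq> ext u) \<and> ext x \<subseteq> ext u \<longrightarrow> ext t \<subseteq> ext u)"
  unfolding is_trcl_def transitive_in_iff subset_in_iff by (rule refl)

lemma ex_trcl:
  assumes "x \<in> M" shows "\<exists>t\<in>M. is_trcl M E x t"
proof -
  obtain w where w: "w \<in> M" "ext x \<subseteq> ext w" "\<forall>y\<in>ext w. ext y \<subseteq> ext w"
    using ex_transitive[OF assms] by blast
  let ?P = "\<lambda>z. \<forall>u\<in>M. (\<forall>y\<in>ext u. ext y \<subseteq> ext u) \<and> ext x \<subseteq> ext u \<longrightarrow> z \<in> ext u"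
  have "isset {z \<in> ext w. ?P z}"
    by (rule sep[OF w(1)]) (intro dfn DT_M_const assms)
  then obtain t where t: "t \<in> M" "ext t = {z \<in> ext w. ?P z}" unfolding isset_def by blast
  have "is_trcl M E x t"
    unfolding trcl_iff
  proof (intro conjI ballI impI)
    show "ext y \<subseteq> ext t" if "y \<in> ext t" for y
      using that w(3) unfolding t(2) by blast
    show "ext x \<subseteq> ext t" using w(2) unfolding t(2) by blast
    show "ext t \<subseteq> ext u" if "u \<in> M" "(\<forall>y\<in>ext u. ext y \<subseteq> ext u) \<and> ext x \<subseteq> ext u" for u
      using that unfolding t(2) by blast
  qed
  then show ?thesis using t(1) by blast
qed

lemma HOD_iff: "x \<in> N \<longleftrightarrow> x \<in> OD M E \<and> (\<exists>t\<in>M. is_trcl M E x t \<and> (\<forall>y\<in>ext t. y \<in> OD M E))"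
  unfolding HOD_def ext_def by auto

lemma D_HOD [dfn]: "DT b t \<Longrightarrow> D b (\<lambda>s. t s \<in> N)"
  by (rule D1[where R = "\<lambda>x. x \<in> N"]) (unfold HOD_iff trcl_iff, intro dfn)

lemma HOD_OD: "x \<in> N \<Longrightarrow> x \<in> OD M E" by (simp add: HOD_iff)

lemma HOD_M [simp, dest]: "x \<in> N \<Longrightarrow> x \<in> M" using HOD_OD by blast

lemma HOD_sub: "N \<subseteq> M" by blast

lemma DT_N: "x \<in> N \<Longrightarrow> DT b (\<lambda>s. x)" by (rule DT_OD_const[OF HOD_OD])

lemma D_bex_N [dfn]:
  "D b (\<lambda>s. P (s 0) (\<lambda>n. s (Suc n))) \<Longrightarrow> D b (\<lambda>s. \<exists>x\<in>N. P x s)"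
  by (rule D_bex_class) (intro dfn, rule HOD_sub)

lemma HOD_trans: "x \<in> N \<Longrightarrow> y \<in> ext x \<Longrightarrow> y \<in> N"
proof -
  assume x: "x \<in> N" and y: "y \<in> ext x"
  obtain t where t: "t \<in> M" "is_trcl M E x t" "\<forall>y\<in>ext t. y \<in> OD M E" using x HOD_iff by blast
  obtain u where u: "u \<in> M" "is_trcl M E y u" using ex_trcl y by blast
  have "y \<in> ext t" "ext y \<subseteq> ext t" using y t(2) unfolding trcl_iff by blast+
  then have "ext u \<subseteq> ext t" using t(1,2) u(2) unfolding trcl_iff by blast
  then show "y \<in> N" unfolding HOD_iff using \<open>y \<in> ext t\<close> t(3) u by blast
qed

lemma HOD_ext: "x \<in> N \<Longrightarrow> ext x \<subseteq> N" using HOD_trans by blast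

text \<open>The elements of the transitive closure that lie in HOD form a transitive set including
  \<open>x\<close>, hence exhaust the closure.\<close>

lemma HODI: "x \<in> M \<Longrightarrow> DT False (\<lambda>s. x) \<Longrightarrow> ext x \<subseteq> N \<Longrightarrow> x \<in> N"
proof -
  assume x: "x \<in> M" "DT False (\<lambda>s. x)" "ext x \<subseteq> N"
  obtain t where t: "t \<in> M" "is_trcl M E x t" using ex_trcl[OF x(1)] by blast
  have "isset {z \<in> ext t. z \<in> N}" by (rule sep[OF t(1)]) (intro dfn)
  then obtain u where u: "u \<in> M" "ext u = {z \<in> ext t. z \<in> N}" unfolding isset_def by blast
  have "\<forall>y\<in>ext u. ext y \<subseteq> ext u" using t(2) HOD_trans unfolding u(2) trcl_iff by blast
  moreover have "ext x \<subseteq> ext u" using t(2) x(3) unfolding u(2) trcl_iff by blast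
  ultimately have "ext t \<subseteq> ext u" using t(2) u(1) unfolding trcl_iff by blast
  then have "\<forall>y\<in>ext t. y \<in> OD M E" using HOD_OD unfolding u(2) by blast
  moreover have "x \<in> OD M E" using x OD_iff by blast
  ultimately show "x \<in> N" unfolding HOD_iff using t by blast
qed

lemma Ord_HOD [simp]: "x \<in> Ord \<Longrightarrow> x \<in> N"
proof -
  assume x: "x \<in> Ord"
  show "x \<in> N"
  proof (rule Ord_induct[where P = "\<lambda>x. x \<in> N", OF _ x])
    fix a assume "a \<in> Ord" "\<forall>b\<in>ext a. b \<in> N"
    then show "a \<in> N" by (intro HODI DT_Ord_const) auto
  qed (intro dfn)
qed

section \<open>Pairs, ordinals and bijections seen from HOD\<close>

lemma up_HOD [simp]: "a \<in> N \<Longrightarrow> b \<in> N \<Longrightarrow> up a b \<in> N"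
proof (rule HODI)
  assume N: "a \<in> N" "b \<in> N"
  show "DT False (\<lambda>s. up a b)" by (intro DT_up DT_N N)
  show "ext (up a b) \<subseteq> N" using N by simp
qed simp

lemma pair_HOD [simp]: "a \<in> N \<Longrightarrow> b \<in> N \<Longrightarrow> pair a b \<in> N"
  by (simp add: pair_def)

lemma ext_N_iff: "x \<in> N \<Longrightarrow> z \<in> ext x \<longleftrightarrow> z \<in> N \<and> E z x"
  using HOD_trans HOD_M unfolding ext_iff by blast

lemma upairN: "a \<in> N \<Longrightarrow> b \<in> N \<Longrightarrow> u \<in> N \<Longrightarrow> is_upair N E a b u \<longleftrightarrow> u = up a b"
proof -
  assume N: "a \<in> N" "b \<in> N" "u \<in> N"
  have "is_upair N E a b u \<longleftrightarrow> (\<forall>z\<in>N. z \<in> ext u \<longleftrightarrow> z = a \<or> z = b)"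
    unfolding is_upair_def using ext_N_iff[OF N(3)] by blast
  also have "\<dots> \<longleftrightarrow> ext u = {a, b}" using HOD_ext[OF N(3)] N by blast
  also have "\<dots> \<longleftrightarrow> u = up a b" using ext_inj[of u "up a b"] N by auto
  finally show ?thesis .
qed

lemma pairN: "a \<in> N \<Longrightarrow> b \<in> N \<Longrightarrow> p \<in> N \<Longrightarrow> is_pair N E a b p \<longleftrightarrow> p = pair a b"
  unfolding is_pair_def pair_def using upairN up_HOD by metis

lemma appN: "f \<in> N \<Longrightarrow> a \<in> N \<Longrightarrow> b \<in> N \<Longrightarrow> is_app N E f a b \<longleftrightarrow> pair a b \<in> ext f"
  unfolding is_app_def using pairN pair_HOD ext_N_iff by metis

lemma subsetN: "x \<in> N \<Longrightarrow> subset_in N E x y \<longleftrightarrow> ext x \<subseteq> ext y"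
  unfolding subset_in_def using ext_N_iff[of x] by (auto simp: ext_iff)

lemma emptyN: "x \<in> N \<Longrightarrow> is_empty N E x \<longleftrightarrow> ext x = {}"
  unfolding is_empty_def using ext_N_iff[of x] by auto

lemma OrdN: "x \<in> Ord \<Longrightarrow> x \<in> Ords N E"
proof -
  assume x: "x \<in> Ord"
  have xN: "x \<in> N" using x by simp
  note [simp] = subsetN emptyN
  have 1: "transitive_in N E x" unfolding transitive_in_def
    using x ext_N_iff[OF xN] unfolding Ord_iff by (auto simp del: HOD_M)
  have 2: "\<not> E a a" if "a \<in> N" for a
    using mem_irrefl[of a] HOD_M[OF that] unfolding ext_iff by blast
  have 3: "\<forall>a\<in>N. \<forall>b\<in>N. \<forall>c\<in>N. E a x \<and> E b x \<and> E c x \<and> E a b \<and> E b c \<longrightarrow> E a c"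
    using x HOD_sub unfolding Ords_def by blast
  have 4: "\<forall>a\<in>N. \<forall>b\<in>N. E a x \<and> E b x \<longrightarrow> E a b \<or> a = b \<or> E b a"
    using x HOD_sub unfolding Ords_def by blast
  have 5: "\<exists>a\<in>N. E a u \<and> (\<forall>b\<in>N. E b u \<longrightarrow> a = b \<or> E a b)"
    if u: "u \<in> N" "subset_in N E u x" "\<not> is_empty N E u" for u
  proof -
    have u': "ext u \<subseteq> ext x" "ext u \<noteq> {}" "u \<in> M" using u by auto
    then obtain a where a: "a \<in> ext u" "ext a \<inter> ext u = {}" using foundation_ax by metis
    have "a = b \<or> a \<in> ext b" if "b \<in> ext u" for b
      using that a u'(1) x unfolding Ord_iff by blast
    then show ?thesis using a(1) ext_N_iff[OF u(1)] by (intro bexI[of _ a]) (auto simp: ext_iff)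
  qed
  have 6: "\<forall>u\<in>N. subset_in N E u x \<and> \<not> is_empty N E u \<longrightarrow>
        (\<exists>a\<in>N. E a u \<and> (\<forall>b\<in>N. E b u \<longrightarrow> a = b \<or> E a b))"
    using 5 by blast
  have 7: "\<forall>a\<in>N. E a x \<longrightarrow> \<not> E a a" using 2 by blast
  show ?thesis unfolding Ords_def by (intro CollectI conjI xN 1 7 3 4 6)
qed

lemma limN: "x \<in> Ord \<Longrightarrow> is_limit N E x \<longleftrightarrow> lim x"
proof -
  assume x: "x \<in> Ord"
  have xN: "x \<in> N" using x by simp
  have 1: "(\<forall>y\<in>N. E y x \<longrightarrow> (\<exists>z\<in>N. E z x \<and> E y z)) \<longleftrightarrow> (\<forall>y\<in>ext x. \<exists>z\<in>ext x. y \<in> ext z)"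
  proof -
    have e: "E y x \<longleftrightarrow> y \<in> ext x" if "y \<in> N" for y using ext_N_iff[OF xN] that by blast
    have e': "E y z \<longleftrightarrow> y \<in> ext z" if "y \<in> N" for y z using that by (simp add: ext_iff)
    have "(\<forall>y\<in>N. E y x \<longrightarrow> (\<exists>z\<in>N. E z x \<and> E y z)) \<longleftrightarrow>
      (\<forall>y\<in>N. y \<in> ext x \<longrightarrow> (\<exists>z\<in>N. z \<in> ext x \<and> y \<in> ext z))"
      by (intro ball_cong bex_cong refl imp_cong conj_cong) (simp_all add: e e')
    then show ?thesis using HOD_ext[OF xN] by blast
  qed
  have 2: "ext x \<noteq> {} \<longleftrightarrow> e0 \<in> ext x" using e0_least[OF x] by auto
  have 3: "(\<exists>z\<in>ext x. y \<in> ext z) \<longleftrightarrow> sc y \<in> ext x" if y: "y \<in> ext x" for y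
  proof
    assume "sc y \<in> ext x"
    then show "\<exists>z\<in>ext x. y \<in> ext z" using ext_sc[of y] y by (intro bexI[of _ "sc y"]) auto
  next
    assume "\<exists>z\<in>ext x. y \<in> ext z"
    then obtain z where z: "z \<in> ext x" "y \<in> ext z" by blast
    then have "sc y \<in> ext z \<or> sc y = z" using sc_mono Ord_elt[OF x] by blast
    then show "sc y \<in> ext x" using z Ord_trans[OF x] by blast
  qed
  show ?thesis unfolding is_limit_def lim_def emptyN[OF xN] 1 using 2 3 x OrdN[OF x] by auto
qed

lemma omegaN: "is_omega N E om"
proof -
  have "\<not> is_limit N E x" if "x \<in> N" "E x om" for x
  proof -
    have x: "x \<in> ext om" using that ext_N_iff[OF Ord_HOD[OF om_Ord]] by blast
    then show ?thesis using limN[OF Ord_elt[OF om_Ord x]] om(2)[OF x] by blast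
  qed
  moreover have "is_limit N E om" using limN[OF om_Ord] om(1) by blast
  ultimately show ?thesis unfolding is_omega_def by blast
qed

text \<open>Translates bijections inside HOD to \<open>bij_betw\<close> on extensions, where
  composition and inversion come from the library.\<close>

lemma bijN:
  assumes N: "f \<in> N" "A \<in> N" "B \<in> N"
  shows "is_bij N E f A B \<longleftrightarrow>
    (\<exists>g. bij_betw g (ext A) (ext B) \<and> ext f = {pair a (g a) | a. a \<in> ext A})" (is "_ \<longleftrightarrow> ?R")
proof
  assume b: "is_bij N E f A B"
  have 1: "\<exists>a\<in>ext A. \<exists>b\<in>ext B. p = pair a b" if "p \<in> ext f" for p
    using b that N ext_N_iff pairN unfolding is_bij_def is_fun_def by metis
  have 2: "\<exists>!b. b \<in> N \<and> pair a b \<in> ext f" if "a \<in> ext A" for a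
    using b that N ext_N_iff appN unfolding is_bij_def is_fun_def by metis
  have 3: "\<exists>!a. a \<in> N \<and> pair a b \<in> ext f" if "b \<in> ext B" for b
    using b that N ext_N_iff appN unfolding is_bij_def is_fun_def by metis
  define g where "g a = (THE b. b \<in> N \<and> pair a b \<in> ext f)" for a
  have g: "g a \<in> N" "pair a (g a) \<in> ext f" if "a \<in> ext A" for a
    using theI'[OF 2[OF that]] unfolding g_def by auto
  have gu: "b = g a" if "a \<in> ext A" "b \<in> N" "pair a b \<in> ext f" for a b
    using 2[OF that(1)] g[OF that(1)] that by blast
  have gB: "g a \<in> ext B" if a: "a \<in> ext A" for a
  proof -
    obtain x y where "x \<in> ext A" "y \<in> ext B" "pair a (g a) = pair x y" using 1[OF g(2)[OF a]] by blast
    moreover then have "g a = y" using ext_M a g(1)[OF a] by (metis HOD_M pair_inj)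
    ultimately show ?thesis by simp
  qed
  have "bij_betw g (ext A) (ext B)"
    unfolding bij_betw_def
  proof
    show "inj_on g (ext A)"
    proof (rule inj_onI)
      fix x y assume xy: "x \<in> ext A" "y \<in> ext A" "g x = g y"
      have "x \<in> N" "y \<in> N" using HOD_trans N(2) xy by blast+
      then show "x = y" using 3[OF gB[OF xy(1)]] g(2)[OF xy(1)] g(2)[OF xy(2)] xy(3) by metis
    qed
    have "\<exists>a\<in>ext A. b = g a" if b: "b \<in> ext B" for b
    proof -
      obtain a where a: "a \<in> N" "pair a b \<in> ext f" using 3[OF b] by blast
      obtain x y where xy: "x \<in> ext A" "y \<in> ext B" "pair a b = pair x y" using 1[OF a(2)] by blast
      then have "a = x" using ext_M a(1) b by (metis HOD_M pair_inj)
      then show ?thesis using gu[of a b] xy(1) a b HOD_trans[OF N(3)] by blast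
    qed
    then show "g ` ext A = ext B" using gB by blast
  qed
  moreover have "ext f = {pair a (g a) | a. a \<in> ext A}"
  proof
    show "{pair a (g a) | a. a \<in> ext A} \<subseteq> ext f" using g(2) by blast
    show "ext f \<subseteq> {pair a (g a) | a. a \<in> ext A}"
    proof
      fix p assume p: "p \<in> ext f"
      then obtain a b where ab: "a \<in> ext A" "b \<in> ext B" "p = pair a b" using 1 by blast
      then have "b = g a" using gu p HOD_trans[OF N(3)] by blast
      then show "p \<in> {pair a (g a) | a. a \<in> ext A}" using ab by blast
    qed
  qed
  ultimately show ?R by blast
next
  assume ?R
  then obtain g where g: "bij_betw g (ext A) (ext B)" "ext f = {pair a (g a) | a. a \<in> ext A}" by blast
  have gB: "g a \<in> ext B" if "a \<in> ext A" for a using g(1) that by (auto simp: bij_betw_def)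
  have AN: "a \<in> N" if "a \<in> ext A" for a using HOD_trans[OF N(2) that] .
  have BN: "a \<in> N" if "a \<in> ext B" for a using HOD_trans[OF N(3) that] .
  have p: "pair a b \<in> ext f \<longleftrightarrow> a \<in> ext A \<and> b = g a" if "a \<in> N" "b \<in> N" for a b
  proof
    assume "pair a b \<in> ext f"
    then obtain x where "x \<in> ext A" "pair a b = pair x (g x)" using g(2) by blast
    moreover then have "a = x \<and> b = g x" using that AN BN gB HOD_M by simp
    ultimately show "a \<in> ext A \<and> b = g a" by simp
  qed (use g(2) in blast)
  have 1: "\<forall>p\<in>N. E p f \<longrightarrow> (\<exists>a\<in>N. \<exists>b\<in>N. E a A \<and> E b B \<and> is_pair N E a b p)"
  proof (intro ballI impI)
    fix p assume "p \<in> N" "E p f"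
    then obtain a where a: "a \<in> ext A" "p = pair a (g a)" using g(2) ext_N_iff[OF N(1)] by blast
    then have n: "a \<in> N" "g a \<in> N" "g a \<in> ext B" using gB AN BN by blast+
    have "is_pair N E a (g a) p" using pairN[OF n(1,2) \<open>p \<in> N\<close>] a(2) by blast
    moreover have "E a A" "E (g a) B" using a(1) n(3) unfolding ext_iff by blast+
    ultimately show "\<exists>a\<in>N. \<exists>b\<in>N. E a A \<and> E b B \<and> is_pair N E a b p" using n(1,2) by blast
  qed
  have 2: "\<forall>a\<in>N. E a A \<longrightarrow> (\<exists>!b. b \<in> N \<and> is_app N E f a b)"
  proof (intro ballI impI)
    fix a assume a: "a \<in> N" "E a A"
    then have aA: "a \<in> ext A" by (simp add: ext_iff)
    show "\<exists>!b. b \<in> N \<and> is_app N E f a b"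
      by (rule ex1I[of _ "g a"]) (use appN[OF N(1) a(1)] p[OF a(1)] BN[OF gB[OF aA]] aA in blast)+
  qed
  have 3: "\<forall>b\<in>N. E b B \<longrightarrow> (\<exists>!a. a \<in> N \<and> is_app N E f a b)"
  proof (intro ballI impI)
    fix b assume b: "b \<in> N" "E b B"
    then have "b \<in> ext B" by (simp add: ext_iff)
    then obtain a where a: "a \<in> ext A" "b = g a" using g(1) unfolding bij_betw_def by blast
    show "\<exists>!a. a \<in> N \<and> is_app N E f a b"
    proof (rule ex1I[of _ a])
      show "a \<in> N \<and> is_app N E f a b" using a AN appN[OF N(1) _ b(1)] p[OF _ b(1)] by blast
      fix x assume "x \<in> N \<and> is_app N E f x b"
      then have "x \<in> ext A" "g x = g a" using a appN[OF N(1) _ b(1)] p[OF _ b(1)] by auto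
      then show "x = a" using g(1) a unfolding bij_betw_def inj_on_def by blast
    qed
  qed
  show "is_bij N E f A B" unfolding is_bij_def is_fun_def using 1 2 3 by blast
qed

lemma lam_HOD:
  assumes "A \<in> N" "DT False (\<lambda>s. F (s 0))" "\<And>a. a \<in> ext A \<Longrightarrow> F a \<in> N"
  shows "lam A F \<in> N"
proof (rule HODI)
  show "DT False (\<lambda>s. lam A F)" unfolding lam_def by (intro dfn DT_N assms)
  have "DT True (\<lambda>s. F (s 0))" by (rule DT_mono) fact
  then show "ext (lam A F) \<subseteq> N" using ext_lam[of A F] assms HOD_trans[OF assms(1)] by auto
qed simp

text \<open>An external bijection is not enough: its definability with \<open>b = False\<close> is
  what places the graph in HOD.\<close>

lemma equipotentI:
  assumes "A \<in> N" "B \<in> N" "DT False (\<lambda>s. F (s 0))" "bij_betw F (ext A) (ext B)"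
  shows "equipotent N E A B"
proof -
  have B: "F a \<in> N" if "a \<in> ext A" for a
    using that assms(4) HOD_trans[OF assms(2)] unfolding bij_betw_def by blast
  have l: "lam A F \<in> N" by (rule lam_HOD[OF assms(1,3) B])
  have "DT True (\<lambda>s. F (s 0))" by (rule DT_mono) fact
  then have "ext (lam A F) = {pair a (F a) | a. a \<in> ext A}" using ext_lam[of A F] assms(1) by auto
  then show ?thesis unfolding equipotent_def
    using bijN[OF l assms(1,2)] assms(4) l by blast
qed

subsection \<open>Order types of sets of ordinals\<close>

text \<open>Only the smaller argument has to lie in \<open>S\<close>, so \<open>col S x\<close> is
  the order type of S \<inter> x for every ordinal \<open>x\<close>, whether in \<open>S\<close> or
  not.\<close>

definition Rcol :: "'a \<Rightarrow> 'a \<Rightarrow> 'a \<Rightarrow> bool" where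
  "Rcol S y x \<longleftrightarrow> x \<in> Ord \<and> y \<in> ext x \<and> y \<in> ext S"

definition col :: "'a \<Rightarrow> 'a \<Rightarrow> 'a" where "col S x = clp Rcol S x"

lemma D_Rcol: "D b (\<lambda>s. Rcol (s 0) (s 1) (s 2))"
  unfolding Rcol_def by (intro dfn)

lemma wfr_Rcol: assumes "S \<in> M" shows "wfr Rcol S"
proof -
  have "isset {y. y \<in> M \<and> Rcol S y x}" if "x \<in> M" for x
  proof (cases "x \<in> Ord")
    case True
    then have *: "{y. y \<in> M \<and> Rcol S y x} = {y \<in> ext x. y \<in> ext S}" by (auto simp: Rcol_def)
    show ?thesis unfolding * by (rule sep[OF that]) (intro dfn DT_M_const assms)
  qed (simp add: Rcol_def)
  moreover have "\<exists>m\<in>ext a. \<forall>y\<in>ext a. \<not> Rcol S y m" if "a \<in> M" "ext a \<noteq> {}" for a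
    using foundation_ax[OF that] unfolding Rcol_def by blast
  ultimately show ?thesis unfolding wfr_def Rcol_def using Ord_trans by blast
qed

lemma DT_col [dfn]: "DT b t \<Longrightarrow> DT b u \<Longrightarrow> DT b (\<lambda>s. col (t s) (u s))"
  unfolding col_def by (rule DT_clp[OF D_Rcol])

lemma ext_col: "S \<in> M \<Longrightarrow> x \<in> Ord \<Longrightarrow> ext (col S x) = {col S y | y. y \<in> ext x \<and> y \<in> ext S}"
proof -
  assume S: "S \<in> M" "x \<in> Ord"
  have "Rcol S y x \<longleftrightarrow> y \<in> ext x \<and> y \<in> ext S" for y using S(2) by (simp add: Rcol_def)
  then show ?thesis using ext_clp[OF wfr_Rcol[OF S(1)] S(1) D_Rcol Ord_M[OF S(2)]]
    unfolding col_def by auto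
qed

lemma col_Ord: "S \<in> M \<Longrightarrow> x \<in> Ord \<Longrightarrow> col S x \<in> Ord"
  unfolding col_def by (rule clp_Ord[OF wfr_Rcol _ D_Rcol]) auto

lemma col_less: "S \<in> M \<Longrightarrow> x \<in> Ord \<Longrightarrow> y \<in> ext x \<Longrightarrow> y \<in> ext S \<Longrightarrow> col S y \<in> ext (col S x)"
  using ext_col by blast

lemma col_inj: "S \<in> M \<Longrightarrow> ext S \<subseteq> Ord \<Longrightarrow> inj_on (col S) (ext S)"
proof (rule inj_onI)
  fix x y assume S: "S \<in> M" "ext S \<subseteq> Ord" "x \<in> ext S" "y \<in> ext S" "col S x = col S y"
  then have O: "x \<in> Ord" "y \<in> Ord" by auto
  have "x \<notin> ext y" using col_less[OF S(1) O(2) _ S(3)] S(5) by auto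
  moreover have "y \<notin> ext x" using col_less[OF S(1) O(1) _ S(4)] S(5) by auto
  ultimately show "x = y" using Ord_linear[OF O] by blast
qed

text \<open>If col T a = col S y with y in S below a, then col T y < col T a = col S y, so
  \<open>y\<close> is a smaller counterexample.\<close>

lemma col_mono:
  assumes "S \<in> M" "T \<in> M" "ext S \<subseteq> ext T" "x \<in> Ord"
  shows "col T x \<notin> ext (col S x)"
proof (rule Ord_induct[where P = "\<lambda>x. col T x \<notin> ext (col S x)", OF _ assms(4)])
  show "D True (\<lambda>s. col T (s 0) \<notin> ext (col S (s 0)))" by (intro dfn DT_M_const assms)
  fix a assume a: "a \<in> Ord" and IH: "\<forall>b\<in>ext a. col T b \<notin> ext (col S b)"
  show "col T a \<notin> ext (col S a)"
  proof
    assume "col T a \<in> ext (col S a)"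
    then obtain y where y: "y \<in> ext a" "y \<in> ext S" "col T a = col S y"
      using ext_col[OF assms(1) a] by auto
    then have "col T y \<in> ext (col T a)" using col_less[OF assms(2) a] assms(3) by blast
    then show False using IH y by auto
  qed
qed

definition otp :: "'a \<Rightarrow> 'a" where
  "otp S = mk {z. z \<in> M \<and> (\<exists>y\<in>ext S. z = col S y)}"

lemma DT_otp [dfn]: "DT b t \<Longrightarrow> DT b (\<lambda>s. otp (t s))"
  by (rule DT1[where F = otp]) (unfold otp_def, intro dfn)

lemma otp_eq:
  assumes "S \<in> M" "ext S \<subseteq> ext x" "x \<in> Ord" shows "otp S = col S x"
proof -
  have "col S y \<in> M" if "y \<in> ext S" for y
    using col_Ord[OF assms(1)] Ord_elt[OF assms(3)] assms(2) that by blast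
  then have "{z. z \<in> M \<and> (\<exists>y\<in>ext S. z = col S y)} = ext (col S x)"
    using ext_col[OF assms(1,3)] assms(2) by blast
  then show ?thesis unfolding otp_def using col_Ord[OF assms(1,3)] by simp
qed

lemma ext_otp:
  assumes "S \<in> M" "ext S \<subseteq> Ord" shows "ext (otp S) = col S ` ext S" "otp S \<in> Ord"
proof -
  obtain x where x: "x \<in> Ord" "ext S \<subseteq> ext x" using Ord_bound assms by blast
  note e = otp_eq[OF assms(1) x(2,1)]
  show "otp S \<in> Ord" unfolding e by (rule col_Ord[OF assms(1) x(1)])
  show "ext (otp S) = col S ` ext S" unfolding e ext_col[OF assms(1) x(1)] using x(2) by auto
qed

lemma otp_mono:
  assumes "S \<in> M" "T \<in> M" "ext S \<subseteq> ext T" "ext T \<subseteq> Ord"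
  shows "otp S = otp T \<or> otp S \<in> ext (otp T)"
proof -
  obtain x where x: "x \<in> Ord" "ext T \<subseteq> ext x" using Ord_bound assms by blast
  have "otp S = col S x" "otp T = col T x" using otp_eq assms x by auto
  then show ?thesis
    using col_mono[OF assms(1-3) x(1)] Ord_linear[OF col_Ord[OF assms(1) x(1)] col_Ord[OF assms(2) x(1)]]
    by auto
qed

section \<open>Power sets in HOD and their canonical order type\<close>

definition hpow :: "'a \<Rightarrow> 'a" where "hpow l = mk {z. z \<in> M \<and> z \<in> N \<and> ext z \<subseteq> ext l}"

lemma DT_hpow [dfn]: "DT b t \<Longrightarrow> DT b (\<lambda>s. hpow (t s))"
  by (rule DT1[where F = hpow]) (unfold hpow_def, intro dfn)

lemma hpow_M [simp]: "hpow l \<in> M" by (simp add: hpow_def)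

lemma ext_hpow:
  assumes l: "l \<in> M" shows "ext (hpow l) = {z. z \<in> N \<and> ext z \<subseteq> ext l}"
proof -
  have D: "D True (\<lambda>s. s 0 \<in> N)" by (intro dfn)
  have *: "{z. z \<in> M \<and> z \<in> N \<and> ext z \<subseteq> ext l} = {z \<in> ext (Pw l). z \<in> N}" using l by auto
  have "ext (hpow l) = {z \<in> ext (Pw l). z \<in> N}"
    unfolding hpow_def * by (rule ext_mk[OF sep[OF Pw_M D]])
  then show ?thesis using l by auto
qed

lemma hpow_HOD: "l \<in> Ord \<Longrightarrow> hpow l \<in> N"
  by (rule HODI) (auto simp: ext_hpow intro: DT_hpow[OF DT_Ord_const])

lemma powerN: "l \<in> Ord \<Longrightarrow> is_power N E l (hpow l)"
  unfolding is_power_def using ext_hpow[of l] ext_N_iff[OF hpow_HOD] subsetN by auto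

definition hpow_idx :: "'a \<Rightarrow> 'a" where "hpow_idx l = mk {y. y \<in> M \<and> (\<exists>z\<in>ext (hpow l). y = idx z)}"

lemma DT_hpow_idx [dfn]: "DT b t \<Longrightarrow> DT b (\<lambda>s. hpow_idx (t s))"
  by (rule DT1[where F = hpow_idx]) (unfold hpow_idx_def, intro dfn)

lemma hpow_idx_M [simp]: "hpow_idx l \<in> M" by (simp add: hpow_idx_def)

lemma ext_hpow_idx: "ext (hpow_idx l) = idx ` ext (hpow l)"
  unfolding hpow_idx_def by (rule ext_mk_image) (auto intro: dfn)

lemma hpow_idx_Ord: "ext (hpow_idx l) \<subseteq> Ord" unfolding ext_hpow_idx by auto

text \<open>Stands in for the cardinal 2^l of HOD: an ordinal equipotent there with the power set,
  obtained from the order of least indices.\<close>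

definition pow_otp :: "'a \<Rightarrow> 'a" where "pow_otp l = otp (hpow_idx l)"

definition pow_rank :: "'a \<Rightarrow> 'a \<Rightarrow> 'a" where "pow_rank l z = col (hpow_idx l) (idx z)"

lemma DT_pow_otp [dfn]: "DT b t \<Longrightarrow> DT b (\<lambda>s. pow_otp (t s))"
  unfolding pow_otp_def by (intro dfn)

lemma DT_pow_rank [dfn]: "DT b t \<Longrightarrow> DT b u \<Longrightarrow> DT b (\<lambda>s. pow_rank (t s) (u s))"
  unfolding pow_rank_def by (intro dfn)

lemma pow_otp_Ord [simp]: "pow_otp l \<in> Ord"
  unfolding pow_otp_def by (rule ext_otp(2)[OF hpow_idx_M hpow_idx_Ord])

lemma pow_rank_bij: "l \<in> M \<Longrightarrow> bij_betw (pow_rank l) (ext (hpow l)) (ext (pow_otp l))"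
proof -
  assume l: "l \<in> M"
  have "inj_on idx (ext (hpow l))"
    by (rule inj_on_inverseI[of _ U]) (use U_idx HOD_OD ext_hpow[OF l] in auto)
  then have 1: "bij_betw idx (ext (hpow l)) (ext (hpow_idx l))"
    unfolding bij_betw_def ext_hpow_idx by simp
  have 2: "bij_betw (col (hpow_idx l)) (ext (hpow_idx l)) (ext (pow_otp l))"
    unfolding bij_betw_def pow_otp_def ext_otp(1)[OF hpow_idx_M hpow_idx_Ord] using col_inj[OF hpow_idx_M hpow_idx_Ord] by simp
  have "pow_rank l = col (hpow_idx l) \<circ> idx" by (rule HOL.ext) (simp add: pow_rank_def)
  then show ?thesis using bij_betw_trans[OF 1 2] by simp
qed

lemma pow_otp_equipotent: "l \<in> Ord \<Longrightarrow> equipotent N E (hpow l) (pow_otp l)"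
  by (rule equipotentI[OF hpow_HOD _ _ pow_rank_bij]) (auto intro!: dfn DT_Ord_const)

text \<open>Carries bounds from limit ordinals, where the codes supply them, to arbitrary smaller
  ordinals.\<close>

lemma pow_otp_mono:
  assumes "l \<in> Ord" "m \<in> Ord" "ext l \<subseteq> ext m"
  shows "pow_otp l = pow_otp m \<or> pow_otp l \<in> ext (pow_otp m)"
  unfolding pow_otp_def
proof (rule otp_mono[OF hpow_idx_M hpow_idx_M _ hpow_idx_Ord])
  show "ext (hpow_idx l) \<subseteq> ext (hpow_idx m)" unfolding ext_hpow_idx using ext_hpow assms by auto
qed

subsection \<open>Codes for the failure of inaccessibility\<close>

definition functional :: "'a \<Rightarrow> bool" where
  "functional f \<longleftrightarrow> (\<forall>x\<in>M. \<forall>y\<in>M. \<forall>y'\<in>M. pair x y \<in> ext f \<longrightarrow> pair x y' \<in> ext f \<longrightarrow> y = y')"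

text \<open>\<open>f\<close> is a relation that may be undefined at points of \<open>a\<close> and
  may have further pairs; thus a cofinal map can be cut down in domain and target without changing
  \<open>f\<close>.\<close>

definition unb :: "'a \<Rightarrow> 'a \<Rightarrow> 'a \<Rightarrow> bool" where
  "unb f a k \<longleftrightarrow> (\<forall>y\<in>ext k. \<exists>x\<in>ext a. \<exists>y'\<in>ext k. (y = y' \<or> y \<in> ext y') \<and> pair x y' \<in> ext f)"

definition incr :: "'a \<Rightarrow> 'a \<Rightarrow> 'a \<Rightarrow> bool" where
  "incr f a k \<longleftrightarrow> (\<forall>x\<in>ext a. \<forall>x'\<in>ext x. \<forall>y\<in>ext k. \<forall>y'\<in>ext k.
     pair x y \<in> ext f \<longrightarrow> pair x' y' \<in> ext f \<longrightarrow> y' \<in> ext y)"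

definition sing :: "'a \<Rightarrow> 'a \<Rightarrow> bool" where
  "sing a k \<longleftrightarrow> a \<in> ext k \<and> (\<exists>f\<in>N. functional f \<and> unb f a k)"

lemma D_functional [dfn]: "DT b t \<Longrightarrow> D b (\<lambda>s. functional (t s))"
  by (rule D1[where R = functional]) (unfold functional_def, intro dfn)

lemma D_unb [dfn]: "DT b t \<Longrightarrow> DT b u \<Longrightarrow> DT b v \<Longrightarrow> D b (\<lambda>s. unb (t s) (u s) (v s))"
  by (rule D3[where R = unb]) (unfold unb_def, intro dfn)

lemma D_incr [dfn]: "DT b t \<Longrightarrow> DT b u \<Longrightarrow> DT b v \<Longrightarrow> D b (\<lambda>s. incr (t s) (u s) (v s))"
  by (rule D3[where R = incr]) (unfold incr_def, intro dfn)

lemma D_sing [dfn]: "DT b t \<Longrightarrow> DT b u \<Longrightarrow> D b (\<lambda>s. sing (t s) (u s))"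
  by (rule D2[where R = sing]) (unfold sing_def, intro dfn)

text \<open>
  Which of \<open>0\<close> and \<open>1\<close> belong to a code tells the three kinds apart. The shifts by two keep
  these markers free, and in \<open>pow_code\<close> they also make \<open>l\<close> the only limit ordinal in the code.
\<close>

definition succ_code :: "'a \<Rightarrow> 'a \<Rightarrow> bool" where
  "succ_code k A \<longleftrightarrow> (\<exists>g\<in>ext k. k = sc g \<and> (\<forall>z\<in>M. z \<in> ext A \<longleftrightarrow> z = g))"

text \<open>The least \<open>a\<close> with \<open>sing a k\<close> is the cofinality of
  \<open>k\<close> in HOD. Only values above \<open>sc (sc a)\<close> are recorded, which makes
  \<open>sc (sc a)\<close> the least nonzero element of the code, so that \<open>a\<close> can be
  recovered.\<close>

definition cof_code :: "'a \<Rightarrow> 'a \<Rightarrow> bool" where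
  "cof_code k A \<longleftrightarrow> lim k \<and> (\<exists>a\<in>ext k. (\<forall>a'\<in>ext a. \<not> sing a' k) \<and>
     (\<exists>f\<in>N. functional f \<and> unb f a k \<and> incr f a k \<and>
       (\<forall>z\<in>M. z \<in> ext A \<longleftrightarrow> z = e0 \<or> z = sc (sc a) \<or>
          (z \<in> ext k \<and> sc (sc a) \<in> ext z \<and> (\<exists>x\<in>ext a. pair x z \<in> ext f)))))"

definition pow_code :: "'a \<Rightarrow> 'a \<Rightarrow> bool" where
  "pow_code k A \<longleftrightarrow> lim k \<and> (\<exists>l\<in>ext k. lim l \<and>
     (\<exists>x\<in>ext (hpow l). (pow_rank l x = k \<or> (k = pow_otp l \<and> pow_rank l x = e0)) \<and>
       (\<forall>z\<in>M. z \<in> ext A \<longleftrightarrow> z = sc e0 \<or> z = l \<or> (\<exists>i\<in>ext x. z = sc (sc i)))))"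

lemma D_succ_code [dfn]: "DT b t \<Longrightarrow> DT b u \<Longrightarrow> D b (\<lambda>s. succ_code (t s) (u s))"
  by (rule D2[where R = succ_code]) (unfold succ_code_def, intro dfn)

lemma D_cof_code [dfn]: "DT b t \<Longrightarrow> DT b u \<Longrightarrow> D b (\<lambda>s. cof_code (t s) (u s))"
  by (rule D2[where R = cof_code]) (unfold cof_code_def, intro dfn)

lemma D_pow_code [dfn]: "DT b t \<Longrightarrow> DT b u \<Longrightarrow> D b (\<lambda>s. pow_code (t s) (u s))"
  by (rule D2[where R = pow_code]) (unfold pow_code_def, intro dfn)

lemma ex_cof_code:
  assumes k: "lim k" and s: "sing a0 k"
  shows "\<exists>A\<in>M. ext A \<subseteq> ext k \<and> cof_code k A"
proof -
  have kO: "k \<in> Ord" using k by (simp add: lim_def)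
  have a0: "a0 \<in> Ord" using s kO Ord_elt unfolding sing_def by blast
  have "D True (\<lambda>s. sing (s 0) k)" by (intro dfn DT_Ord_const kO)
  from Ord_least[where P = "\<lambda>a. sing a k", OF this a0 s]
  obtain a where a: "a \<in> Ord" "sing a k" "\<forall>a'\<in>ext a. \<not> sing a' k" by blast
  then obtain f where f: "f \<in> N" "functional f" "unb f a k" unfolding sing_def by blast
  have ak: "a \<in> ext k" using a(2) by (simp add: sing_def)
  \<comment> \<open>Thins \<open>f\<close> to its record values, those above all earlier values; the
    result is increasing.\<close>
  let ?P = "\<lambda>z. \<exists>x\<in>ext a. \<exists>y\<in>ext k. z = pair x y \<and>
    (\<forall>x'\<in>ext x. \<forall>y'\<in>ext k. pair x' y' \<in> ext f \<longrightarrow> y' \<in> ext y)"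
  define g where "g = mk {z. z \<in> M \<and> (z \<in> ext f \<and> ?P z)}"
  have eg: "ext g = {z \<in> ext f. ?P z}"
    unfolding g_def by (rule ext_mk_sep[OF HOD_M[OF f(1)]])
      (intro dfn DT_N[OF f(1)] DT_Ord_const[OF kO] DT_Ord_const[OF a(1)])
  have gN: "g \<in> N"
  proof (rule HODI)
    show "DT False (\<lambda>s. g)" unfolding g_def
      by (intro dfn DT_N[OF f(1)] DT_Ord_const[OF kO] DT_Ord_const[OF a(1)])
    show "ext g \<subseteq> N" unfolding eg using HOD_trans[OF f(1)] by blast
  qed (simp add: g_def)
  have pg: "pair x y \<in> ext g \<longleftrightarrow> pair x y \<in> ext f \<and> x \<in> ext a \<and> y \<in> ext k \<and>
    (\<forall>x'\<in>ext x. \<forall>y'\<in>ext k. pair x' y' \<in> ext f \<longrightarrow> y' \<in> ext y)" if xy: "x \<in> M" "y \<in> M" for x y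
  proof -
    have "pair x y = pair u v \<longleftrightarrow> x = u \<and> y = v" if "u \<in> ext a" "v \<in> ext k" for u v
      using pair_inj[OF xy ext_M[OF that(1)] ext_M[OF that(2)]] .
    then show ?thesis unfolding eg by blast
  qed
  have g1: "functional g" using f(2) unfolding functional_def using pg by blast
  have g2: "incr g a k" unfolding incr_def
  proof (intro ballI impI)
    fix x x' y y' assume *: "x \<in> ext a" "x' \<in> ext x" "y \<in> ext k" "y' \<in> ext k" "pair x y \<in> ext g" "pair x' y' \<in> ext g"
    have M: "x \<in> M" "x' \<in> M" "y \<in> M" "y' \<in> M" using * by blast+
    show "y' \<in> ext y" using * pg[OF M(1,3)] pg[OF M(2,4)] by blast
  qed
  have g3: "unb g a k" unfolding unb_def
  proof
    fix y assume y: "y \<in> ext k"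
    \<comment> \<open>The least argument at which \<open>f\<close> reaches \<open>y\<close> is a
      record, since all earlier values are below \<open>y\<close>; so thinning keeps
      \<open>f\<close> unbounded.\<close>
    let ?Q = "\<lambda>x. x \<in> ext a \<and> (\<exists>y'\<in>ext k. (y = y' \<or> y \<in> ext y') \<and> pair x y' \<in> ext f)"
    obtain x0 where x0: "?Q x0" using f(3) y unfolding unb_def by blast
    have D: "D True (\<lambda>s. ?Q (s 0))"
      by (intro dfn DT_N[OF f(1)] DT_Ord_const[OF kO] DT_Ord_const[OF a(1)] DT_M_const ext_M[OF y])
    have "x0 \<in> Ord" using x0 a(1) Ord_elt by blast
    from Ord_least[where P = ?Q, OF D this x0]
    obtain x where x: "x \<in> Ord" "?Q x" "\<forall>x'\<in>ext x. \<not> ?Q x'" by blast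
    then obtain y' where y': "y' \<in> ext k" "y = y' \<or> y \<in> ext y'" "pair x y' \<in> ext f" by blast
    have "v \<in> ext y'" if uv: "u \<in> ext x" "v \<in> ext k" "pair u v \<in> ext f" for u v
    proof -
      have "u \<in> ext a" using Ord_trans[OF a(1)] x(2) uv(1) by blast
      then have "\<not> (y = v \<or> y \<in> ext v)" using x(3) uv by blast
      then have "v \<in> ext y" using Ord_linear[of v y] Ord_elt[OF kO] uv(2) y by blast
      then show ?thesis using y'(2) Ord_trans[OF Ord_elt[OF kO y'(1)]] by blast
    qed
    then have "pair x y' \<in> ext g" using pg[of x y'] y' x ext_M by blast
    then show "\<exists>x\<in>ext a. \<exists>y'\<in>ext k. (y = y' \<or> y \<in> ext y') \<and> pair x y' \<in> ext g"
      using x(2) y' by blast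
  qed
  let ?C = "{z \<in> ext k. sc (sc a) \<in> ext z \<and> (\<exists>x\<in>ext a. pair x z \<in> ext g)}"
  have "isset ?C"
    by (rule sep[OF Ord_M[OF kO]]) (intro dfn DT_N[OF gN] DT_Ord_const[OF a(1)])
  then have "isset (insert e0 (insert (sc (sc a)) ?C))" by simp
  then obtain A where A: "A \<in> M" "ext A = insert e0 (insert (sc (sc a)) ?C)" unfolding isset_def by blast
  have sk: "sc (sc a) \<in> ext k" "e0 \<in> ext k" using ak k unfolding lim_def by auto
  have "cof_code k A" unfolding cof_code_def
    using k ak a(3) gN g1 g2 g3 A(2) by (intro conjI bexI[of _ a] bexI[of _ g]) auto
  moreover have "ext A \<subseteq> ext k" using A(2) sk by auto
  ultimately show ?thesis using A(1) by blast
qed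

lemma ex_pow_code:
  assumes k: "lim k" and l: "l \<in> ext k" "lim l" "pow_otp l \<notin> ext k"
  shows "\<exists>A\<in>M. ext A \<subseteq> ext k \<and> pow_code k A"
proof -
  have kO: "k \<in> Ord" using k by (simp add: lim_def)
  have lM: "l \<in> M" and lO: "l \<in> Ord" using l(2) unfolding lim_def by auto
  have surj: "\<exists>x\<in>ext (hpow l). pow_rank l x = y" if "y \<in> ext (pow_otp l)" for y
    using bij_betw_imp_surj_on[OF pow_rank_bij[OF lM]] that by (metis imageE)
  have "\<exists>x\<in>ext (hpow l). pow_rank l x = k \<or> (k = pow_otp l \<and> pow_rank l x = e0)"
  \<comment> \<open>Ranks run through the ordinals below \<open>pow_otp l\<close>, so at equality no
    subset has rank \<open>k\<close> and the one of rank 0 is used instead.\<close>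
  proof (cases "k = pow_otp l")
    case True
    then have "e0 \<in> ext (pow_otp l)" using k unfolding lim_def by blast
    then show ?thesis using surj True by blast
  next
    case False
    then have "k \<in> ext (pow_otp l)" using Ord_linear[OF kO pow_otp_Ord] l(3) by blast
    then show ?thesis using surj by blast
  qed
  then obtain x where x: "x \<in> ext (hpow l)" "pow_rank l x = k \<or> (k = pow_otp l \<and> pow_rank l x = e0)" by blast
  have xM: "x \<in> M" and xl: "ext x \<subseteq> ext l" using x(1) ext_hpow[OF lM] by auto
  have D: "DT True (\<lambda>s. sc (sc (s 0)))" by (intro dfn)
  have "isset ((\<lambda>i. sc (sc i)) ` ext x)" by (rule repl[OF xM D])
  then have "isset (insert (sc e0) (insert l ((\<lambda>i. sc (sc i)) ` ext x)))" using lM by simp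
  then obtain A where A: "A \<in> M" "ext A = insert (sc e0) (insert l ((\<lambda>i. sc (sc i)) ` ext x))"
    unfolding isset_def by blast
  have "pow_code k A" unfolding pow_code_def
    using k l x A(2) by (intro conjI bexI[of _ l] bexI[of _ x]) auto
  moreover have "ext A \<subseteq> ext k"
  proof -
    have "sc (sc i) \<in> ext k" if "i \<in> ext x" for i
      using that xl lim_sc[OF l(2)] Ord_trans[OF kO l(1)] by blast
    moreover have "sc e0 \<in> ext k" using k unfolding lim_def by blast
    ultimately show ?thesis using A(2) l(1) by auto
  qed
  ultimately show ?thesis using A(1) by blast
qed

text \<open>Otherwise the ordinals from \<open>l\<close> to \<open>k\<close> would have order type \<open>\<omega>\<close>, making \<open>k\<close> singular.\<close>

lemma lim_between:
  assumes k: "lim k" "om \<in> ext k" and ns: "\<And>a. \<not> sing a k" and l: "l \<in> ext k"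
  shows "\<exists>m\<in>ext k. lim m \<and> l \<in> ext m"
proof (rule ccontr)
  assume no: "\<not> ?thesis"
  have kO: "k \<in> Ord" using k by (simp add: lim_def)
  have lO: "l \<in> Ord" using Ord_elt[OF kO l] .
  define S where "S = mk {y. y \<in> M \<and> (y \<in> ext k \<and> (y = l \<or> l \<in> ext y))}"
  have D: "D True (\<lambda>s. s 0 = l \<or> l \<in> ext (s 0))" by (intro dfn DT_Ord_const lO)
  have eS: "ext S = {y \<in> ext k. y = l \<or> l \<in> ext y}"
    unfolding S_def by (rule ext_mk_sep[where P = "\<lambda>y. y = l \<or> l \<in> ext y", OF Ord_M[OF kO] D])
  have SM: "S \<in> M" by (simp add: S_def)
  have DS: "DT b (\<lambda>s. S)" for b
    unfolding S_def by (intro dfn DT_Ord_const[OF lO] DT_Ord_const[OF kO])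
  have SO: "ext S \<subseteq> Ord" using eS Ord_elt[OF kO] by blast
  have SN: "S \<in> N" by (rule HODI[OF SM DS]) (use SO in auto)
  \<comment> \<open>With no limits between \<open>l\<close> and \<open>k\<close>, every element of
    \<open>S\<close> other than \<open>l\<close> is the successor of an element of \<open>S\<close>,
    so all ranks in \<open>S\<close> are below omega.\<close>
  have fin: "y \<in> ext S \<longrightarrow> col S y \<in> ext om" if y: "y \<in> Ord" for y
  proof (rule Ord_induct[where P = "\<lambda>y. y \<in> ext S \<longrightarrow> col S y \<in> ext om", OF _ y])
    show "D True (\<lambda>s. s 0 \<in> ext S \<longrightarrow> col S (s 0) \<in> ext om)" by (intro dfn DS)
    fix y assume y: "y \<in> Ord" and IH: "\<forall>z\<in>ext y. z \<in> ext S \<longrightarrow> col S z \<in> ext om"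
    show "y \<in> ext S \<longrightarrow> col S y \<in> ext om"
    proof
      assume yS: "y \<in> ext S"
      show "col S y \<in> ext om"
      proof (cases "y = l")
        case True
        have "ext (col S y) = {}"
          unfolding ext_col[OF SM y] unfolding True eS using no_2cycle mem_irrefl by blast
        then have "col S y = e0" using ext_inj[of "col S y" e0] Ord_M[OF col_Ord[OF SM y]] by auto
        then show ?thesis using om(1) unfolding lim_def by simp
      next
        case False
        then have ly: "l \<in> ext y" "y \<in> ext k" using yS eS by auto
        then have "\<not> lim y" "y \<noteq> e0" using no by auto
        then obtain z where z: "z \<in> Ord" "y = sc z" using lim_or_sc[OF y] by blast
        have zy: "z \<in> ext y" using z by simp
        have "l = z \<or> l \<in> ext z" using ly z by auto
        then have zS: "z \<in> ext S" using eS Ord_trans[OF kO ly(2) zy] by blast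
        have "ext (col S y) = insert (col S z) (ext (col S z))"
          unfolding ext_col[OF SM y] ext_col[OF SM z(1)] using z zS by auto
        also have "\<dots> = ext (sc (col S z))" using Ord_M[OF col_Ord[OF SM z(1)]] by simp
        finally have "col S y = sc (col S z)" using ext_inj Ord_M[OF col_Ord[OF SM y]] by auto
        then show ?thesis using IH zy zS lim_sc[OF om(1)] by auto
      qed
    qed
  qed
  \<comment> \<open>The inverse of the collapse of \<open>S\<close>: a map from ranks below omega
    that is cofinal in \<open>k\<close>.\<close>
  define f where "f = mk {p. p \<in> M \<and> (\<exists>y\<in>ext S. p = pair (col S y) y)}"
  have ef: "ext f = (\<lambda>y. pair (col S y) y) ` ext S"
    unfolding f_def by (rule ext_mk_image[OF SM]) (intro dfn DS)
  have cO: "col S y \<in> Ord" if "y \<in> ext S" for y using col_Ord[OF SM] SO that by blast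
  have fN: "f \<in> N"
  proof (rule HODI)
    show "DT False (\<lambda>s. f)" unfolding f_def by (intro dfn DS)
    show "ext f \<subseteq> N" unfolding ef using cO SO by auto
  qed (simp add: f_def)
  have pf: "pair x y \<in> ext f \<longleftrightarrow> y \<in> ext S \<and> x = col S y" if xy: "x \<in> M" "y \<in> M" for x y
  proof -
    have "pair x y = pair (col S z) z \<longleftrightarrow> x = col S z \<and> y = z" if "z \<in> ext S" for z
      using pair_inj[OF xy Ord_M[OF cO[OF that]] ext_M[OF that]] .
    then show ?thesis unfolding ef by blast
  qed
  have "functional f" unfolding functional_def
  proof (intro ballI impI)
    fix x y y' assume "x \<in> M" "y \<in> M" "y' \<in> M" "pair x y \<in> ext f" "pair x y' \<in> ext f"
    then have "y \<in> ext S" "y' \<in> ext S" "col S y = col S y'" using pf by auto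
    then show "y = y'" using col_inj[OF SM SO] unfolding inj_on_def by blast
  qed
  moreover have "unb f om k" unfolding unb_def
  proof
    fix y assume y: "y \<in> ext k"
    obtain z where z: "z \<in> ext S" "y = z \<or> y \<in> ext z"
      using Ord_linear[OF Ord_elt[OF kO y] lO] eS y l by blast
    have "pair (col S z) z \<in> ext f" unfolding ef using z(1) by blast
    moreover have "col S z \<in> ext om" using fin z(1) SO by blast
    ultimately show "\<exists>x\<in>ext om. \<exists>y'\<in>ext k. (y = y' \<or> y \<in> ext y') \<and> pair x y' \<in> ext f"
      using z eS by blast
  qed
  ultimately have "sing om k" unfolding sing_def using k(2) fN by blast
  then show False using ns by blast
qed

section \<open>From the lack of codes to inaccessibility in HOD\<close>

lemma N_ext: "x \<in> N \<Longrightarrow> a \<in> N \<Longrightarrow> E a x \<longleftrightarrow> a \<in> ext x"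
  using ext_N_iff by blast

lemma pair_graph:
  assumes "ext f = {pair x (g x) | x. x \<in> ext p}" "\<And>x. x \<in> ext p \<Longrightarrow> g x \<in> M"
    and xy: "x \<in> M" "y \<in> M"
  shows "pair x y \<in> ext f \<longleftrightarrow> x \<in> ext p \<and> y = g x"
proof -
  have "pair x y = pair z (g z) \<longleftrightarrow> x = z \<and> y = g z" if "z \<in> ext p" for z
    using pair_inj[OF xy ext_M[OF that] assms(2)[OF that]] .
  then show ?thesis unfolding assms(1) by blast
qed

text \<open>The composite with the inverse is described from \<open>f\<close> and \<open>f'\<close>,
  which are ordinal definable as members of HOD; so its graph is in HOD again.\<close>

lemma equipotent_trans_inv:
  assumes N: "p \<in> N" "m \<in> N" "a \<in> N" and pm: "equipotent N E p m" and am: "equipotent N E a m"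
  shows "equipotent N E p a"
proof -
  obtain f g where f: "f \<in> N" "bij_betw g (ext p) (ext m)" "ext f = {pair x (g x) | x. x \<in> ext p}"
    using pm bijN[OF _ N(1,2)] unfolding equipotent_def by blast
  obtain f' g' where f': "f' \<in> N" "bij_betw g' (ext a) (ext m)" "ext f' = {pair x (g' x) | x. x \<in> ext a}"
    using am bijN[OF _ N(3,2)] unfolding equipotent_def by blast
  define F where "F x = thep (\<lambda>z. \<exists>y\<in>M. pair x y \<in> ext f \<and> pair z y \<in> ext f')" for x
  have DF: "DT False (\<lambda>s. F (s 0))"
    unfolding F_def by (intro dfn DT_N[OF f(1)] DT_N[OF f'(1)])
  have gM: "g x \<in> M" if "x \<in> ext p" for x using f(2) that unfolding bij_betw_def by blast
  have g'M: "g' x \<in> M" if "x \<in> ext a" for x using f'(2) that unfolding bij_betw_def by blast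
  have pf: "pair x y \<in> ext f \<longleftrightarrow> x \<in> ext p \<and> y = g x" if "x \<in> M" "y \<in> M" for x y
    by (rule pair_graph[OF f(3)]) (use gM that in blast)+
  have pf': "pair x y \<in> ext f' \<longleftrightarrow> x \<in> ext a \<and> y = g' x" if "x \<in> M" "y \<in> M" for x y
    by (rule pair_graph[OF f'(3)]) (use g'M that in blast)+
  have F: "F x = inv_into (ext a) g' (g x)" if x: "x \<in> ext p" for x
  proof -
    have gx: "g x \<in> g' ` ext a" using f(2) f'(2) x unfolding bij_betw_def by blast
    let ?z = "inv_into (ext a) g' (g x)"
    have z: "?z \<in> ext a" "g' ?z = g x" using gx by (auto intro: inv_into_into f_inv_into_f)
    show ?thesis unfolding F_def
    proof (rule thep_eq)
      show "?z \<in> M" using z by blast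
      show "\<exists>y\<in>M. pair x y \<in> ext f \<and> pair ?z y \<in> ext f'"
        using pf[OF ext_M[OF x] gM[OF x]] pf'[OF ext_M[OF z(1)] gM[OF x]] x z gM[OF x] by auto
      fix w assume w: "w \<in> M" "\<exists>y\<in>M. pair x y \<in> ext f \<and> pair w y \<in> ext f'"
      then have "w \<in> ext a" "g' w = g x" using pf[OF ext_M[OF x]] pf'[OF w(1)] by auto
      then show "w = ?z" using f'(2) z unfolding bij_betw_def inj_on_def by metis
    qed
  qed
  have "bij_betw (inv_into (ext a) g' \<circ> g) (ext p) (ext a)"
    by (rule bij_betw_trans[OF f(2) bij_betw_inv_into[OF f'(2)]])
  then have "bij_betw F (ext p) (ext a)"
    by (rule iffD1[OF bij_betw_cong, rotated]) (simp add: F)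
  then show ?thesis by (rule equipotentI[OF N(1,3) DF])
qed

lemma D_ball_N [dfn]:
  "D b (\<lambda>s. P (s 0) (\<lambda>n. s (Suc n))) \<Longrightarrow> D b (\<lambda>s. \<forall>x\<in>N. P x s)"
  by (rule D_ball_class) (intro dfn, rule HOD_sub)

lemma D_ex1_N [dfn]:
  assumes "D b (\<lambda>s. P (s 0) (\<lambda>n. s (Suc n)))"
  shows "D b (\<lambda>s. \<exists>!x. x \<in> N \<and> P x s)"
proof -
  have "D b (\<lambda>s. \<exists>x\<in>N. P x s \<and> (\<forall>y\<in>N. P y s \<longrightarrow> y = x))"
    using D_lift[OF assms] by (intro dfn assms) auto
  then show ?thesis by (rule D_cong) blast
qed

lemma D_equipotent:
  assumes p: "p \<in> N" shows "D True (\<lambda>s. s 0 \<in> N \<and> equipotent N E p (s 0))"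
  unfolding equipotent_def is_bij_def is_fun_def is_app_def is_pair_def is_upair_def
  by (intro dfn DT_N[OF p])

text \<open>A bijection from a smaller ordinal, or a function unbounded in \<open>k\<close>, would
  witness \<open>sing\<close>; this gives cardinality and regularity. For the strong limit property
  the order types of power sets bound their cardinals.\<close>

lemma accessible:
  assumes k: "lim k" "om \<in> ext k" and ns: "\<And>a. \<not> sing a k"
    and pw: "\<And>l. l \<in> ext k \<Longrightarrow> lim l \<Longrightarrow> pow_otp l \<in> ext k"
  shows "strongly_inaccessible N E k"
proof -
  have kO: "k \<in> Ord" using k by (simp add: lim_def)
  have kN: "k \<in> N" using kO by simp
  have k1: "k \<in> Ords N E" using OrdN[OF kO] .
  have card: "is_cardinal N E k"
    unfolding is_cardinal_def
  proof (intro conjI k1 ballI impI)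
    fix a assume a: "a \<in> N" "E a k"
    then have ak: "a \<in> ext k" using N_ext[OF kN] by blast
    show "\<not> equipotent N E a k"
    proof
      assume "equipotent N E a k"
      then obtain f g where f: "f \<in> N" "bij_betw g (ext a) (ext k)" "ext f = {pair x (g x) | x. x \<in> ext a}"
        using bijN[OF _ a(1) kN] unfolding equipotent_def by blast
      have gM: "g x \<in> M" if "x \<in> ext a" for x using f(2) that unfolding bij_betw_def by blast
      have "functional f" unfolding functional_def
      proof (intro ballI impI)
        fix x y y' assume *: "x \<in> M" "y \<in> M" "y' \<in> M" "pair x y \<in> ext f" "pair x y' \<in> ext f"
        have "v = g x" if "v \<in> M" "pair x v \<in> ext f" for v
          using pair_graph[OF f(3) _ *(1) that(1)] that(2) gM by blast
        then show "y = y'" using * by blast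
      qed
      moreover have "unb f a k" unfolding unb_def
      proof
        fix y assume y: "y \<in> ext k"
        then obtain x where x: "x \<in> ext a" "y = g x" using f(2) unfolding bij_betw_def by blast
        then have "pair x y \<in> ext f" using f(3) by blast
        then show "\<exists>x\<in>ext a. \<exists>y'\<in>ext k. (y = y' \<or> y \<in> ext y') \<and> pair x y' \<in> ext f" using x y by blast
      qed
      ultimately have "sing a k" unfolding sing_def using ak f(1) by blast
      then show False using ns by blast
    qed
  qed
  have reg: "is_regular N E k"
    unfolding is_regular_def
  proof (intro conjI card ballI impI)
    show "is_limit N E k" using limN[OF kO] k(1) by blast
    fix a f assume a: "a \<in> N" and f: "f \<in> N" and af: "E a k \<and> is_fun N E f a k"
    have ak: "a \<in> ext k" using af N_ext[OF kN a] by blast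
    have "functional f" unfolding functional_def
    proof (intro ballI impI)
      fix x y y' assume *: "x \<in> M" "y \<in> M" "y' \<in> M" "pair x y \<in> ext f" "pair x y' \<in> ext f"
      have "x \<in> N \<and> E x a \<and> v \<in> N" if v: "v \<in> M" "pair x v \<in> ext f" for v
      proof -
        have "pair x v \<in> N" "E (pair x v) f" using ext_N_iff[OF f] v(2) by blast+
        then obtain u w where u: "u \<in> N" "w \<in> N" "E u a" "is_pair N E u w (pair x v)"
          using af unfolding is_fun_def by blast
        then have "pair x v = pair u w" using pairN \<open>pair x v \<in> N\<close> by blast
        then have "x = u \<and> v = w" using pair_inj[OF *(1) v(1) HOD_M[OF u(1)] HOD_M[OF u(2)]] by blast
        then show ?thesis using u by blast
      qed
      then have n: "x \<in> N" "E x a" "y \<in> N" "y' \<in> N" using * by blast+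
      have "\<exists>!b. b \<in> N \<and> is_app N E f x b" using af n(1,2) unfolding is_fun_def by blast
      moreover have "is_app N E f x y" "is_app N E f x y'" using appN[OF f n(1)] n *(4,5) by blast+
      ultimately show "y = y'" using n by blast
    qed
    then have "\<not> unb f a k" using ns[of a] ak f unfolding sing_def by blast
    then obtain b where b: "b \<in> ext k"
      "\<And>x y. x \<in> ext a \<Longrightarrow> y \<in> ext k \<Longrightarrow> pair x y \<in> ext f \<Longrightarrow> \<not> (b = y \<or> b \<in> ext y)"
      unfolding unb_def by blast
    have "E y b" if xy: "x \<in> N" "y \<in> N" "is_app N E f x y" for x y
    proof -
      have p: "pair x y \<in> ext f" using appN[OF f xy(1,2)] xy(3) by blast
      have "pair x y \<in> N" "E (pair x y) f" using ext_N_iff[OF f] p by blast+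
      then obtain u w where u: "u \<in> N" "w \<in> N" "E u a" "E w k" "is_pair N E u w (pair x y)"
        using af unfolding is_fun_def by blast
      then have "pair x y = pair u w" using pairN \<open>pair x y \<in> N\<close> by blast
      then have "x = u \<and> y = w"
        using pair_inj[OF HOD_M[OF xy(1)] HOD_M[OF xy(2)] HOD_M[OF u(1)] HOD_M[OF u(2)]] by blast
      then have "x \<in> ext a" "y \<in> ext k" using u N_ext[OF a] N_ext[OF kN] by blast+
      then have "\<not> (b = y \<or> b \<in> ext y)" "y \<in> Ord" "b \<in> Ord" using b p Ord_elt[OF kO] by blast+
      then have "y \<in> ext b" using Ord_linear by blast
      then show ?thesis by (simp add: ext_iff)
    qed
    moreover have "b \<in> N" "E b k" using b(1) ext_N_iff[OF kN] by blast+
    ultimately show "\<exists>b\<in>N. E b k \<and> (\<forall>x\<in>N. \<forall>y\<in>N. is_app N E f x y \<longrightarrow> E y b)" by blast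
  qed
  have "is_strong_limit N E k"
    unfolding is_strong_limit_def
  proof (intro conjI card ballI impI)
    fix l assume "l \<in> N" "is_cardinal N E l \<and> E l k"
    then have lk: "l \<in> ext k" using N_ext[OF kN] by blast
    then have lO: "l \<in> Ord" using Ord_elt[OF kO] by blast
    \<comment> \<open>The bound on \<open>pow_otp\<close> is given at limits only, so it is taken at
      a limit \<open>m\<close> above \<open>l\<close>.\<close>
    obtain m where m: "m \<in> ext k" "lim m" "l \<in> ext m" using lim_between[OF k ns lk] by blast
    have mO: "m \<in> Ord" using Ord_elt[OF kO m(1)] .
    have "ext l \<subseteq> ext m" using Ord_trans[OF mO m(3)] by blast
    then have "pow_otp l \<in> ext k"
      using pow_otp_mono[OF lO mO] pw[OF m(1,2)] Ord_trans[OF kO] by metis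
    have pN: "hpow l \<in> N" using hpow_HOD[OF lO] .
    have "pow_otp l \<in> N \<and> equipotent N E (hpow l) (pow_otp l)" using pow_otp_equipotent[OF lO] by simp
    \<comment> \<open>The cardinal 2^l of HOD is the least ordinal equipotent there with
      \<open>hpow l\<close>; it is at most \<open>pow_otp l\<close>, hence below
      \<open>k\<close>.\<close>
    from Ord_least[where P = "\<lambda>c. c \<in> N \<and> equipotent N E (hpow l) c", OF D_equipotent[OF pN] pow_otp_Ord this]
    obtain c where c: "c \<in> Ord" "equipotent N E (hpow l) c" "\<forall>d\<in>ext c. \<not> (d \<in> N \<and> equipotent N E (hpow l) d)"
      "c = pow_otp l \<or> c \<in> ext (pow_otp l)" by blast
    have cN: "c \<in> N" using c(1) by simp
    have "c \<in> ext k" using c(4) \<open>pow_otp l \<in> ext k\<close> Ord_trans[OF kO] by blast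
    then have ck: "E c k" by (simp add: ext_iff)
    have "is_cardinal N E c" unfolding is_cardinal_def
    proof (intro conjI OrdN[OF c(1)] ballI impI notI)
      fix a assume a: "a \<in> N" "E a c" "equipotent N E a c"
      then have "a \<in> ext c" using N_ext[OF cN] by blast
      then show False using c(3) equipotent_trans_inv[OF pN cN a(1) c(2) a(3)] a(1) by blast
    qed
    then show "\<exists>p\<in>N. \<exists>m\<in>N. is_power N E l p \<and> is_cardinal N E m \<and> equipotent N E p m \<and> E m k"
      using pN cN powerN[OF lO] c(2) ck by blast
  qed
  moreover have "\<exists>w\<in>N. is_omega N E w \<and> E w k"
    using omegaN Ord_HOD[OF om_Ord] k(2) unfolding ext_iff by blast
  ultimately show ?thesis unfolding strongly_inaccessible_def using reg by blast
qed

section \<open>Existence and incompatibility of codes\<close>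

lemma ex_code:
  assumes k: "k \<in> Ord" "om \<in> ext k" "\<not> strongly_inaccessible N E k"
  shows "\<exists>A\<in>M. ext A \<subseteq> ext k \<and> (succ_code k A \<or> cof_code k A \<or> pow_code k A)"
proof -
  have "k \<noteq> e0" using k(2) by auto
  then consider (s) g where "g \<in> Ord" "k = sc g" | (l) "lim k" using lim_or_sc[OF k(1)] by blast
  then show ?thesis
  proof cases
    case s
    obtain A where A: "A \<in> M" "ext A = {g}" using isset_sing[of g] s(1) unfolding isset_def by auto
    have gk: "g \<in> ext k" using s by simp
    then have "succ_code k A" unfolding succ_code_def using s A(2) by (intro bexI[of _ g]) auto
    then show ?thesis using A gk by auto
  next
    case l
    show ?thesis
    proof (cases "\<exists>a. sing a k")
      case True
      then show ?thesis using ex_cof_code[OF l] by blast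
    next
      case False
      then obtain m where "m \<in> ext k" "lim m" "pow_otp m \<notin> ext k" using accessible[OF l k(2)] k(3) by blast
      then show ?thesis using ex_pow_code[OF l] by blast
    qed
  qed
qed

text \<open>The bound \<open>om\<close> enters for successors: the only element of such a code is
  the predecessor of \<open>k\<close>, which is then at least omega and so neither 0 nor 1.\<close>

lemma marks:
  assumes k: "k \<in> Ord" "om \<in> ext k" and A: "A \<in> M"
  shows "succ_code k A \<Longrightarrow> e0 \<notin> ext A" "succ_code k A \<Longrightarrow> sc e0 \<notin> ext A"
    "cof_code k A \<Longrightarrow> e0 \<in> ext A" "cof_code k A \<Longrightarrow> sc e0 \<notin> ext A"
    "pow_code k A \<Longrightarrow> e0 \<notin> ext A" "pow_code k A \<Longrightarrow> sc e0 \<in> ext A"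
proof -
  have z: "e0 \<in> ext om" "sc e0 \<in> ext om" using om(1) unfolding lim_def by auto
  { assume "succ_code k A"
    then obtain g where g: "g \<in> ext k" "k = sc g" "\<forall>z\<in>M. z \<in> ext A \<longleftrightarrow> z = g" unfolding succ_code_def by blast
    then have "om = g \<or> om \<in> ext g" using k(2) ext_sc[of g] by blast
    then have "g \<noteq> e0" "g \<noteq> sc e0" using z no_2cycle mem_irrefl e0(2) by (metis empty_iff)+
    then show "e0 \<notin> ext A" "sc e0 \<notin> ext A" using g(3) by auto }
  { assume "cof_code k A"
    then obtain a f where a: "a \<in> ext k" "\<forall>z\<in>M. z \<in> ext A \<longleftrightarrow> z = e0 \<or> z = sc (sc a) \<or>
          (z \<in> ext k \<and> sc (sc a) \<in> ext z \<and> (\<exists>x\<in>ext a. pair x z \<in> ext f))"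
      unfolding cof_code_def by blast
    then show "e0 \<in> ext A" by auto
    have aO: "a \<in> Ord" using Ord_elt[OF k(1) a(1)] .
    have "sc (sc a) \<noteq> sc e0" using sc_inj[of "sc a" e0] aO by auto
    moreover have "sc (sc a) \<notin> ext (sc e0)" using aO by auto
    ultimately show "sc e0 \<notin> ext A" using a(2) sc_neq_e0[of e0] by (metis e0(1) sc_M) }
  { assume "pow_code k A"
    then obtain l x where l: "lim l" "x \<in> ext (hpow l)"
        "\<forall>z\<in>M. z \<in> ext A \<longleftrightarrow> z = sc e0 \<or> z = l \<or> (\<exists>i\<in>ext x. z = sc (sc i))"
      unfolding pow_code_def by blast
    then show "sc e0 \<in> ext A" by auto
    have "l \<noteq> e0" using l(1) unfolding lim_def by auto
    then show "e0 \<notin> ext A" using l(3) sc_neq_e0 sc_M by (metis e0(1)) }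
qed

lemma no_coherence:
  assumes a: "k \<in> Ord" "om \<in> ext k" and b: "k' \<in> Ord" "k \<in> ext k'"
    and A: "A \<in> M" "B \<in> M" and AB: "\<And>z. z \<in> ext k \<Longrightarrow> z \<in> ext B \<longleftrightarrow> z \<in> ext A"
    and Bk: "ext B \<subseteq> ext k"
    and TA: "succ_code k' A \<or> cof_code k' A \<or> pow_code k' A" and TB: "succ_code k B \<or> cof_code k B \<or> pow_code k B"
  shows False
proof -
  have om': "om \<in> ext k'" using Ord_trans[OF b] a(2) .
  have "e0 \<in> ext om" "sc e0 \<in> ext om" using om(1) unfolding lim_def by auto
  then have z: "e0 \<in> ext k" "sc e0 \<in> ext k" using Ord_trans[OF a] by blast+
  note mA = marks[OF b(1) om' A(1)] and mB = marks[OF a A(2)]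
  have same: "e0 \<in> ext B \<longleftrightarrow> e0 \<in> ext A" "sc e0 \<in> ext B \<longleftrightarrow> sc e0 \<in> ext A" using AB z by auto
  consider "succ_code k' A" "succ_code k B" | "cof_code k' A" "cof_code k B" | "pow_code k' A" "pow_code k B"
    using TA TB mA mB same by blast
  then show False
  proof cases
    case 1
    then obtain g g' where g: "g \<in> ext k" "\<forall>z\<in>M. z \<in> ext B \<longleftrightarrow> z = g"
      and g': "k' = sc g'" "g' \<in> ext k'" "\<forall>z\<in>M. z \<in> ext A \<longleftrightarrow> z = g'" unfolding succ_code_def by blast
    \<comment> \<open>Both codes are singletons: the predecessor of \<open>k\<close> would be that
      of \<open>k'\<close>, which is at least \<open>k\<close>.\<close>
    have "g \<in> ext A" using AB[OF g(1)] g ext_M[OF g(1)] by blast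
    then have "g = g'" using g'(3) ext_M[OF g(1)] by blast
    moreover have "k = g' \<or> k \<in> ext g'" using b(2) g'(1) ext_sc[OF ext_M[OF g'(2)]] by blast
    ultimately show False using g(1) no_2cycle mem_irrefl by blast
  next
    case 2
    from 2(2) obtain c f where c: "c \<in> ext k" "\<forall>c'\<in>ext c. \<not> sing c' k" "f \<in> N" "unb f c k"
      and B: "\<And>z. z \<in> M \<Longrightarrow> z \<in> ext B \<longleftrightarrow> z = e0 \<or> z = sc (sc c) \<or>
          (z \<in> ext k \<and> sc (sc c) \<in> ext z \<and> (\<exists>x\<in>ext c. pair x z \<in> ext f))"
      unfolding cof_code_def by blast
    from 2(1) obtain c' f' where c': "c' \<in> ext k'" "f' \<in> N" "functional f'" "unb f' c' k'" "incr f' c' k'"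
      and A': "\<And>z. z \<in> M \<Longrightarrow> z \<in> ext A \<longleftrightarrow> z = e0 \<or> z = sc (sc c') \<or>
          (z \<in> ext k' \<and> sc (sc c') \<in> ext z \<and> (\<exists>x\<in>ext c'. pair x z \<in> ext f'))"
      unfolding cof_code_def by blast
    have lk: "lim k" using 2 unfolding cof_code_def by blast
    have O: "c \<in> Ord" "c' \<in> Ord" using Ord_elt a(1) b(1) c(1) c'(1) by blast+
    let ?d = "sc (sc c)" let ?d' = "sc (sc c')"
    have dk: "?d \<in> ext k" using lim_sc[OF lk] c(1) by blast
    have ne: "?d \<noteq> e0" "?d' \<noteq> e0" by auto
    have "?d \<in> ext A" using AB[OF dk] B[of ?d] by auto
    then have 1: "?d = ?d' \<or> ?d' \<in> ext ?d" using A'[of ?d] ne by auto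
    \<comment> \<open>Each of the two is the least nonzero element of its code. If
      \<open>?d'\<close> were smaller, it would lie below \<open>k\<close>, hence in
      \<open>B\<close>, hence not below \<open>?d\<close>.\<close>
    have "?d = ?d'"
    proof (rule ccontr)
      assume n: "?d \<noteq> ?d'"
      then have dd: "?d' \<in> ext ?d" using 1 by blast
      then have d'k: "?d' \<in> ext k" using Ord_trans[OF a(1) dk] by blast
      then have "?d' \<in> ext B" using AB[OF d'k] A'[of ?d'] by auto
      then have "?d \<in> ext ?d'" using B[of ?d'] n ne by auto
      then show False using dd no_2cycle by blast
    qed
    then have cc: "c' = c" using sc_inj O by (metis Ord_sc)
    \<comment> \<open>The cofinal map of \<open>k'\<close> reaches \<open>k\<close> at
      \<open>x0\<close>; below \<open>x0\<close> it will turn out cofinal in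
      \<open>k\<close>.\<close>
    obtain x0 y0 where x0: "x0 \<in> ext c" "y0 \<in> ext k'" "k = y0 \<or> k \<in> ext y0" "pair x0 y0 \<in> ext f'"
      using c'(4) b(2) unfolding unb_def cc by blast
    have y0O: "y0 \<in> Ord" using Ord_elt[OF b(1) x0(2)] .
    have "unb f' x0 k" unfolding unb_def
    proof
      fix y assume y: "y \<in> ext k"
      have yO: "y \<in> Ord" using Ord_elt[OF a(1) y] .
      \<comment> \<open>A value of \<open>f\<close> above both \<open>y\<close> and
        \<open>?d\<close> is recorded in \<open>B\<close>; being in \<open>A\<close> and above
        \<open>?d\<close>, it is also a value of \<open>f'\<close>.\<close>
      let ?w = "sc (mx y ?d)"
      have mO: "mx y ?d \<in> Ord" using mx(1)[OF yO] O by simp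
      have "mx y ?d \<in> ext k" using mx(4)[OF yO, of ?d] O y dk by auto
      then have "?w \<in> ext k" using lim_sc[OF lk] by blast
      then obtain x1 y' where x1: "x1 \<in> ext c" "y' \<in> ext k" "?w = y' \<or> ?w \<in> ext y'" "pair x1 y' \<in> ext f"
        using c(4) unfolding unb_def by blast
      have y'O: "y' \<in> Ord" using Ord_elt[OF a(1) x1(2)] .
      have y'M: "y' \<in> M" using y'O by simp
      have "mx y ?d \<in> ext ?w" using mO by simp
      then have my: "mx y ?d \<in> ext y'" using x1(3) Ord_trans[OF y'O] by blast
      have yy: "y \<in> ext y'" "?d \<in> ext y'"
        using mx(2)[OF yO, of ?d] mx(3)[OF yO, of ?d] O my Ord_trans[OF y'O my] by auto
      have "y' \<in> ext B" using B[OF y'M] x1 yy(2) by blast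
      then have "y' \<in> ext A" using AB[OF x1(2)] by blast
      moreover have "y' \<noteq> e0" "y' \<noteq> ?d" using yy(2) mem_irrefl[of ?d] e0(2) by (metis empty_iff)+
      ultimately obtain x where x: "x \<in> ext c" "pair x y' \<in> ext f'" using A'[OF y'M] unfolding cc by blast
      have y'k': "y' \<in> ext k'" using Ord_trans[OF b x1(2)] .
      have y'y0: "y' \<in> ext y0" using x0(3) x1(2) Ord_trans[OF y0O] by blast
      have xO: "x \<in> Ord" "x0 \<in> Ord" using Ord_elt[OF O(1)] x(1) x0(1) by blast+
      \<comment> \<open>Since \<open>f'\<close> is increasing and its value \<open>y'\<close> at
        \<open>x\<close> is below its value \<open>y0\<close> at \<open>x0\<close>, the argument
        \<open>x\<close> must be below \<open>x0\<close>.\<close>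
      have "x \<noteq> x0"
      proof
        assume "x = x0"
        then have "y' = y0" using c'(3) x(2) x0(4) y'M y0O xO unfolding functional_def by blast
        then show False using y'y0 by simp
      qed
      moreover have "x0 \<notin> ext x"
      proof
        assume "x0 \<in> ext x"
        then have "y0 \<in> ext y'" using c'(5) x x0 y'k' unfolding incr_def cc by blast
        then show False using y'y0 no_2cycle by blast
      qed
      ultimately have "x \<in> ext x0" using Ord_linear[OF xO] by blast
      then show "\<exists>x\<in>ext x0. \<exists>y'\<in>ext k. (y = y' \<or> y \<in> ext y') \<and> pair x y' \<in> ext f'"
        using x x1(2) yy(1) by blast
    qed
    moreover have "x0 \<in> ext k" using Ord_trans[OF a(1) c(1) x0(1)] .
    \<comment> \<open>This contradicts that \<open>c\<close> was least, as \<open>x0\<close> is an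
      element of \<open>c\<close>.\<close>
    ultimately have "sing x0 k" unfolding sing_def using c'(2,3) by blast
    then show False using c(2) x0(1) by blast
  next
    case 3
    from 3(2) obtain l x where l: "l \<in> ext k" "lim l" "x \<in> ext (hpow l)"
        "pow_rank l x = k \<or> (k = pow_otp l \<and> pow_rank l x = e0)"
      and B: "\<And>z. z \<in> M \<Longrightarrow> z \<in> ext B \<longleftrightarrow> z = sc e0 \<or> z = l \<or> (\<exists>i\<in>ext x. z = sc (sc i))"
      unfolding pow_code_def by blast
    from 3(1) obtain l' x' where l': "l' \<in> ext k'" "lim l'" "x' \<in> ext (hpow l')"
        "pow_rank l' x' = k' \<or> (k' = pow_otp l' \<and> pow_rank l' x' = e0)"
      and A': "\<And>z. z \<in> M \<Longrightarrow> z \<in> ext A \<longleftrightarrow> z = sc e0 \<or> z = l' \<or> (\<exists>i\<in>ext x'. z = sc (sc i))"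
      unfolding pow_code_def by blast
    have lM: "l \<in> M" using l(1) by blast
    have nl: "l \<noteq> sc y" "y \<in> M \<Longrightarrow> l' \<noteq> sc y" if "y \<in> M" for y
      using lim_not_sc l(2) l'(2) that by blast+
    have "l \<in> ext A" using AB[OF l(1)] B[OF lM] by blast
    \<comment> \<open>All elements of \<open>A\<close> other than \<open>l'\<close> are successors,
      so the limit \<open>l\<close> can only be \<open>l'\<close>.\<close>
    then have ll: "l' = l" using A'[OF lM] nl(1)[OF e0(1)] nl(1)[OF sc_M] by metis
    have xs: "ext x \<subseteq> ext l" "ext x' \<subseteq> ext l" "x \<in> M" "x' \<in> M"
      using l(3) l'(3) unfolding ll ext_hpow[OF lM] by auto
    have "i \<in> ext x \<longleftrightarrow> i \<in> ext x'" if i: "i \<in> ext l" for i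
    proof -
      have O: "j \<in> Ord" if "j \<in> ext l" for j using that l(2) Ord_elt unfolding lim_def by blast
      have "sc (sc i) \<in> ext k" using lim_sc[OF l(2)] i Ord_trans[OF a(1) l(1)] by blast
      note ab = AB[OF this]
      have ne: "sc (sc i) \<noteq> l" "sc (sc i) \<noteq> sc e0"
        using nl(1)[OF sc_M] sc_inj[of "sc i" e0] O[OF i] by auto
      have inj: "sc (sc i) = sc (sc j) \<longleftrightarrow> i = j" if "j \<in> ext l" for j
        using sc_inj[of "sc i" "sc j"] sc_inj[of i j] O[OF i] O[OF that] by auto
      have "i \<in> ext x \<longleftrightarrow> sc (sc i) \<in> ext B" using B[OF sc_M, of "sc i"] ne inj xs(1) by blast
      also have "\<dots> \<longleftrightarrow> i \<in> ext x'" unfolding ab using A'[OF sc_M, of "sc i"] ne inj xs(2) ll by blast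
      finally show ?thesis .
    qed
    then have "x = x'" using ext_inj[OF xs(3,4)] xs(1,2) by blast
    \<comment> \<open>Neither ordinal is 0, so rank 0 signals the order type and any other rank is
      the ordinal itself; either way \<open>k\<close> and \<open>k'\<close> would be equal.\<close>
    moreover have "k \<noteq> e0" "k' \<noteq> e0" "k \<noteq> k'" using a(2) om' b(2) by auto
    ultimately show False using l(4) l'(4) unfolding ll by auto
  qed
qed

lemma inaccessible_in_HOD_above:
  assumes faint: "Ord_essentially_faint M E" and x: "x \<in> Ord"
  shows "\<exists>k\<in>Ord. E x k \<and> strongly_inaccessible N E k"
proof (rule ccontr)
  assume no: "\<not> ?thesis"
  \<comment> \<open>Codes are analysed only above omega, so faintness is applied at the maximum of
    \<open>x\<close> and \<open>om\<close>.\<close>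
  define y where "y = mx x om"
  have yO: "y \<in> Ord" unfolding y_def by (rule mx(1)[OF x om_Ord])
  have y: "x \<in> ext k" "om \<in> ext k" if "k \<in> Ord" "y \<in> ext k" for k
    using mx(2,3)[OF x om_Ord] that Ord_trans[OF that] unfolding y_def by metis+
  \<comment> \<open>The sequence must be nonempty at every ordinal; at ordinals not above
    \<open>y\<close> the empty set is a filler, never met since faintness returns ordinals above
    \<open>y\<close>.\<close>
  let ?P = "\<lambda>k A. ext A \<subseteq> ext k \<and> ((y \<in> ext k \<and> (succ_code k A \<or> cof_code k A \<or> pow_code k A)) \<or> (y \<notin> ext k \<and> A = e0))"
  define F where "F k = mk {A. A \<in> M \<and> ?P k A}" for k
  have eF: "ext (F k) = {A. A \<in> M \<and> ?P k A}" if k: "k \<in> Ord" for k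
  proof -
    have "D True (\<lambda>s. ?P k (s 0))" by (intro dfn DT_Ord_const[OF yO] DT_Ord_const[OF k])
    from sep[where P = "?P k", OF Pw_M[of k] this]
    have "isset {A \<in> ext (Pw k). ?P k A}" .
    moreover have "{A \<in> ext (Pw k). ?P k A} = {A. A \<in> M \<and> ?P k A}" using ext_Pw[OF Ord_M[OF k]] by blast
    ultimately show ?thesis unfolding F_def by (simp add: ext_mk)
  qed
  have ne: "\<not> is_empty M E (F k)" if k: "k \<in> Ord" for k
  proof -
    have "\<exists>A\<in>M. ?P k A"
    proof (cases "y \<in> ext k")
      case True
      have "\<not> strongly_inaccessible N E k" using no y(1)[OF k True] k unfolding ext_iff by blast
      then show ?thesis using ex_code[OF k y(2)[OF k True]] True by blast
    next
      case False
      then show ?thesis by (intro bexI[of _ e0]) auto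
    qed
    then show ?thesis using eF[OF k] unfolding is_empty_def ext_def by blast
  qed
  have DF: "DT True (\<lambda>s. F (s 0))" unfolding F_def by (intro dfn DT_Ord_const[OF yO])
  have "D True (\<lambda>s. s 1 = F (s 0))" using DF by (intro dfn)
  then obtain p s where ps: "range s \<subseteq> M"
    "\<And>a b. a \<in> M \<Longrightarrow> b \<in> M \<Longrightarrow> sat M E (s(0 := a, 1 := b)) p \<longleftrightarrow> b = F a"
    by (rule D_sat2[where R = "\<lambda>a b. b = F a"]) blast
  have "F a \<in> M" for a by (simp add: F_def)
  then have def: "definable_Ord_sequence M E F"
    unfolding definable_Ord_sequence_def using ps Ord_M by blast
  have "\<forall>a\<in>Ord. \<not> is_empty M E (F a) \<and> (\<forall>A\<in>M. E A (F a) \<longrightarrow> subset_in M E A a)"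
  proof (intro ballI conjI impI ne)
    fix a A assume "a \<in> Ord" "A \<in> M" "E A (F a)"
    then have "A \<in> ext (F a)" by (simp add: ext_iff)
    then show "subset_in M E A a" using eF[OF \<open>a \<in> Ord\<close>] unfolding subset_in_iff by blast
  qed
  with faint[unfolded Ord_essentially_faint_def, THEN spec, THEN mp, OF conjI[OF def]] yO
  obtain a b A B where ab: "a \<in> Ord" "b \<in> Ord" "E y a" "E a b" "A \<in> M" "B \<in> M" "E A (F b)"
    "is_inter M E A a B" "E B (F a)" by blast
  have ya: "y \<in> ext a" and a_b: "a \<in> ext b" using ab yO by (auto simp: ext_iff)
  then have yb: "y \<in> ext b" using Ord_trans[OF ab(2)] by blast
  have "A \<in> ext (F b)" "B \<in> ext (F a)" using ab by (simp_all add: ext_iff)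
  then have "?P b A" "?P a B" using eF[OF ab(1)] eF[OF ab(2)] by blast+
  moreover have "z \<in> ext B \<longleftrightarrow> z \<in> ext A" if "z \<in> ext a" for z
    using ab(8) that unfolding is_inter_def ext_iff by blast
  ultimately show False
    using no_coherence[OF ab(1) y(2)[OF ab(1) ya] ab(2) a_b ab(5,6)] ya yb by blast
qed

end

theorem theorem1p15:
  fixes M :: "'a set" and E :: "'a \<Rightarrow> 'a \<Rightarrow> bool"
  assumes "ZFC_model M E"
    and "Ord_essentially_faint M E"
  shows "\<forall>\<xi>\<in>Ords M E. \<exists>\<kappa>\<in>Ords M E. E \<xi> \<kappa> \<and> strongly_inaccessible (HOD M E) E \<kappa>"
  using zfc.inaccessible_in_HOD_above[OF zfc.intro, OF assms] by blast

end
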